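(* The set $G=\{E_A T_w \mid A\in\mathcal{P}_n,\ w\in S_n\}$ is a basis of $\mathcal{E}^{\mathcal{A}}_n(u)$ over $\mathcal{A}$, and it induces (via its images under the canonical maps) a $K$-basis of $\mathcal{E}_n(u)$ and a $\mathbb{C}$-basis of $\mathcal{E}_n(1)$.
   Context: Let $u$ be an indeterminate, $\mathcal{A}=\mathbb{C}[u,u^{-1}]$ and $K=\mathbb{C}(u)$. $\mathcal{E}^{\mathcal{A}}_n(u)$ is the associative unital $\mathcal{A}$-algebra on generators $T_1,\dots,T_{n-1}$, $E_1,\dots,E_{n-1}$ with relations: (E1) $T_iT_j=T_jT_i$ if $|i-j|>1$; (E2) $E_iE_j=E_jE_i$ for all $i,j$; (E3) $E_iT_j=T_jE_i$ if $|i-j|>1$; (E4) $E_i^2=E_i$; (E5) $E_iT_i=T_iE_i$; (E6) $T_iT_jT_i=T_jT_iT_j$ if $|i-j|=1$; (E7) $E_jT_iT_j=T_iT_jE_i$ if $|i-j|=1$; (E8) $E_iE_jT_j=E_iT_jE_i=T_jE_iE_j$ if $|i-j|=1$; (E9) $T_i^2=1+(u-1)E_i(1+T_i)$. Put $\mathcal{E}_n(u)=\mathcal{E}^{\mathcal{A}}_n(u)\otimes_{\mathcal{A}}K$ and $\mathcal{E}_n(1)=\mathcal{E}^{\mathcal{A}}_n(u)\otimes_{\mathcal{A}}\mathbb{C}$, where $\mathbb{C}$ is an $\mathcal{A}$-module via $u\mapsto 1$. Each $T_i$ is invertible with $T_i^{-1}=T_i+(u^{-1}-1)E_i(1+T_i)$.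 For $1\le i<j\le n$ put $E_{ij}=E_i$ if $j=i+1$ and otherwise $E_{ij}=T_iT_{i+1}\cdots T_{j-2}E_{j-1}T_{j-2}^{-1}\cdots T_{i+1}^{-1}T_i^{-1}$. For nonempty $I\subset\mathbf{n}:=\{1,\dots,n\}$ put $E_I=\prod_{(i,j)\in I\times I,\ i<j}E_{ij}$ ($E_I=1$ if $|I|=1$); the $E_{ij}$ commute, so the order is irrelevant. $\mathcal{P}_n$ is the set of all set partitions of $\mathbf{n}$; for $A=\{I_1,\dots,I_k\}\in\mathcal{P}_n$ put $E_A=\prod_iE_{I_i}$. $S_n$ is the symmetric group, $s_i=(i,i+1)$, and $T_w=T_{i_1}\cdots T_{i_r}$ for any reduced expression $w=s_{i_1}\cdots s_{i_r}$. *)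

theory Defs
  imports
    "HOL-Algebra.QuotRing"
    "HOL-Algebra.Generated_Groups"
    "HOL-Algebra.Sym_Groups"
    "HOL-Library.Disjoint_Sets"
    "HOL-Library.Poly_Mapping"
    "HOL-Computational_Algebra.Polynomial_Factorial"
    "Jordan_Normal_Form.VS_Connect"
begin

text \<open>\<^const>\<open>LinearCombinations.module.lin_dep\<close> and
  \<^const>\<open>LinearCombinations.module.span\<close> make sense over any commutative ring;
  \<^const>\<open>vectorspace.basis\<close> is only available over a field.\<close>

definition module_basis ::
    "('r, 'x) ring_scheme \<Rightarrow> ('r, 'm, 'y) module_scheme \<Rightarrow> 'm set \<Rightarrow> bool" where
  "module_basis R M B \<longleftrightarrow>
     Module.module R M \<and> B \<subseteq> carrier M \<and> \<not> LinearCombinations.module.lin_dep R M B \<and>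
     LinearCombinations.module.span R M B = carrier M"

definition list_prod :: "('g, 'x) monoid_scheme \<Rightarrow> 'g list \<Rightarrow> 'g" where
  "list_prod G xs = foldr (\<lambda>x y. x \<otimes>\<^bsub>G\<^esub> y) xs \<one>\<^bsub>G\<^esub>"

definition monoid_ring :: "('g, 'x) monoid_scheme \<Rightarrow> ('g \<Rightarrow>\<^sub>0 'r::comm_ring_1) ring" where
  "monoid_ring G =
    \<lparr>carrier = {p. Poly_Mapping.keys p \<subseteq> carrier G},
     monoid.mult = (\<lambda>p q. \<Sum>g\<in>Poly_Mapping.keys p. \<Sum>h\<in>Poly_Mapping.keys q.
               Poly_Mapping.single (g \<otimes>\<^bsub>G\<^esub> h) (Poly_Mapping.lookup p g * Poly_Mapping.lookup q h)),
     one = Poly_Mapping.single \<one>\<^bsub>G\<^esub> 1,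
     zero = 0,
     add = (+)\<rparr>"

definition free_monoid :: "'a set \<Rightarrow> 'a list monoid" where
  "free_monoid X = \<lparr>carrier = lists X, monoid.mult = (@), one = []\<rparr>"

definition free_algebra :: "'a set \<Rightarrow> ('r::comm_ring_1, 'a list \<Rightarrow>\<^sub>0 'r) module" where
  "free_algebra X =
     ring.extend (monoid_ring (free_monoid X))
       (module.fields (\<lambda>a p. Poly_Mapping.map ((*) a) p))"

definition quotient_algebra ::
    "('a, 'b, 'x) module_scheme \<Rightarrow> 'b set \<Rightarrow> ('a, 'b set) module" where
  "quotient_algebra F I =
     ring.extend (F Quot I) (module.fields (\<lambda>a X. \<Union>x\<in>X. I +>\<^bsub>F\<^esub> (a \<odot>\<^bsub>F\<^esub> x)))"


text \<open>Extension of scalars \<open>M \<otimes>\<^sub>R S\<close> of an \<open>R\<close>-algebra \<open>M\<close> along a ring homomorphism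
  \<open>h : R \<rightarrow> S\<close>: the free abelian group on the pairs \<open>(m, s)\<close> modulo the subgroup generated by the
  bilinearity and balancing relators.  The free abelian group on the pairs, seen as the integral
  monoid ring of the product of the multiplicative monoids, already carries the product
  \<open>(m, s) (m', s') = (m m', s s')\<close> and the action \<open>c (m, s) = (m, c s)\<close> which the tensor product
  inherits.  The free group itself is not an \<open>S\<close>-module, only its quotient is.\<close>

definition tensor_free ::
    "('r, 'm, 'x) module_scheme \<Rightarrow> ('s, 'y) ring_scheme \<Rightarrow> ('s, ('m \<times> 's) \<Rightarrow>\<^sub>0 int) module" where
  "tensor_free M S =
     ring.extend (monoid_ring (M \<times>\<times> S))
       (module.fields (\<lambda>c p. \<Sum>(m, s)\<in>Poly_Mapping.keys p.
          Poly_Mapping.single (m, c \<otimes>\<^bsub>S\<^esub> s) (Poly_Mapping.lookup p (m, s))))"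

inductive_set tensor_relators ::
    "('r, 'z) ring_scheme \<Rightarrow> ('r, 'm, 'x) module_scheme \<Rightarrow> ('s, 'y) ring_scheme \<Rightarrow> ('r \<Rightarrow> 's)
      \<Rightarrow> (('m \<times> 's) \<Rightarrow>\<^sub>0 int) set"
  for R M S h where
  add_left: "\<lbrakk>m \<in> carrier M; m' \<in> carrier M; s \<in> carrier S\<rbrakk> \<Longrightarrow>
     Poly_Mapping.single (m \<oplus>\<^bsub>M\<^esub> m', s) 1
       - (Poly_Mapping.single (m, s) 1 + Poly_Mapping.single (m', s) 1)
     \<in> tensor_relators R M S h"
| add_right: "\<lbrakk>m \<in> carrier M; s \<in> carrier S; s' \<in> carrier S\<rbrakk> \<Longrightarrow>
     Poly_Mapping.single (m, s \<oplus>\<^bsub>S\<^esub> s') 1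
       - (Poly_Mapping.single (m, s) 1 + Poly_Mapping.single (m, s') 1)
     \<in> tensor_relators R M S h"
| balanced: "\<lbrakk>r \<in> carrier R; m \<in> carrier M; s \<in> carrier S\<rbrakk> \<Longrightarrow>
     Poly_Mapping.single (r \<odot>\<^bsub>M\<^esub> m, s) 1 - Poly_Mapping.single (m, h r \<otimes>\<^bsub>S\<^esub> s) 1
     \<in> tensor_relators R M S h"

definition tensor_subgroup ::
    "('r, 'z) ring_scheme \<Rightarrow> ('r, 'm, 'x) module_scheme \<Rightarrow> ('s, 'y) ring_scheme \<Rightarrow> ('r \<Rightarrow> 's)
      \<Rightarrow> (('m \<times> 's) \<Rightarrow>\<^sub>0 int) set" where
  "tensor_subgroup R M S h = generate (add_monoid (tensor_free M S)) (tensor_relators R M S h)"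

definition extension_of_scalars ::
    "('r, 'z) ring_scheme \<Rightarrow> ('r, 'm, 'x) module_scheme \<Rightarrow> ('s, 'y) ring_scheme \<Rightarrow> ('r \<Rightarrow> 's)
      \<Rightarrow> ('s, (('m \<times> 's) \<Rightarrow>\<^sub>0 int) set) module" where
  "extension_of_scalars R M S h = quotient_algebra (tensor_free M S) (tensor_subgroup R M S h)"

definition pure_tensor ::
    "('r, 'z) ring_scheme \<Rightarrow> ('r, 'm, 'x) module_scheme \<Rightarrow> ('s, 'y) ring_scheme \<Rightarrow> ('r \<Rightarrow> 's)
      \<Rightarrow> 'm \<Rightarrow> 's \<Rightarrow> (('m \<times> 's) \<Rightarrow>\<^sub>0 int) set" where
  "pure_tensor R M S h m s =
     tensor_subgroup R M S h +>\<^bsub>tensor_free M S\<^esub> Poly_Mapping.single (m, s) 1"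

definition canonical_map ::
    "('r, 'z) ring_scheme \<Rightarrow> ('r, 'm, 'x) module_scheme \<Rightarrow> ('s, 'y) ring_scheme \<Rightarrow> ('r \<Rightarrow> 's)
      \<Rightarrow> 'm \<Rightarrow> (('m \<times> 's) \<Rightarrow>\<^sub>0 int) set" where
  "canonical_map R M S h m = pure_tensor R M S h m \<one>\<^bsub>S\<^esub>"


text \<open>The Laurent polynomial ring \<open>\<complex>[u, u\<^sup>-\<^sup>1]\<close> is the group algebra of the integers: the
  coefficient of \<open>u\<^sup>k\<close> in \<open>f\<close> is \<open>lookup f k\<close>, and the product of the type is convolution.
  The field \<open>\<complex>(u)\<close> is the fraction field of \<open>\<complex>[u]\<close>.\<close>

type_synonym laurent = "int \<Rightarrow>\<^sub>0 complex"
type_synonym ratfun = "complex poly fract"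

definition laurent_u :: laurent where
  "laurent_u = Poly_Mapping.single 1 1"

definition laurent_eval :: "(complex \<Rightarrow> 'k::field) \<Rightarrow> 'k \<Rightarrow> laurent \<Rightarrow> 'k" where
  "laurent_eval \<phi> x f = (\<Sum>k\<in>Poly_Mapping.keys f. \<phi> (Poly_Mapping.lookup f k) * x powi k)"

definition laurent_to_ratfun :: "laurent \<Rightarrow> ratfun" where
  "laurent_to_ratfun = laurent_eval (\<lambda>c. to_fract [:c:]) (to_fract [:0, 1:])"

definition laurent_at_1 :: "laurent \<Rightarrow> complex" where
  "laurent_at_1 = laurent_eval (\<lambda>c. c) 1"


text \<open>The algebra of braids and ties on \<open>n\<close> strands.\<close>

datatype bt_gen = T nat | E nat

definition bt_gens :: "nat \<Rightarrow> bt_gen set" where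
  "bt_gens n = T ` {1..<n} \<union> E ` {1..<n}"

abbreviation bt_free :: "nat \<Rightarrow> (laurent, bt_gen list \<Rightarrow>\<^sub>0 laurent) module" where
  "bt_free n \<equiv> free_algebra (bt_gens n)"

abbreviation bt_word :: "bt_gen list \<Rightarrow> (bt_gen list \<Rightarrow>\<^sub>0 laurent)" where
  "bt_word w \<equiv> Poly_Mapping.single w 1"

inductive_set bt_relations ::
    "nat \<Rightarrow> ((bt_gen list \<Rightarrow>\<^sub>0 laurent) \<times> (bt_gen list \<Rightarrow>\<^sub>0 laurent)) set"
  for n where
  E1: "\<lbrakk>i \<in> {1..<n}; j \<in> {1..<n}; \<bar>int i - int j\<bar> > 1\<rbrakk> \<Longrightarrow>
    (bt_word [T i, T j], bt_word [T j, T i]) \<in> bt_relations n"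
| E2: "\<lbrakk>i \<in> {1..<n}; j \<in> {1..<n}\<rbrakk> \<Longrightarrow>
    (bt_word [E i, E j], bt_word [E j, E i]) \<in> bt_relations n"
| E3: "\<lbrakk>i \<in> {1..<n}; j \<in> {1..<n}; \<bar>int i - int j\<bar> > 1\<rbrakk> \<Longrightarrow>
    (bt_word [E i, T j], bt_word [T j, E i]) \<in> bt_relations n"
| E4: "i \<in> {1..<n} \<Longrightarrow>
    (bt_word [E i, E i], bt_word [E i]) \<in> bt_relations n"
| E5: "i \<in> {1..<n} \<Longrightarrow>
    (bt_word [E i, T i], bt_word [T i, E i]) \<in> bt_relations n"
| E6: "\<lbrakk>i \<in> {1..<n}; j \<in> {1..<n}; \<bar>int i - int j\<bar> = 1\<rbrakk> \<Longrightarrow>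
    (bt_word [T i, T j, T i], bt_word [T j, T i, T j]) \<in> bt_relations n"
| E7: "\<lbrakk>i \<in> {1..<n}; j \<in> {1..<n}; \<bar>int i - int j\<bar> = 1\<rbrakk> \<Longrightarrow>
    (bt_word [E j, T i, T j], bt_word [T i, T j, E i]) \<in> bt_relations n"
| E8_left: "\<lbrakk>i \<in> {1..<n}; j \<in> {1..<n}; \<bar>int i - int j\<bar> = 1\<rbrakk> \<Longrightarrow>
    (bt_word [E i, E j, T j], bt_word [E i, T j, E i]) \<in> bt_relations n"
| E8_right: "\<lbrakk>i \<in> {1..<n}; j \<in> {1..<n}; \<bar>int i - int j\<bar> = 1\<rbrakk> \<Longrightarrow>
    (bt_word [E i, T j, E i], bt_word [T j, E i, E j]) \<in> bt_relations n"
| E9: "i \<in> {1..<n} \<Longrightarrow>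
    (bt_word [T i, T i],
     \<one>\<^bsub>bt_free n\<^esub> \<oplus>\<^bsub>bt_free n\<^esub>
       (laurent_u - 1) \<odot>\<^bsub>bt_free n\<^esub>
         (bt_word [E i] \<otimes>\<^bsub>bt_free n\<^esub> (\<one>\<^bsub>bt_free n\<^esub> \<oplus>\<^bsub>bt_free n\<^esub> bt_word [T i])))
    \<in> bt_relations n"

definition bt_ideal :: "nat \<Rightarrow> (bt_gen list \<Rightarrow>\<^sub>0 laurent) set" where
  "bt_ideal n = Idl\<^bsub>bt_free n\<^esub> {p \<ominus>\<^bsub>bt_free n\<^esub> q | p q. (p, q) \<in> bt_relations n}"

definition bt_algebra :: "nat \<Rightarrow> (laurent, (bt_gen list \<Rightarrow>\<^sub>0 laurent) set) module" where
  "bt_algebra n = quotient_algebra (bt_free n) (bt_ideal n)"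

definition bt_T :: "nat \<Rightarrow> nat \<Rightarrow> (bt_gen list \<Rightarrow>\<^sub>0 laurent) set" where
  "bt_T n i = bt_ideal n +>\<^bsub>bt_free n\<^esub> bt_word [T i]"

definition bt_E :: "nat \<Rightarrow> nat \<Rightarrow> (bt_gen list \<Rightarrow>\<^sub>0 laurent) set" where
  "bt_E n i = bt_ideal n +>\<^bsub>bt_free n\<^esub> bt_word [E i]"


text \<open>The product \<open>T\<^sub>i \<dots> T\<^sub>j\<^sub>-\<^sub>2 E\<^sub>j\<^sub>-\<^sub>1 T\<^sub>j\<^sub>-\<^sub>2\<^sup>-\<^sup>1 \<dots> T\<^sub>i\<^sup>-\<^sup>1\<close>; for \<open>j = i + 1\<close> both outer lists are
  empty and it is \<open>E\<^sub>i\<close>.\<close>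

definition bt_E_pair :: "nat \<Rightarrow> nat \<Rightarrow> nat \<Rightarrow> (bt_gen list \<Rightarrow>\<^sub>0 laurent) set" where
  "bt_E_pair n i j =
     list_prod (bt_algebra n)
       (map (bt_T n) [i..<j - 1] @ [bt_E n (j - 1)]
        @ map (\<lambda>k. inv\<^bsub>bt_algebra n\<^esub> bt_T n k) (rev [i..<j - 1]))"

text \<open>\<^const>\<open>finprod\<close> is used here in a noncommutative ring.  It denotes the product in any order,
  because the factors \<open>E\<^sub>i\<^sub>j\<close> commute with each other.\<close>

definition bt_E_block :: "nat \<Rightarrow> nat set \<Rightarrow> (bt_gen list \<Rightarrow>\<^sub>0 laurent) set" where
  "bt_E_block n I =
     finprod (bt_algebra n) (\<lambda>(i, j). bt_E_pair n i j) {(i, j) \<in> I \<times> I. i < j}"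

definition bt_E_partition :: "nat \<Rightarrow> nat set set \<Rightarrow> (bt_gen list \<Rightarrow>\<^sub>0 laurent) set" where
  "bt_E_partition n A = finprod (bt_algebra n) (bt_E_block n) A"

definition word_perm :: "nat \<Rightarrow> nat list \<Rightarrow> (nat \<Rightarrow> nat)" where
  "word_perm n is = list_prod (sym_group n) (map (\<lambda>i. Transposition.transpose i (i + 1)) is)"

definition reduced_word :: "nat \<Rightarrow> (nat \<Rightarrow> nat) \<Rightarrow> nat list \<Rightarrow> bool" where
  "reduced_word n w = is_arg_min length (\<lambda>is. set is \<subseteq> {1..<n} \<and> word_perm n is = w)"

text \<open>By the braid relations the product does not depend on the reduced expression chosen.\<close>

definition bt_T_perm :: "nat \<Rightarrow> (nat \<Rightarrow> nat) \<Rightarrow> (bt_gen list \<Rightarrow>\<^sub>0 laurent) set" where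
  "bt_T_perm n w = list_prod (bt_algebra n) (map (bt_T n) (SOME is. reduced_word n w is))"

definition bt_G :: "nat \<Rightarrow> (bt_gen list \<Rightarrow>\<^sub>0 laurent) set set" where
  "bt_G n =
     {bt_E_partition n A \<otimes>\<^bsub>bt_algebra n\<^esub> bt_T_perm n w | A w.
        partition_on {1..n} A \<and> w \<in> carrier (sym_group n)}"


abbreviation laurent_ring :: "laurent ring" where "laurent_ring \<equiv> class_ring"
abbreviation ratfun_field :: "ratfun ring" where "ratfun_field \<equiv> class_ring"
abbreviation complex_field :: "complex ring" where "complex_field \<equiv> class_ring"

definition bt_algebra_generic ::
    "nat \<Rightarrow> (ratfun, (((bt_gen list \<Rightarrow>\<^sub>0 laurent) set \<times> ratfun) \<Rightarrow>\<^sub>0 int) set) module" where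
  "bt_algebra_generic n =
     extension_of_scalars laurent_ring (bt_algebra n) ratfun_field laurent_to_ratfun"

definition bt_algebra_at_1 ::
    "nat \<Rightarrow> (complex, (((bt_gen list \<Rightarrow>\<^sub>0 laurent) set \<times> complex) \<Rightarrow>\<^sub>0 int) set) module" where
  "bt_algebra_at_1 n =
     extension_of_scalars laurent_ring (bt_algebra n) complex_field laurent_at_1"

end

theory Submission
  imports Defs
begin

text \<open>\<^bold>\<open>Spanning.\<close>  The element \<open>E\<^sub>i\<^sub>j\<close> makes sense for every unordered pair of strands, and
\<open>T\<^sub>k E\<^sub>i\<^sub>j = E\<^sub>s\<^sub>(\<^sub>i\<^sub>)\<^sub>s\<^sub>(\<^sub>j\<^sub>) T\<^sub>k\<close> with \<open>s = s\<^sub>k\<close> (\<open>t_link\<close>).  Any identity between the \<open>E\<^sub>i\<^sub>j\<close> can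
therefore be moved along the symmetric group, and it suffices to check it on the first few strands:
the \<open>E\<^sub>i\<^sub>j\<close> are commuting idempotents (\<open>link_commute\<close>, \<open>link_idem\<close>), and \<open>E\<^sub>i\<^sub>j E\<^sub>j\<^sub>k\<close> absorbs \<open>E\<^sub>i\<^sub>k\<close>
(\<open>link_triangle\<close>).  So the pairs absorbed by a given element form an equivalence relation, whence
\<open>E\<^sub>A E\<^sub>i\<^sub>j = E\<^sub>B\<close>, where \<open>B\<close> arises from \<open>A\<close> by merging the blocks of \<open>i\<close> and \<open>j\<close>
(\<open>tie_partition_link\<close>).  By Matsumoto's theorem (\<open>braid_word_reduced_unique\<close>) \<open>T\<^sub>w\<close> depends on \<open>w\<close>
only.  Multiplication by generators from the right preserves the span of the \<open>E\<^sub>A T\<^sub>w\<close>: one has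
\<open>T\<^sub>w E\<^sub>i = E\<^sub>w\<^sub>(\<^sub>i\<^sub>)\<^sub>w\<^sub>(\<^sub>i\<^sub>+\<^sub>1\<^sub>) T\<^sub>w\<close>, and \<open>T\<^sub>w T\<^sub>i\<close> is \<open>T\<^sub>v\<close> with \<open>v = w s\<^sub>i\<close> if \<open>w\<close> has an ascent at \<open>i\<close> and
otherwise \<open>T\<^sub>v T\<^sub>i\<^sup>2 = T\<^sub>v + (u - 1) T\<^sub>v E\<^sub>i (1 + T\<^sub>i)\<close>.  The span contains \<open>1\<close>, so it is everything.

\<^bold>\<open>Independence.\<close>  Fix a colouring \<open>c\<close> of the strands.  The algebra acts on functions of arrangements
\<open>w\<close> of the strands: \<open>E\<^sub>i\<close> restricts a function to the arrangements whose strands in positions \<open>i\<close> and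
\<open>i + 1\<close> have equal colours, while \<open>T\<^sub>i\<close> swaps these strands if their colours differ and acts as a
generator of the Iwahori--Hecke algebra if they agree (\<open>rep_relations\<close>).  Then \<open>E\<^sub>A\<close> restricts to the
arrangements for which \<open>c\<close> is constant on the blocks of \<open>A\<close>, and evaluating \<open>T\<^sub>w f\<close> at the identity
arrangement gives \<open>f w\<close>, because along a reduced word only ascents occur and no lower terms appear.
So \<open>E\<^sub>A T\<^sub>w\<close> has the matrix coefficient \<open>1\<close> at \<open>(id, w')\<close> if \<open>c\<close> is constant on the blocks of \<open>A\<close>
and \<open>w = w'\<close>, and \<open>0\<close> otherwise (\<open>matrix_coeff_std\<close>).  Colouring by the blocks of a partition \<open>B\<close>
turns a vanishing linear combination into the statement that for each \<open>w\<close> the coefficients of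
the \<open>E\<^sub>A T\<^sub>w\<close> with \<open>A\<close> finer than \<open>B\<close> sum to \<open>0\<close>; induction along refinement kills all
coefficients (\<open>std_coeffs_zero\<close>).

\<^bold>\<open>Specialisation.\<close>  The coordinate functionals of a finite basis extend along any homomorphism of
commutative rings, so a finite basis stays a basis after extension of scalars
(\<open>module_basis_extension\<close>).  Both \<open>\<E>\<^sub>n(u)\<close> and \<open>\<E>\<^sub>n(1)\<close> are such extensions.\<close>

section \<open>Inversions and reduced words in the symmetric group\<close>

abbreviation adj :: "nat \<Rightarrow> nat \<Rightarrow> nat" where
  "adj i \<equiv> Transposition.transpose i (Suc i)"

definition inversions :: "nat \<Rightarrow> (nat \<Rightarrow> nat) \<Rightarrow> (nat \<times> nat) set" where
  "inversions n w = {(a, b). 1 \<le> a \<and> a < b \<and> b \<le> n \<and> w b < w a}"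

lemma finite_inversions: "finite (inversions n w)"
  by (rule finite_subset[of _ "{1..n} \<times> {1..n}"]) (auto simp: inversions_def)

lemma inversions_id: "inversions n id = {}"
  by (auto simp: inversions_def)

lemma adj_mono: "a < b \<Longrightarrow> (a, b) \<noteq> (i, Suc i) \<Longrightarrow> adj i a < adj i b"
  by (auto simp: Transposition.transpose_def)

lemma adj_permutes: "i \<in> {1..<n} \<Longrightarrow> adj i permutes {1..n}"
  by (rule permutes_swap_id) auto

lemma adj_in: "i \<in> {1..<n} \<Longrightarrow> a \<in> {1..n} \<Longrightarrow> adj i a \<in> {1..n}"
  using permutes_in_image[OF adj_permutes] by blast

text \<open>At an ascent \<open>i\<close> of \<open>w\<close>: relabelling positions by \<open>s\<^sub>i\<close> preserves the order of every pair of positions except \<open>(i, i + 1)\<close>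
  itself (\<open>adj_mono\<close>), so the inversions of \<open>w s\<^sub>i\<close> are the relabelled inversions of \<open>w\<close> and this one pair.\<close>

lemma inversions_ascent:
  assumes "i \<in> {1..<n}" "w i < w (Suc i)"
  shows "inversions n (w \<circ> adj i) = insert (i, Suc i) (map_prod (adj i) (adj i) ` inversions n w)"
    (is "?L = ?R")
proof
  show "?L \<subseteq> ?R"
  proof
    fix p assume "p \<in> ?L"
    then obtain a b where p: "p = (a, b)" "1 \<le> a" "a < b" "b \<le> n" "w (adj i b) < w (adj i a)"
      by (auto simp: inversions_def)
    show "p \<in> ?R"
    proof (cases "(a, b) = (i, Suc i)")
      case True
      then show ?thesis using p by simp
    next
      case False
      have "adj i a \<in> {1..n}" "adj i b \<in> {1..n}"
        using adj_in[OF assms(1)] p by auto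
      then have "(adj i a, adj i b) \<in> inversions n w"
        using adj_mono[OF p(3) False] p by (auto simp: inversions_def)
      then have "map_prod (adj i) (adj i) (adj i a, adj i b) \<in> map_prod (adj i) (adj i) ` inversions n w"
        by (rule imageI)
      then show ?thesis using p by simp
    qed
  qed
  show "?R \<subseteq> ?L"
  proof
    fix p assume "p \<in> ?R"
    then consider "p = (i, Suc i)"
      | a b where "p = (adj i a, adj i b)" "(a, b) \<in> inversions n w"
      by auto
    then show "p \<in> ?L"
    proof cases
      case 1
      then show ?thesis using assms by (auto simp: inversions_def)
    next
      case 2
      then have "(a, b) \<noteq> (i, Suc i)" "a < b" "a \<in> {1..n}" "b \<in> {1..n}"
        using assms by (auto simp: inversions_def)
      then show ?thesis
        using adj_mono[of a b i] adj_in[OF assms(1), of a] adj_in[OF assms(1), of b] 2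
        by (auto simp: inversions_def)
    qed
  qed
qed

lemma card_inversions_ascent:
  assumes "i \<in> {1..<n}" "w i < w (Suc i)"
  shows "card (inversions n (w \<circ> adj i)) = Suc (card (inversions n w))"
proof -
  have inj: "inj_on (map_prod (adj i) (adj i)) (inversions n w)"
    by (auto simp: inj_on_def transpose_eq_iff)
  have "(i, Suc i) \<notin> map_prod (adj i) (adj i) ` inversions n w"
  proof
    assume "(i, Suc i) \<in> map_prod (adj i) (adj i) ` inversions n w"
    then obtain a b where ab: "i = adj i a" "Suc i = adj i b" "(a, b) \<in> inversions n w" by auto
    then have "a = Suc i" "b = i" by (metis transpose_apply_first transpose_apply_second transpose_involutory)+
    then show False using ab by (auto simp: inversions_def)
  qed
  then show ?thesis
    unfolding inversions_ascent[of i n w, OF assms]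
    using finite_inversions[of n w] by (simp add: card_image[OF inj])
qed

lemma adj_adj: "w \<circ> adj i \<circ> adj i = (w :: nat \<Rightarrow> 'a)"
  by (auto simp: fun_eq_iff)

lemma card_inversions_descent:
  assumes "i \<in> {1..<n}" "w (Suc i) < w i"
  shows "card (inversions n w) = Suc (card (inversions n (w \<circ> adj i)))"
  using card_inversions_ascent[of i n "w \<circ> adj i"] assms by (simp add: adj_adj)

lemma permutes_adj_neq:
  assumes "w permutes S" shows "w i \<noteq> w (Suc i)"
  using injD[OF permutes_inj[OF assms], of i "Suc i"] by auto

lemma no_descent_imp_id:
  assumes w: "w permutes {1..n}" and asc: "\<And>i. i \<in> {1..<n} \<Longrightarrow> w i < w (Suc i)"
  shows "w = id"
proof (rule permutes_natset_ge[OF w])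
  have "1 \<le> i \<Longrightarrow> i \<le> n \<Longrightarrow> i \<le> w i" for i
  proof (induction i rule: dec_induct)
    case base
    then show ?case using permutes_in_image[OF w, of 1] by auto
  next
    case (step i)
    then show ?case using asc[of i] by force
  qed
  then show "\<forall>i\<in>{1..n}. i \<le> w i" by auto
qed

lemma word_perm_Nil: "word_perm n [] = id"
  by (simp add: word_perm_def list_prod_def sym_group_def)

lemma word_perm_Cons: "word_perm n (i # is) = adj i \<circ> word_perm n is"
  by (simp add: word_perm_def list_prod_def sym_group_def)

lemma word_perm_append: "word_perm n (xs @ ys) = word_perm n xs \<circ> word_perm n ys"
  by (induction xs) (auto simp: word_perm_Nil word_perm_Cons)

lemma word_perm_snoc: "word_perm n (xs @ [i]) = word_perm n xs \<circ> adj i"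
  by (simp add: word_perm_append word_perm_Cons word_perm_Nil)

lemma word_perm_permutes: "set is \<subseteq> {1..<n} \<Longrightarrow> word_perm n is permutes {1..n}"
proof (induction "is")
  case Nil
  show ?case unfolding word_perm_Nil by (rule permutes_id)
next
  case (Cons i js)
  then show ?case
    unfolding word_perm_Cons by (intro permutes_compose adj_permutes) simp_all
qed

lemma card_inversions_le_length:
  "set is \<subseteq> {1..<n} \<Longrightarrow> card (inversions n (word_perm n is)) \<le> length is"
proof (induction "is" rule: rev_induct)
  case Nil
  show ?case unfolding word_perm_Nil inversions_id by simp
next
  case (snoc i xs)
  let ?w = "word_perm n xs"
  have "?w i \<noteq> ?w (Suc i)"
    using permutes_adj_neq word_perm_permutes snoc.prems by (metis le_sup_iff set_append)
  then consider "?w i < ?w (Suc i)" | "?w (Suc i) < ?w i" by linarith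
  then have "card (inversions n (?w \<circ> adj i)) \<le> Suc (card (inversions n ?w))"
    using card_inversions_ascent[of i n ?w] card_inversions_descent[of i n ?w] snoc.prems
    by cases auto
  moreover have "card (inversions n ?w) \<le> length xs"
    using snoc by simp
  ultimately show ?case
    unfolding word_perm_snoc length_append_singleton by linarith
qed

lemma ex_word_of_length_inversions:
  assumes "w permutes {1..n}"
  shows "\<exists>is. set is \<subseteq> {1..<n} \<and> word_perm n is = w \<and> length is = card (inversions n w)"
  using assms
proof (induction "card (inversions n w)" arbitrary: w)
  case 0
  then have "inversions n w = {}" by (simp add: finite_inversions)
  have "w = id"
  proof (rule no_descent_imp_id[OF 0(2)])
    fix i assume i: "i \<in> {1..<n}"
    then have "\<not> w (Suc i) < w i" using \<open>inversions n w = {}\<close> by (force simp: inversions_def)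
    then show "w i < w (Suc i)" using permutes_adj_neq[OF 0(2), of i] by simp
  qed
  then show ?case using 0 by (intro exI[of _ "[]"]) (simp add: word_perm_Nil)
next
  case (Suc m)
  have "\<exists>i\<in>{1..<n}. w (Suc i) < w i"
  proof (rule ccontr)
    assume "\<not> ?thesis"
    then have "w = id"
      using no_descent_imp_id[OF Suc(3)] permutes_adj_neq[OF Suc(3)] by (meson linorder_neqE_nat)
    then show False using Suc(2) by (simp add: inversions_id)
  qed
  then obtain i where i: "i \<in> {1..<n}" "w (Suc i) < w i" by blast
  let ?v = "w \<circ> adj i"
  have v: "?v permutes {1..n}" using Suc(3) i adj_permutes permutes_compose by blast
  have m: "m = card (inversions n ?v)" using card_inversions_descent[of i n w] i Suc(2) by simp
  obtain js where "set js \<subseteq> {1..<n}" "word_perm n js = ?v" "length js = m"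
    using Suc(1)[OF m v] m by auto
  then show ?case
    using i Suc(2) by (intro exI[of _ "js @ [i]"]) (simp add: word_perm_snoc adj_adj)
qed

text \<open>The number of inversions is the length function: a letter changes it by one, and a permutation
  without descents is the identity, so following descents reaches the identity in exactly that many
  steps.\<close>

lemma reduced_word_iff:
  "reduced_word n w is \<longleftrightarrow>
    set is \<subseteq> {1..<n} \<and> word_perm n is = w \<and> length is = card (inversions n w)"
  (is "_ \<longleftrightarrow> ?R")
proof
  assume red: "reduced_word n w is"
  then have "is": "set is \<subseteq> {1..<n}" "word_perm n is = w"
    by (auto simp: reduced_word_def is_arg_min_def)
  obtain js where "set js \<subseteq> {1..<n}" "word_perm n js = w" "length js = card (inversions n w)"
    using ex_word_of_length_inversions[of w n] word_perm_permutes[of "is" n] "is" by blast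
  moreover from this have "\<not> length js < length is"
    using red by (auto simp: reduced_word_def is_arg_min_def)
  ultimately show ?R
    using "is" card_inversions_le_length[of "is" n] by simp
next
  assume ?R
  then show "reduced_word n w is"
    unfolding reduced_word_def is_arg_min_def using card_inversions_le_length[of _ n]
    by (metis not_less)
qed

lemma reduced_word_ex: "w permutes {1..n} \<Longrightarrow> \<exists>is. reduced_word n w is"
  using ex_word_of_length_inversions by (auto simp: reduced_word_iff)

lemma reduced_word_Nil: "reduced_word n id []"
  by (simp add: reduced_word_iff word_perm_Nil inversions_id)

lemma reduced_word_snoc:
  assumes "w permutes {1..n}" "i \<in> {1..<n}"
  shows "reduced_word n w (is @ [i]) \<longleftrightarrow> w (Suc i) < w i \<and> reduced_word n (w \<circ> adj i) is"
proof -
  have eq: "word_perm n (is @ [i]) = w \<longleftrightarrow> word_perm n is = w \<circ> adj i"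
    unfolding word_perm_snoc by (metis adj_adj)
  consider "w i < w (Suc i)" | "w (Suc i) < w i"
    using permutes_adj_neq[OF assms(1), of i] by linarith
  then show ?thesis
  proof cases
    case 1
    have "length (is @ [i]) \<noteq> card (inversions n w)"
      if "set is \<subseteq> {1..<n}" "word_perm n is = w \<circ> adj i"
      using card_inversions_le_length[OF that(1)] card_inversions_ascent[of i n w] 1 assms that(2)
      by simp
    then show ?thesis
      using 1 unfolding reduced_word_iff eq by auto
  next
    case 2
    then show ?thesis
      using assms card_inversions_descent[of i n w] unfolding reduced_word_iff eq by auto
  qed
qed

text \<open>Injective tuples form a single orbit of the symmetric group, which the adjacent transpositions
  generate.  This reduces an equivariant statement about distinct strands to one tuple.\<close>

lemma transport_along_adj:
  assumes step: "\<And>k xs. \<lbrakk>k \<in> {1..<n}; set xs \<subseteq> {1..n}; P xs\<rbrakk> \<Longrightarrow> P (map (adj k) xs)"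
    and P: "P xs"
    and d: "distinct xs" "distinct ys" "length xs = length ys" "set xs \<subseteq> {1..n}" "set ys \<subseteq> {1..n}"
  shows "P ys"
proof -
  have word: "set is \<subseteq> {1..<n} \<Longrightarrow> P (map (word_perm n is) xs)" for "is"
  proof (induction "is")
    case Nil
    then show ?case using P by (simp add: word_perm_Nil)
  next
    case (Cons i js)
    have "set (map (word_perm n js) xs) \<subseteq> {1..n}"
      using d(4) permutes_in_image[OF word_perm_permutes[of js n]] Cons.prems by auto
    then show ?case
      using step[of i "map (word_perm n js) xs"] Cons by (simp add: word_perm_Cons comp_def)
  qed
  obtain f where f: "bij_betw f (set xs) (set ys)" "map f xs = ys"
  proof -
    have "inj_on (\<lambda>x. the (map_of (zip xs ys) x)) (set xs)"
    proof (rule inj_onI)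
      fix x y assume x: "x \<in> set xs" and y: "y \<in> set xs"
        and eq: "the (map_of (zip xs ys) x) = the (map_of (zip xs ys) y)"
      obtain i j where "i < length xs" "x = xs ! i" "j < length xs" "y = xs ! j"
        using x y by (metis in_set_conv_nth)
      then show "x = y" using eq d by (simp add: map_of_zip_nth nth_eq_iff_index_eq)
    qed
    moreover have "map (\<lambda>x. the (map_of (zip xs ys) x)) xs = ys"
      using d by (auto intro!: nth_equalityI simp: map_of_zip_nth)
    ultimately show ?thesis
      using that[of "\<lambda>x. the (map_of (zip xs ys) x)"]
      by (metis bij_betw_def set_map)
  qed
  have "card ({1..n} - set xs) = card ({1..n} - set ys)"
    using d by (simp add: card_Diff_subset distinct_card)
  then obtain g where g: "bij_betw g ({1..n} - set xs) ({1..n} - set ys)"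
    by (meson bij_betw_iff_card finite_Diff finite_atLeastAtMost)
  define p where "p x = (if x \<in> set xs then f x else if x \<in> {1..n} then g x else x)" for x
  have "bij_betw p (set xs \<union> ({1..n} - set xs)) (set ys \<union> ({1..n} - set ys))"
  proof (rule bij_betw_combine)
    show "bij_betw p (set xs) (set ys)"
      using f(1) by (rule bij_betw_cong[THEN iffD1, rotated]) (simp add: p_def)
    show "bij_betw p ({1..n} - set xs) ({1..n} - set ys)"
      using g by (rule bij_betw_cong[THEN iffD1, rotated]) (simp add: p_def)
  qed auto
  then have "bij_betw p {1..n} {1..n}" using d by (simp add: Un_absorb1)
  then have "p permutes {1..n}"
    by (rule bij_imp_permutes) (use d in \<open>auto simp: p_def\<close>)
  then obtain "is" where "set is \<subseteq> {1..<n}" "word_perm n is = p"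
    using ex_word_of_length_inversions by blast
  then have "P (map p xs)" using word by blast
  moreover have "map p xs = map f xs" by (simp add: p_def)
  ultimately show ?thesis using f(2) by simp
qed

lemma adj_far_comm: "1 < \<bar>int i - int j\<bar> \<Longrightarrow> adj i \<circ> adj j = adj j \<circ> adj i"
  by (auto simp: fun_eq_iff Transposition.transpose_def)

lemma adj_braid: "adj i \<circ> adj (Suc i) \<circ> adj i = adj (Suc i) \<circ> adj i \<circ> adj (Suc i)"
  by (auto simp: fun_eq_iff Transposition.transpose_def)

lemma permutes_comp_adj: "w permutes {1..n} \<Longrightarrow> i \<in> {1..<n} \<Longrightarrow> w \<circ> adj i permutes {1..n}"
  using adj_permutes permutes_compose by blast

section \<open>Products of commuting elements\<close>

context monoid
begin

lemma list_prod_Nil [simp]: "list_prod G [] = \<one>"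
  by (simp add: list_prod_def)

lemma list_prod_Cons [simp]: "list_prod G (x # xs) = x \<otimes> list_prod G xs"
  by (simp add: list_prod_def)

lemma list_prod_closed [simp]: "set xs \<subseteq> carrier G \<Longrightarrow> list_prod G xs \<in> carrier G"
  by (induction xs) auto

lemma list_prod_append:
  "set xs \<subseteq> carrier G \<Longrightarrow> set ys \<subseteq> carrier G \<Longrightarrow>
    list_prod G (xs @ ys) = list_prod G xs \<otimes> list_prod G ys"
  by (induction xs) (auto simp: m_assoc)

text \<open>The products \<open>E\<^sub>I\<close> and \<open>E\<^sub>A\<close> are values of \<open>finprod\<close> in a noncommutative monoid.  Such a value is
  meaningful as soon as the factors commute with each other.\<close>

definition commuting :: "('i \<Rightarrow> 'a) \<Rightarrow> 'i set \<Rightarrow> bool" where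
  "commuting f A \<longleftrightarrow> f \<in> A \<rightarrow> carrier G \<and> (\<forall>x\<in>A. \<forall>y\<in>A. f x \<otimes> f y = f y \<otimes> f x)"

lemma commuting_insertD: "commuting f (insert a A) \<Longrightarrow> commuting f A"
  by (auto simp: commuting_def)

lemma commutingD: "commuting f A \<Longrightarrow> x \<in> A \<Longrightarrow> f x \<in> carrier G"
  by (auto simp: commuting_def)

lemma finprod_empty_monoid [simp]: "finprod G f {} = \<one>"
  by (simp add: finprod_def)

lemma finprod_commuting_insert:
  assumes "finite A" "commuting f (insert a A)" "a \<notin> A"
  shows "finprod G f (insert a A) = f a \<otimes> finprod G f A"
proof -
  interpret LCD "insert a A" "carrier G" "(\<otimes>) \<circ> f"
  proof
    fix x y z assume "x \<in> insert a A" "y \<in> insert a A" "z \<in> carrier G"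
    moreover from this have "f x \<in> carrier G" "f y \<in> carrier G" "f x \<otimes> f y = f y \<otimes> f x"
      using assms by (auto simp: commuting_def)
    ultimately show "((\<otimes>) \<circ> f) x (((\<otimes>) \<circ> f) y z) = ((\<otimes>) \<circ> f) y (((\<otimes>) \<circ> f) x z)"
      by (simp flip: m_assoc)
  qed (use assms in \<open>auto simp: commuting_def\<close>)
  show ?thesis
    unfolding finprod_def using foldD_insert[of A a \<one>] assms by (auto simp: commuting_def)
qed

lemma finprod_commuting_closed:
  "finite A \<Longrightarrow> commuting f A \<Longrightarrow> finprod G f A \<in> carrier G"
proof (induction A rule: finite_induct)
  case (insert a A)
  then show ?case
    using commuting_insertD[OF insert.prems] commutingD[OF insert.prems]
    by (simp add: finprod_commuting_insert)
qed simp

lemma finprod_commutes: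
  assumes "finite A" "commuting f A" "z \<in> carrier G" "\<And>x. x \<in> A \<Longrightarrow> f x \<otimes> z = z \<otimes> f x"
  shows "finprod G f A \<otimes> z = z \<otimes> finprod G f A"
  using assms
proof (induction A rule: finite_induct)
  case (insert a A)
  have f: "f a \<in> carrier G" "commuting f A"
    using commutingD[OF insert.prems(1)] commuting_insertD[OF insert.prems(1)] by auto
  have "finprod G f (insert a A) \<otimes> z = f a \<otimes> (z \<otimes> finprod G f A)"
    using insert f finprod_commuting_closed[of A f] by (simp add: finprod_commuting_insert m_assoc)
  also have "\<dots> = z \<otimes> (f a \<otimes> finprod G f A)"
    using insert.prems f finprod_commuting_closed[of A f] insert.hyps by (simp flip: m_assoc)
  finally show ?case
    using insert by (simp add: finprod_commuting_insert)
qed simp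

lemma finprod_absorbs_factor:
  assumes "finite A" "commuting f A" "x \<in> A" "z \<in> carrier G"
    and "\<And>y. y \<in> A \<Longrightarrow> f y \<otimes> z = z \<otimes> f y" "f x \<otimes> z = f x"
  shows "finprod G f A \<otimes> z = finprod G f A"
proof -
  define B where "B = A - {x}"
  have A: "A = insert x B" "x \<notin> B" "finite B" using assms by (auto simp: B_def)
  have f: "f x \<in> carrier G" "commuting f B"
    using assms(2,3) A commutingD commuting_insertD by metis+
  have fB: "finprod G f B \<in> carrier G" using A f finprod_commuting_closed by blast
  have prod: "finprod G f A = f x \<otimes> finprod G f B"
    unfolding A(1) by (rule finprod_commuting_insert) (use A assms(2) in auto)
  have "finprod G f B \<otimes> z = z \<otimes> finprod G f B"
    by (rule finprod_commutes) (use A assms f in auto)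
  then have "finprod G f A \<otimes> z = f x \<otimes> (z \<otimes> finprod G f B)"
    unfolding prod using f fB assms(4) by (simp add: m_assoc)
  also have "\<dots> = (f x \<otimes> z) \<otimes> finprod G f B"
    using f fB assms(4) by (simp add: m_assoc)
  finally show ?thesis
    unfolding prod assms(6) .
qed

lemma absorbs_finprod:
  assumes "finite A" "commuting f A" "y \<in> carrier G" "\<And>x. x \<in> A \<Longrightarrow> y \<otimes> f x = y"
  shows "y \<otimes> finprod G f A = y"
  using assms
proof (induction A rule: finite_induct)
  case (insert a A)
  have f: "f a \<in> carrier G" "commuting f A" "y \<otimes> f a = y"
    using insert.prems(3) commutingD[OF insert.prems(1)] commuting_insertD[OF insert.prems(1)] by auto
  have "y \<otimes> finprod G f (insert a A) = (y \<otimes> f a) \<otimes> finprod G f A"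
    using insert f(1,2) finprod_commuting_closed[of A f] m_assoc[of y "f a" "finprod G f A"]
    by (simp add: finprod_commuting_insert)
  then show ?case using insert f by simp
qed simp

lemma unit_cancel_right:
  assumes "x \<in> Units G" "a \<in> carrier G" "b \<in> carrier G" "a \<otimes> x = b \<otimes> x"
  shows "a = b"
proof -
  have "c = c \<otimes> x \<otimes> inv x" if "c \<in> carrier G" for c
    using that assms(1) by (simp add: m_assoc Units_closed)
  then show ?thesis using assms by metis
qed

lemma unit_inv_cancel: "x \<in> Units G \<Longrightarrow> y \<in> carrier G \<Longrightarrow> x \<otimes> (inv x \<otimes> y) = y"
  by (simp add: Units_closed flip: m_assoc)

text \<open>An intertwining relation survives conjugation by a unit that commutes with the intertwiner.  Since
  \<open>E\<^sub>i\<^sub>j\<close> is an iterated conjugate, this is the inductive step in its commutation rules.\<close>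

lemma intertwine_conj:
  assumes x: "x \<in> Units G" and c: "t \<in> carrier G" "a \<in> carrier G" "b \<in> carrier G"
    and tx: "t \<otimes> x = x \<otimes> t" and ab: "t \<otimes> a = b \<otimes> t"
  shows "t \<otimes> (x \<otimes> a \<otimes> inv x) = (x \<otimes> b \<otimes> inv x) \<otimes> t"
proof (rule unit_cancel_right[OF x])
  have xc: "x \<in> carrier G" "inv x \<in> carrier G" using x by auto
  have "t \<otimes> (x \<otimes> a \<otimes> inv x) \<otimes> x = x \<otimes> (t \<otimes> a)"
    using x xc c by (simp add: m_assoc) (simp add: tx flip: m_assoc)
  also have "\<dots> = x \<otimes> b \<otimes> (inv x \<otimes> x) \<otimes> t"
    using x xc c by (simp add: ab m_assoc)
  also have "\<dots> = (x \<otimes> b \<otimes> inv x) \<otimes> t \<otimes> x"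
    using xc c by (simp add: m_assoc tx)
  finally show "t \<otimes> (x \<otimes> a \<otimes> inv x) \<otimes> x = (x \<otimes> b \<otimes> inv x) \<otimes> t \<otimes> x" .
qed (use assms in auto)

end

section \<open>Ties between arbitrary strands\<close>

text \<open>The multiplicative content of the defining relations.  The quadratic relation enters only through
  two of its consequences: \<open>t i\<close> is a unit, and its square commutes with the neighbouring \<open>e j\<close>.\<close>

locale braids_ties = monoid G for G (structure) +
  fixes n :: nat and t e :: "nat \<Rightarrow> 'a"
  assumes t_unit: "i \<in> {1..<n} \<Longrightarrow> t i \<in> Units G"
    and e_closed: "i \<in> {1..<n} \<Longrightarrow> e i \<in> carrier G"
    and t_far: "\<lbrakk>i \<in> {1..<n}; j \<in> {1..<n}; \<bar>int i - int j\<bar> > 1\<rbrakk> \<Longrightarrow> t i \<otimes> t j = t j \<otimes> t i"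
    and e_comm: "\<lbrakk>i \<in> {1..<n}; j \<in> {1..<n}\<rbrakk> \<Longrightarrow> e i \<otimes> e j = e j \<otimes> e i"
    and et_far: "\<lbrakk>i \<in> {1..<n}; j \<in> {1..<n}; \<bar>int i - int j\<bar> > 1\<rbrakk> \<Longrightarrow> e i \<otimes> t j = t j \<otimes> e i"
    and e_idem: "i \<in> {1..<n} \<Longrightarrow> e i \<otimes> e i = e i"
    and et_same: "i \<in> {1..<n} \<Longrightarrow> e i \<otimes> t i = t i \<otimes> e i"
    and t_braid: "\<lbrakk>i \<in> {1..<n}; j \<in> {1..<n}; \<bar>int i - int j\<bar> = 1\<rbrakk> \<Longrightarrow>
      t i \<otimes> (t j \<otimes> t i) = t j \<otimes> (t i \<otimes> t j)"
    and ett: "\<lbrakk>i \<in> {1..<n}; j \<in> {1..<n}; \<bar>int i - int j\<bar> = 1\<rbrakk> \<Longrightarrow>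
      e j \<otimes> (t i \<otimes> t j) = t i \<otimes> (t j \<otimes> e i)"
    and eet: "\<lbrakk>i \<in> {1..<n}; j \<in> {1..<n}; \<bar>int i - int j\<bar> = 1\<rbrakk> \<Longrightarrow>
      e i \<otimes> (e j \<otimes> t j) = t j \<otimes> (e i \<otimes> e j)"
    and tte: "\<lbrakk>i \<in> {1..<n}; j \<in> {1..<n}; \<bar>int i - int j\<bar> = 1\<rbrakk> \<Longrightarrow>
      t i \<otimes> (t i \<otimes> e j) = e j \<otimes> (t i \<otimes> t i)"
begin

lemma t_closed [simp]: "i \<in> {1..<n} \<Longrightarrow> t i \<in> carrier G"
  using t_unit by blast

lemma inv_t_closed [simp]: "i \<in> {1..<n} \<Longrightarrow> inv t i \<in> carrier G"
  using t_unit by blast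

declare e_closed [simp]

definition tie :: "nat \<Rightarrow> nat \<Rightarrow> 'a" where
  "tie i j = list_prod G
     (map t [i..<j - 1] @ [e (j - 1)] @ map (\<lambda>k. inv t k) (rev [i..<j - 1]))"

lemma tie_base: "i \<in> {1..<n} \<Longrightarrow> tie i (Suc i) = e i"
  by (simp add: tie_def)

lemma tie_step:
  assumes "1 \<le> i" "Suc i < j" "j \<le> n"
  shows "tie i j = t i \<otimes> tie (Suc i) j \<otimes> inv t i"
proof -
  have u: "[i..<j - 1] = i # [Suc i..<j - 1]" using assms by (simp add: upt_conv_Cons)
  have "e (j - 1) \<in> carrier G" using assms by (intro e_closed) auto
  then have c: "set (map t [Suc i..<j - 1] @ [e (j - 1)] @ map (\<lambda>k. inv t k) (rev [Suc i..<j - 1])) \<subseteq> carrier G"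
    using assms by auto
  have l: "map t [i..<j - 1] @ [e (j - 1)] @ map (\<lambda>k. inv t k) (rev [i..<j - 1]) =
    t i # (map t [Suc i..<j - 1] @ [e (j - 1)] @ map (\<lambda>k. inv t k) (rev [Suc i..<j - 1])) @ [inv t i]"
    unfolding u by simp
  show ?thesis
    unfolding tie_def l list_prod_Cons
    by (subst list_prod_append[OF c]) (use assms list_prod_closed[OF c] in \<open>simp_all add: m_assoc del: list_prod_closed\<close>)
qed

lemma tie_induct [consumes 3, case_names base step]:
  assumes "1 \<le> i" "i < j" "j \<le> n"
    and "\<And>i. \<lbrakk>i \<in> {1..<n}; j = Suc i\<rbrakk> \<Longrightarrow> P i"
    and "\<And>i. \<lbrakk>1 \<le> i; Suc i < j; j \<le> n; P (Suc i)\<rbrakk> \<Longrightarrow> P i"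
  shows "P i"
proof -
  have "i \<le> j - 1" using assms by simp
  then show ?thesis using assms(1)
  proof (induction i rule: inc_induct)
    case base
    show ?case by (rule assms(4)) (use assms(1-3) in auto)
  next
    case (step i)
    have lt: "Suc i < j" using step.hyps by linarith
    have "P (Suc i)" using step.IH step.prems by linarith
    with step.prems lt assms(3) show ?case by (rule assms(5))
  qed
qed

lemma tie_closed: "1 \<le> i \<Longrightarrow> i < j \<Longrightarrow> j \<le> n \<Longrightarrow> tie i j \<in> carrier G"
  by (induction i rule: tie_induct) (auto simp: tie_base tie_step)

lemma tie_down: "1 \<le> i \<Longrightarrow> Suc i < j \<Longrightarrow> j \<le> n \<Longrightarrow> t i \<otimes> tie (Suc i) j = tie i j \<otimes> t i"
  using t_unit[of i] tie_closed[of "Suc i" j] by (simp add: tie_step m_assoc)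

lemma tie_intertwine_step:
  assumes k: "k \<in> {1..<n}" "1 < \<bar>int k - int i\<bar>" and i: "1 \<le> i"
    and j: "Suc i < j" "j \<le> n" "Suc i < j'" "j' \<le> n"
    and tw: "t k \<otimes> tie (Suc i) j = tie (Suc i) j' \<otimes> t k"
  shows "t k \<otimes> tie i j = tie i j' \<otimes> t k"
proof -
  have "i \<in> {1..<n}" using i j by simp
  then have "t k \<otimes> (t i \<otimes> tie (Suc i) j \<otimes> inv t i) = (t i \<otimes> tie (Suc i) j' \<otimes> inv t i) \<otimes> t k"
    using k j tw by (intro intertwine_conj t_unit t_far) (auto intro: tie_closed)
  then show ?thesis using i j by (simp add: tie_step)
qed

lemma tie_far:
  assumes "k \<in> {1..<n}" "1 \<le> i" "i < j" "j \<le> n" "Suc k < i \<or> j < k"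
  shows "t k \<otimes> tie i j = tie i j \<otimes> t k"
  using assms(2-4) assms(1,5)
proof (induction i rule: tie_induct)
  case (base i)
  then show ?case using et_far[of i k] by (auto simp: tie_base)
next
  case (step i)
  show ?case by (rule tie_intertwine_step) (use step in auto)
qed

text \<open>Conjugation also moves the right end point, so \<open>E\<^sub>i\<^sub>j\<close> may be built from either side.  For
  neighbouring strands this says \<open>t j e i t j\<^sup>-\<^sup>1 = t i e j t i\<^sup>-\<^sup>1\<close>; the mixed braid relation gives it with
  \<open>t i\<close> and \<open>t i\<^sup>-\<^sup>1\<close> exchanged on the right, which makes no difference because the square of \<open>t i\<close>
  commutes with \<open>e j\<close>.\<close>

lemma tie_up:
  assumes "1 \<le> i" "i < j" "j < n"
  shows "t j \<otimes> tie i j = tie i (Suc j) \<otimes> t j"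
  using assms(1,2) less_imp_le[OF assms(3)] assms(3)
proof (induction i rule: tie_induct)
  case (base i)
  have i: "i \<in> {1..<n}" "j \<in> {1..<n}" "\<bar>int i - int j\<bar> = 1" using base by auto
  note [simp] = t_closed[OF i(1)] t_closed[OF i(2)] e_closed[OF i(1)] e_closed[OF i(2)]
    inv_t_closed[OF i(1)] t_unit[OF i(1)]
  have "t i \<otimes> (t i \<otimes> e j \<otimes> inv t i \<otimes> t j) = (t i \<otimes> (t i \<otimes> e j)) \<otimes> (inv t i \<otimes> t j)"
    by (simp add: m_assoc)
  also have "\<dots> = e j \<otimes> (t i \<otimes> t j)"
    unfolding tte[OF i] by (simp add: m_assoc unit_inv_cancel)
  also have "\<dots> = t i \<otimes> (t j \<otimes> e i)"
    by (rule ett[OF i])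
  finally have "t j \<otimes> e i = t i \<otimes> e j \<otimes> inv t i \<otimes> t j"
    using Units_l_cancel[OF t_unit[OF i(1)]] by simp
  then show ?case using base i by (simp add: tie_base tie_step)
next
  case (step i)
  show ?case by (rule tie_intertwine_step) (use step in auto)
qed

lemma tie_shrink_right:
  assumes "1 \<le> i" "i < j" "Suc j \<le> n"
  shows "t j \<otimes> tie i (Suc j) = tie i j \<otimes> t j"
proof -
  have "j \<le> n" using assms by simp
  with assms(1,2) show ?thesis using assms(3)
  proof (induction i rule: tie_induct)
    case (base i)
    have i: "i \<in> {1..<n}" "j \<in> {1..<n}" "\<bar>int j - int i\<bar> = 1" using base by auto
    note [simp] = t_closed[OF i(1)] t_closed[OF i(2)] e_closed[OF i(1)] e_closed[OF i(2)]
      inv_t_closed[OF i(1)] t_unit[OF i(1)]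
    have "t j \<otimes> (t i \<otimes> e j \<otimes> inv t i) = t j \<otimes> (t i \<otimes> e j) \<otimes> inv t i"
      by (simp add: m_assoc)
    also have "\<dots> = e i \<otimes> t j"
      unfolding ett[OF i(2,1,3), symmetric] by (simp add: m_assoc)
    finally show ?case using base i by (simp add: tie_base tie_step)
  next
    case (step i)
    show ?case by (rule tie_intertwine_step) (use step in auto)
  qed
qed

text \<open>Moving the left end point back undoes \<open>tie_down\<close> only up to the square of \<open>t i\<close>.  For adjacent
  end points the square commutes with \<open>e (i + 1)\<close>; a larger \<open>j\<close> is reached by conjugating
  with crossings that commute with \<open>t i\<close>.\<close>

lemma tie_shrink_left:
  assumes "1 \<le> i" "Suc i < j" "j \<le> n"
  shows "t i \<otimes> tie i j = tie (Suc i) j \<otimes> t i"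
proof -
  have "Suc (Suc i) \<le> j" using assms by simp
  then show ?thesis using assms
  proof (induction j rule: dec_induct)
    case base
    have i: "i \<in> {1..<n}" "Suc i \<in> {1..<n}" "\<bar>int i - int (Suc i)\<bar> = 1" using base by auto
    note [simp] = t_closed[OF i(1)] t_closed[OF i(2)] e_closed[OF i(1)] e_closed[OF i(2)]
      inv_t_closed[OF i(1)] t_unit[OF i(1)]
    have "t i \<otimes> (t i \<otimes> e (Suc i) \<otimes> inv t i) = t i \<otimes> (t i \<otimes> e (Suc i)) \<otimes> inv t i"
      by (simp add: m_assoc)
    also have "\<dots> = e (Suc i) \<otimes> t i"
      unfolding tte[OF i] by (simp add: m_assoc)
    finally show ?case using base i by (simp add: tie_base tie_step)
  next
    case (step j)
    have j: "j \<in> {1..<n}" using step by auto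
    have conj: "tie k (Suc j) = t j \<otimes> tie k j \<otimes> inv t j" if "1 \<le> k" "k < j" for k
      using tie_up[of k j] that j t_unit[OF j] tie_closed[of k "Suc j"] by (simp add: m_assoc)
    have "t i \<otimes> t j = t j \<otimes> t i"
      using step by (intro t_far) auto
    then have "t i \<otimes> (t j \<otimes> tie i j \<otimes> inv t j) = (t j \<otimes> tie (Suc i) j \<otimes> inv t j) \<otimes> t i"
      using step j by (intro intertwine_conj t_unit) (auto intro: tie_closed)
    then show ?case using step by (simp add: conj)
  qed
qed

text \<open>A crossing strictly between the end points.  The conjugating braid is pushed past \<open>t k\<close> by the braid
  relation, which turns \<open>t k\<close> into \<open>t (k - 1)\<close>; that crossing lies to the left of what remains.\<close>

lemma tie_inside:
  assumes "1 \<le> i" "i < k" "Suc k < j" "j \<le> n"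
  shows "t k \<otimes> tie i j = tie i j \<otimes> t k"
proof -
  have "i \<le> k - 1" using assms by simp
  then show ?thesis using assms(1)
  proof (induction i rule: inc_induct)
    case base
    \<comment> \<open>With \<open>y = t m t k\<close> the tie is \<open>y X y\<^sup>-\<^sup>1\<close>, where \<open>t k y = y t m\<close> and \<open>t m\<close> commutes with \<open>X\<close>.\<close>
    define m where "m = k - 1"
    have k: "k = Suc m" "m \<in> {1..<n}" "k \<in> {1..<n}" "\<bar>int m - int k\<bar> = 1"
      using assms by (auto simp: m_def)
    define y where "y = t m \<otimes> t k"
    let ?X = "tie (Suc k) j"
    have y: "y \<in> Units G" unfolding y_def using t_unit k by (intro Units_m_closed) auto
    have X: "?X \<in> carrier G" using assms k by (intro tie_closed) auto
    have tm: "tie m j \<in> carrier G" using assms k by (intro tie_closed) auto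
    note [simp] = t_closed[OF k(2)] t_closed[OF k(3)] X tm
    have ty: "tie m j \<otimes> y = y \<otimes> ?X"
    proof -
      have "tie m j \<otimes> t m = t m \<otimes> tie k j" "tie k j \<otimes> t k = t k \<otimes> ?X"
        using tie_down[of m j] tie_down[of k j] assms k by auto
      moreover have "tie k j \<in> carrier G" using assms k by (intro tie_closed) auto
      ultimately show ?thesis unfolding y_def by (metis \<open>t m \<in> carrier G\<close> \<open>t k \<in> carrier G\<close> X tm m_assoc)
    qed
    have ky: "t k \<otimes> y = y \<otimes> t m"
      unfolding y_def using t_braid[OF k(2,3,4)] by (simp add: m_assoc)
    have yc: "y \<in> carrier G" using y by auto
    have mX: "t m \<otimes> ?X = ?X \<otimes> t m"
      by (rule tie_far) (use assms k in auto)
    have "t k \<otimes> tie m j \<otimes> y = t k \<otimes> y \<otimes> ?X"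
      using ty yc by (simp add: m_assoc)
    also have "\<dots> = y \<otimes> ?X \<otimes> t m"
      using ky mX yc by (simp add: m_assoc)
    also have "\<dots> = tie m j \<otimes> t k \<otimes> y"
      using ty ky yc by (simp add: m_assoc) (metis ty m_assoc X tm yc \<open>t m \<in> carrier G\<close>)
    finally have "t k \<otimes> tie m j = tie m j \<otimes> t k"
      by (rule unit_cancel_right[OF y, rotated 2]) auto
    then show ?case by (simp add: m_def)
  next
    case (step i)
    show ?case
      by (rule tie_intertwine_step) (use step assms in simp_all)
  qed
qed

text \<open>The tie as a function of an unordered pair of strands; the value \<open>\<one>\<close> on the diagonal makes the pairs
  absorbed by an element a reflexive relation.\<close>

definition link :: "nat \<Rightarrow> nat \<Rightarrow> 'a" where
  "link a b = (if a = b then \<one> else tie (min a b) (max a b))"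

lemma link_sym: "link a b = link b a"
  by (simp add: link_def min.commute max.commute)

lemma link_refl [simp]: "link a a = \<one>"
  by (simp add: link_def)

lemma link_less: "a < b \<Longrightarrow> link a b = tie a b"
  by (simp add: link_def)

lemma link_closed: "a \<in> {1..n} \<Longrightarrow> b \<in> {1..n} \<Longrightarrow> link a b \<in> carrier G"
  by (auto simp: link_def intro!: tie_closed)

lemma t_link_less:
  assumes k: "k \<in> {1..<n}" and ab: "1 \<le> a" "a < b" "b \<le> n"
  shows "t k \<otimes> tie a b = link (adj k a) (adj k b) \<otimes> t k"
proof -
  consider "Suc k < a \<or> b < k" | "Suc k = a" | "k = a" "Suc a = b" | "k = a" "Suc a < b"
    | "a < k" "Suc k < b" | "a < k" "Suc k = b" | "b = k"
    using ab by linarith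
  then show ?thesis
  proof cases
    case 1
    then have "adj k a = a" "adj k b = b" using ab by (auto simp: Transposition.transpose_def)
    then show ?thesis using tie_far[of k a b] 1 k ab by (simp add: link_less)
  next
    case 2
    then have "adj k a = k" "adj k b = b" using ab by (auto simp: Transposition.transpose_def)
    then show ?thesis using tie_down[of k b] 2 k ab by (simp add: link_less)
  next
    case 3
    then have "b = Suc k" "a = k" by auto
    then show ?thesis using et_same[of k] k by (simp add: link_def tie_base)
  next
    case 4
    then have "adj k a = Suc a" "adj k b = b" by (auto simp: Transposition.transpose_def)
    then show ?thesis using tie_shrink_left[of k b] 4 k ab by (simp add: link_less)
  next
    case 5
    then have "adj k a = a" "adj k b = b" by (auto simp: Transposition.transpose_def)
    then show ?thesis using tie_inside[of a k b] 5 k ab by (simp add: link_less)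
  next
    case 6
    then have "adj k a = a" "adj k b = k" by (auto simp: Transposition.transpose_def)
    then show ?thesis using tie_shrink_right[of a k] 6 k ab by (simp add: link_less)
  next
    case 7
    then have "adj k a = a" "adj k b = Suc k" using ab by (auto simp: Transposition.transpose_def)
    then show ?thesis using tie_up[of a k] 7 k ab by (simp add: link_less)
  qed
qed

lemma t_link:
  assumes k: "k \<in> {1..<n}" and ab: "a \<in> {1..n}" "b \<in> {1..n}"
  shows "t k \<otimes> link a b = link (adj k a) (adj k b) \<otimes> t k"
proof -
  consider "a = b" | "a < b" | "b < a" by linarith
  then show ?thesis
  proof cases
    case 1
    then show ?thesis using k by simp
  next
    case 2
    then show ?thesis using t_link_less[of k a b] k ab by (simp add: link_less)
  next
    case 3
    then show ?thesis using t_link_less[of k b a] k ab by (simp add: link_less link_sym[of a] link_sym[of "adj k a"])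
  qed
qed

end

lemma partition_on_merge:
  assumes "partition_on S A" "I \<in> A" "J \<in> A"
  shows "partition_on S (insert (I \<union> J) (A - {I, J}))"
proof (rule partition_onI)
  have A: "\<Union>A = S" "{} \<notin> A" using assms by (auto simp: partition_on_def)
  show "\<Union>(insert (I \<union> J) (A - {I, J})) = S" using A(1) assms(2,3) by auto
  show "{} \<notin> insert (I \<union> J) (A - {I, J})"
    using A(2) assms(2) by auto
  have disj: "X \<inter> Y = {}" if "X \<in> A" "Y \<in> A" "X \<noteq> Y" for X Y
    using partition_onD2[OF assms(1)] that by (rule disjointD)
  fix p q assume pq: "p \<in> insert (I \<union> J) (A - {I, J})" "q \<in> insert (I \<union> J) (A - {I, J})" "p \<noteq> q"
  have merged: "(I \<union> J) \<inter> X = {}" if "X \<in> A - {I, J}" for X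
    using that disj[of I X] disj[of J X] assms(2,3) by auto
  from pq consider "p = I \<union> J" "q \<in> A - {I, J}" | "q = I \<union> J" "p \<in> A - {I, J}" | "p \<in> A" "q \<in> A"
    by blast
  then show "disjnt p q"
    unfolding disjnt_def
  proof cases
    case 1
    then show "p \<inter> q = {}" using merged by simp
  next
    case 2
    then show "p \<inter> q = {}" using merged[of p] by (simp add: Int_commute)
  next
    case 3
    then show "p \<inter> q = {}" using disj pq(3) by simp
  qed
qed

lemma partition_on_singletons: "partition_on S ((\<lambda>x. {x}) ` S)"
  by (rule partition_onI) auto

context braids_ties
begin

text \<open>Products of links between the entries of a tuple \<open>xs\<close>, the pairs in \<open>ps\<close> being positions in \<open>xs\<close>.  In
  this form both sides of an identity depend on the tuple only and can be transported.\<close>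

definition link_word :: "nat list \<Rightarrow> (nat \<times> nat) list \<Rightarrow> 'a" where
  "link_word xs ps = list_prod G (map (\<lambda>(i, j). link (xs ! i) (xs ! j)) ps)"

lemma link_word_closed:
  assumes "set xs \<subseteq> {1..n}" "set ps \<subseteq> {..<length xs} \<times> {..<length xs}"
  shows "link_word xs ps \<in> carrier G"
proof -
  have "link (xs ! i) (xs ! j) \<in> carrier G" if "(i, j) \<in> set ps" for i j
    using that assms nth_mem by (intro link_closed) blast+
  then show ?thesis unfolding link_word_def by (intro list_prod_closed) auto
qed

lemma t_link_word:
  assumes k: "k \<in> {1..<n}" and xs: "set xs \<subseteq> {1..n}" and ps: "set ps \<subseteq> {..<length xs} \<times> {..<length xs}"
  shows "t k \<otimes> link_word xs ps = link_word (map (adj k) xs) ps \<otimes> t k"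
  using ps
proof (induction ps)
  case Nil
  then show ?case using k by (simp add: link_word_def)
next
  case (Cons p ps)
  obtain i j where p: "p = (i, j)" "i < length xs" "j < length xs" using Cons.prems by auto
  have in_n: "xs ! i \<in> {1..n}" "xs ! j \<in> {1..n}"
    using xs p nth_mem by blast+
  have c: "link (xs ! i) (xs ! j) \<in> carrier G" "link (adj k (xs ! i)) (adj k (xs ! j)) \<in> carrier G"
    using in_n adj_in[OF k] link_closed by blast+
  have ps: "set ps \<subseteq> {..<length xs} \<times> {..<length xs}" using Cons.prems by auto
  have map_in: "set (map (adj k) xs) \<subseteq> {1..n}" using adj_in[OF k] xs by auto
  have w: "link_word xs ps \<in> carrier G" "link_word (map (adj k) xs) ps \<in> carrier G"
    using link_word_closed[OF xs ps] link_word_closed[OF map_in, of ps] ps by auto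
  have unfold1: "link_word xs (p # ps) = link (xs ! i) (xs ! j) \<otimes> link_word xs ps"
    "link_word (map (adj k) xs) (p # ps) =
      link (adj k (xs ! i)) (adj k (xs ! j)) \<otimes> link_word (map (adj k) xs) ps"
    using p by (simp_all add: link_word_def)
  have "t k \<otimes> link_word xs (p # ps) = (t k \<otimes> link (xs ! i) (xs ! j)) \<otimes> link_word xs ps"
    unfolding unfold1 using c w k by (simp add: m_assoc)
  also have "\<dots> = link (adj k (xs ! i)) (adj k (xs ! j)) \<otimes> (t k \<otimes> link_word xs ps)"
    unfolding t_link[OF k in_n] using c w k by (simp add: m_assoc)
  also have "\<dots> = link_word (map (adj k) xs) (p # ps) \<otimes> t k"
    unfolding Cons.IH[OF ps] unfold1 using c w k by (simp add: m_assoc)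
  finally show ?case .
qed

text \<open>Multiplying both sides by \<open>t k\<close> relabels the tuple, and \<open>t k\<close> can be cancelled again.\<close>

lemma transport_link_identity:
  assumes eq: "link_word xs ps = link_word xs qs"
    and d: "distinct xs" "distinct ys" "length xs = length ys" "set xs \<subseteq> {1..n}" "set ys \<subseteq> {1..n}"
    and ps: "set ps \<subseteq> {..<length xs} \<times> {..<length xs}" and qs: "set qs \<subseteq> {..<length xs} \<times> {..<length xs}"
  shows "link_word ys ps = link_word ys qs"
proof -
  have "length ys = length xs \<and> link_word ys ps = link_word ys qs"
  proof (rule transport_along_adj[where n = n and xs = xs and
        P = "\<lambda>zs. length zs = length xs \<and> link_word zs ps = link_word zs qs"])
    fix k zs
    assume k: "k \<in> {1..<n}" and zs: "set zs \<subseteq> {1..n}"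
      and IH: "length zs = length xs \<and> link_word zs ps = link_word zs qs"
    have map_in: "set (map (adj k) zs) \<subseteq> {1..n}" using adj_in[OF k] zs by auto
    have "link_word (map (adj k) zs) ps \<otimes> t k = link_word (map (adj k) zs) qs \<otimes> t k"
      using t_link_word[OF k zs, of ps] t_link_word[OF k zs, of qs] ps qs IH by simp
    then have "link_word (map (adj k) zs) ps = link_word (map (adj k) zs) qs"
      by (rule unit_cancel_right[OF t_unit[OF k], rotated 2])
        (use link_word_closed[OF map_in] ps qs IH in auto)
    then show "length (map (adj k) zs) = length xs \<and>
        link_word (map (adj k) zs) ps = link_word (map (adj k) zs) qs"
      using IH by simp
  qed (use assms in auto)
  then show ?thesis by simp
qed

lemma distinct_length_le: "distinct xs \<Longrightarrow> set xs \<subseteq> {1..n} \<Longrightarrow> length xs \<le> n"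
  using card_mono[of "{1..n}" "set xs"] by (simp add: distinct_card)

lemma link_adj: "i \<in> {1..<n} \<Longrightarrow> link i (Suc i) = e i"
  by (simp add: link_def tie_base)

lemma link_idem:
  assumes "a \<in> {1..n}" "b \<in> {1..n}"
  shows "link a b \<otimes> link a b = link a b"
proof (cases "a = b")
  case False
  have n: "2 \<le> n" using assms False by auto
  have "link_word [1, 2] [(0, 1), (0, 1)] = link_word [1, 2] [(0, 1)]"
    using n link_adj[of 1] e_idem[of 1] by (simp add: link_word_def numeral_2_eq_2)
  then have "link_word [a, b] [(0, 1), (0, 1)] = link_word [a, b] [(0, 1)]"
    by (rule transport_link_identity) (use False assms n in auto)
  then show ?thesis using link_closed[OF assms] by (simp add: link_word_def)
qed simp

lemma link_commute_path:
  assumes "distinct [a, b, c]" "set [a, b, c] \<subseteq> {1..n}"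
  shows "link a b \<otimes> link b c = link b c \<otimes> link a b"
proof -
  have n: "3 \<le> n" using distinct_length_le[OF assms] by simp
  have "link 1 2 = e 1" "link 2 3 = e 2"
    using n link_adj[of 1] link_adj[of 2] by (simp_all add: numeral_2_eq_2 numeral_3_eq_3)
  then have "link_word [1, 2, 3] [(0, 1), (1, 2)] = link_word [1, 2, 3] [(1, 2), (0, 1)]"
    using n e_comm[of 1 2] by (simp add: link_word_def)
  then have "link_word [a, b, c] [(0, 1), (1, 2)] = link_word [a, b, c] [(1, 2), (0, 1)]"
    by (rule transport_link_identity) (use assms n in auto)
  then show ?thesis using link_closed[of a b] link_closed[of b c] assms by (simp add: link_word_def)
qed

lemma link_commute_disjoint:
  assumes "distinct [a, b, c, d]" "set [a, b, c, d] \<subseteq> {1..n}"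
  shows "link a b \<otimes> link c d = link c d \<otimes> link a b"
proof -
  have n: "4 \<le> n" using distinct_length_le[OF assms] by simp
  have "link 1 2 = e 1" "link 3 4 = e 3"
    using n link_adj[of 1] link_adj[of 3] by (simp_all add: numeral_2_eq_2)
  then have "link_word [1, 2, 3, 4] [(0, 1), (2, 3)] = link_word [1, 2, 3, 4] [(2, 3), (0, 1)]"
    using n e_comm[of 1 3] by (simp add: link_word_def)
  then have "link_word [a, b, c, d] [(0, 1), (2, 3)] = link_word [a, b, c, d] [(2, 3), (0, 1)]"
    by (rule transport_link_identity) (use assms n in auto)
  then show ?thesis using link_closed[of a b] link_closed[of c d] assms by (simp add: link_word_def)
qed

lemma link_commute:
  assumes "a \<in> {1..n}" "b \<in> {1..n}" "c \<in> {1..n}" "d \<in> {1..n}"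
  shows "link a b \<otimes> link c d = link c d \<otimes> link a b"
proof -
  have c: "link a b \<in> carrier G" "link c d \<in> carrier G" using assms link_closed by auto
  consider "a = b" | "c = d" | "a \<noteq> b" "c \<noteq> d" "{a, b} = {c, d}"
    | "distinct [a, b, c, d]" | "a = c" "distinct [b, a, d]" | "a = d" "distinct [b, a, c]"
    | "b = c" "distinct [a, b, d]" | "b = d" "distinct [a, b, c]"
    by auto
  then show ?thesis
  proof cases
    case 3
    then have "link a b = link c d" by (auto simp: doubleton_eq_iff link_sym)
    then show ?thesis by simp
  next
    case 4
    then show ?thesis using link_commute_disjoint[of a b c d] assms by simp
  next
    case 5
    then have "link b a \<otimes> link a d = link a d \<otimes> link b a"
      using assms by (intro link_commute_path) auto
    then show ?thesis using 5 by (metis link_sym)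
  next
    case 6
    then have "link b a \<otimes> link a c = link a c \<otimes> link b a"
      using assms by (intro link_commute_path) auto
    then show ?thesis using 6 by (metis link_sym)
  next
    case 7
    then have "link a b \<otimes> link b d = link b d \<otimes> link a b"
      using assms by (intro link_commute_path) auto
    then show ?thesis using 7 by metis
  next
    case 8
    then have "link a b \<otimes> link b c = link b c \<otimes> link a b"
      using assms by (intro link_commute_path) auto
    then show ?thesis using 8 by (metis link_sym)
  qed (use c in simp_all)
qed

text \<open>The tie between strands 1 and 3 is already absorbed by \<open>e 1\<close> and \<open>e 2\<close>: the relation
  \<open>e i e j t j = t j e i e j\<close> cancels the conjugating crossings.\<close>

lemma e_triangle:
  assumes i: "i \<in> {1..<n}" and j: "j \<in> {1..<n}" and ij: "\<bar>int j - int i\<bar> = 1"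
  shows "e i \<otimes> (e j \<otimes> (t i \<otimes> e j \<otimes> inv t i)) = e i \<otimes> e j"
proof -
  note [simp] = t_closed[OF i] e_closed[OF i] e_closed[OF j] inv_t_closed[OF i] t_unit[OF i]
  have "e i \<otimes> (t i \<otimes> e j \<otimes> inv t i) = (e i \<otimes> t i) \<otimes> e j \<otimes> inv t i"
    by (simp add: m_assoc)
  also have "\<dots> = t i \<otimes> (e i \<otimes> e j) \<otimes> inv t i"
    unfolding et_same[OF i] by (simp add: m_assoc)
  also have "\<dots> = e j \<otimes> e i"
    unfolding e_comm[OF i j] eet[OF j i ij, symmetric] by (simp add: m_assoc)
  finally have e13: "e i \<otimes> (t i \<otimes> e j \<otimes> inv t i) = e j \<otimes> e i" .
  have "e i \<otimes> (e j \<otimes> (t i \<otimes> e j \<otimes> inv t i)) = (e i \<otimes> e j) \<otimes> (t i \<otimes> e j \<otimes> inv t i)"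
    by (simp add: m_assoc)
  also have "\<dots> = e j \<otimes> (e i \<otimes> (t i \<otimes> e j \<otimes> inv t i))"
    unfolding e_comm[OF i j] by (simp add: m_assoc)
  also have "\<dots> = (e j \<otimes> e j) \<otimes> e i"
    unfolding e13 by (simp add: m_assoc)
  also have "\<dots> = e i \<otimes> e j"
    unfolding e_idem[OF j] by (rule e_comm[OF j i])
  finally show ?thesis .
qed

lemma link_triangle:
  assumes "a \<in> {1..n}" "b \<in> {1..n}" "c \<in> {1..n}"
  shows "link a b \<otimes> (link b c \<otimes> link a c) = link a b \<otimes> link b c"
proof -
  have cl: "link a b \<in> carrier G" "link b c \<in> carrier G" "link a c \<in> carrier G"
    using assms link_closed by auto
  consider "a = b" | "b = c" | "a = c" "a \<noteq> b" | "distinct [a, b, c]" by auto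
  then show ?thesis
  proof cases
    case 4
    have n: "3 \<le> n" using distinct_length_le[OF 4] assms by simp
    have one: "link 1 2 = e 1" and two: "link 2 3 = e 2" and thr: "link 1 3 = t 1 \<otimes> e 2 \<otimes> inv t 1"
      using n link_adj[of 1] link_adj[of 2] tie_step[of 1 3] tie_base[of 2]
      by (simp_all add: numeral_2_eq_2 numeral_3_eq_3 link_less)
    have "e 1 \<otimes> (e 2 \<otimes> (t 1 \<otimes> e 2 \<otimes> inv t 1)) = e 1 \<otimes> e 2"
      by (rule e_triangle) (use n in auto)
    then have "link_word [1, 2, 3] [(0, 1), (1, 2), (0, 2)] = link_word [1, 2, 3] [(0, 1), (1, 2)]"
      using one two thr n by (simp add: link_word_def)
    then have "link_word [a, b, c] [(0, 1), (1, 2), (0, 2)] = link_word [a, b, c] [(0, 1), (1, 2)]"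
      by (rule transport_link_identity) (use 4 assms n in auto)
    then show ?thesis using cl by (simp add: link_word_def)
  qed (use assms cl link_idem link_sym in auto)
qed

text \<open>Together with \<open>link_refl\<close> and \<open>link_sym\<close>: the pairs \<open>(a, b)\<close> whose link is absorbed by \<open>y\<close> form an
  equivalence relation.\<close>

lemma absorb_trans:
  assumes y: "y \<in> carrier G" and abc: "a \<in> {1..n}" "b \<in> {1..n}" "c \<in> {1..n}"
    and ab: "y \<otimes> link a b = y" and bc: "y \<otimes> link b c = y"
  shows "y \<otimes> link a c = y"
proof -
  note [simp] = y link_closed[OF abc(1,2)] link_closed[OF abc(2,3)] link_closed[OF abc(1,3)]
  have "y = y \<otimes> (link a b \<otimes> link b c)"
    using ab bc by (simp flip: m_assoc)
  then have "y \<otimes> link a c = y \<otimes> (link a b \<otimes> (link b c \<otimes> link a c))"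
    by (metis m_assoc m_closed y link_closed abc)
  also have "\<dots> = y" unfolding link_triangle[OF abc] using ab bc by (simp flip: m_assoc)
  finally show ?thesis .
qed

definition tie_block :: "nat set \<Rightarrow> 'a" where
  "tie_block I = finprod G (\<lambda>(i, j). tie i j) {(i, j) \<in> I \<times> I. i < j}"

definition tie_partition :: "nat set set \<Rightarrow> 'a" where
  "tie_partition A = finprod G tie_block A"

lemma finite_pairs: "I \<subseteq> {1..n} \<Longrightarrow> finite {(i, j) \<in> I \<times> I. i < j}"
  by (rule finite_subset[of _ "{1..n} \<times> {1..n}"]) auto

lemma commuting_ties:
  assumes "I \<subseteq> {1..n}"
  shows "commuting (\<lambda>(i, j). tie i j) {(i, j) \<in> I \<times> I. i < j}"
  unfolding commuting_def
proof (intro conjI ballI funcsetI)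
  fix p assume "p \<in> {(i, j) \<in> I \<times> I. i < j}"
  then obtain i j where p: "p = (i, j)" "i < j" "i \<in> {1..n}" "j \<in> {1..n}" using assms by blast
  then show "(case p of (i, j) \<Rightarrow> tie i j) \<in> carrier G"
    using link_closed[of i j] by (simp add: link_less)
  fix q assume "q \<in> {(i, j) \<in> I \<times> I. i < j}"
  then obtain k l where q: "q = (k, l)" "k < l" "k \<in> {1..n}" "l \<in> {1..n}" using assms by blast
  show "(case p of (i, j) \<Rightarrow> tie i j) \<otimes> (case q of (i, j) \<Rightarrow> tie i j) =
      (case q of (i, j) \<Rightarrow> tie i j) \<otimes> (case p of (i, j) \<Rightarrow> tie i j)"
    using link_commute[OF p(3,4) q(3,4)] p q by (simp add: link_less)
qed

lemma tie_block_closed: "I \<subseteq> {1..n} \<Longrightarrow> tie_block I \<in> carrier G"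
  unfolding tie_block_def by (rule finprod_commuting_closed[OF finite_pairs commuting_ties])

lemma tie_block_commute_elt:
  assumes "I \<subseteq> {1..n}" "z \<in> carrier G"
    and "\<And>a b. a \<in> {1..n} \<Longrightarrow> b \<in> {1..n} \<Longrightarrow> link a b \<otimes> z = z \<otimes> link a b"
  shows "tie_block I \<otimes> z = z \<otimes> tie_block I"
  unfolding tie_block_def
proof (rule finprod_commutes[OF finite_pairs[OF assms(1)] commuting_ties[OF assms(1)] assms(2)])
  fix p assume "p \<in> {(i, j) \<in> I \<times> I. i < j}"
  then obtain i j where "p = (i, j)" "i \<in> {1..n}" "j \<in> {1..n}" "i < j" using assms(1) by blast
  then show "(case p of (i, j) \<Rightarrow> tie i j) \<otimes> z = z \<otimes> (case p of (i, j) \<Rightarrow> tie i j)"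
    using assms(3)[of i j] by (simp add: link_less)
qed

lemma tie_block_link_commute:
  assumes "I \<subseteq> {1..n}" "a \<in> {1..n}" "b \<in> {1..n}"
  shows "tie_block I \<otimes> link a b = link a b \<otimes> tie_block I"
  using assms by (intro tie_block_commute_elt link_closed link_commute)

lemma tie_block_commute:
  assumes "I \<subseteq> {1..n}" "J \<subseteq> {1..n}"
  shows "tie_block I \<otimes> tie_block J = tie_block J \<otimes> tie_block I"
  using assms by (intro tie_block_commute_elt tie_block_closed)
    (auto simp: tie_block_link_commute)

lemma tie_block_absorbs:
  assumes I: "I \<subseteq> {1..n}" and "a \<in> I" "b \<in> I"
  shows "tie_block I \<otimes> link a b = tie_block I"
proof (cases "a = b")
  case True
  then show ?thesis using tie_block_closed[OF I] by simp
next
  case False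
  have "tie_block I \<otimes> link i j = tie_block I" if ij: "i \<in> I" "j \<in> I" "i < j" for i j
    unfolding tie_block_def
  proof (rule finprod_absorbs_factor[OF finite_pairs[OF I] commuting_ties[OF I], of "(i, j)"])
    have ijn: "i \<in> {1..n}" "j \<in> {1..n}" using ij I by blast+
    show "link i j \<in> carrier G" by (rule link_closed[OF ijn])
    show "(case (i, j) of (i, j) \<Rightarrow> tie i j) \<otimes> link i j = (case (i, j) of (i, j) \<Rightarrow> tie i j)"
      using ij(3) link_idem[OF ijn] by (simp add: link_less)
    fix p assume "p \<in> {(i, j) \<in> I \<times> I. i < j}"
    then obtain k l where "p = (k, l)" "k \<in> {1..n}" "l \<in> {1..n}" "k < l" using I by blast
    then show "(case p of (i, j) \<Rightarrow> tie i j) \<otimes> link i j = link i j \<otimes> (case p of (i, j) \<Rightarrow> tie i j)"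
      using link_commute[of k l i j] ijn ij(3) by (simp add: link_less)
  qed (use ij in auto)
  then show ?thesis using assms False link_sym[of a b] by (metis linorder_neqE_nat)
qed

lemma absorbs_tie_block:
  assumes I: "I \<subseteq> {1..n}" and y: "y \<in> carrier G" "\<And>a b. a \<in> I \<Longrightarrow> b \<in> I \<Longrightarrow> y \<otimes> link a b = y"
  shows "y \<otimes> tie_block I = y"
  unfolding tie_block_def
proof (rule absorbs_finprod[OF finite_pairs[OF I] commuting_ties[OF I] y(1)])
  fix p assume "p \<in> {(i, j) \<in> I \<times> I. i < j}"
  then show "y \<otimes> (case p of (i, j) \<Rightarrow> tie i j) = y"
    using y(2) by (auto simp flip: link_less)
qed

lemma partition_blockD: "partition_on {1..n} A \<Longrightarrow> I \<in> A \<Longrightarrow> I \<subseteq> {1..n}"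
  by (auto simp: partition_on_def)

lemma finite_partition: "partition_on {1..n} A \<Longrightarrow> finite A"
  by (rule finite_elements) auto

lemma commuting_blocks:
  assumes "partition_on {1..n} A" shows "commuting tie_block A"
  unfolding commuting_def
  by (intro conjI ballI funcsetI tie_block_closed tie_block_commute partition_blockD[OF assms])

lemma tie_partition_closed: "partition_on {1..n} A \<Longrightarrow> tie_partition A \<in> carrier G"
  unfolding tie_partition_def by (rule finprod_commuting_closed[OF finite_partition commuting_blocks])

lemma tie_partition_link_commute:
  assumes "partition_on {1..n} A" "a \<in> {1..n}" "b \<in> {1..n}"
  shows "tie_partition A \<otimes> link a b = link a b \<otimes> tie_partition A"
  unfolding tie_partition_def
  using assms partition_blockD[OF assms(1)]
  by (intro finprod_commutes finite_partition commuting_blocks link_closed tie_block_link_commute)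

lemma tie_partition_absorbs:
  assumes A: "partition_on {1..n} A" and I: "I \<in> A" and ab: "a \<in> I" "b \<in> I"
  shows "tie_partition A \<otimes> link a b = tie_partition A"
proof -
  have "a \<in> {1..n}" "b \<in> {1..n}" using partition_blockD[OF A I] ab by auto
  then show ?thesis
    unfolding tie_partition_def
    by (intro finprod_absorbs_factor[OF finite_partition[OF A] commuting_blocks[OF A] I]
        link_closed tie_block_link_commute tie_block_absorbs partition_blockD[OF A] I ab)
qed

lemma absorbs_tie_partition:
  assumes A: "partition_on {1..n} A" and y: "y \<in> carrier G"
    "\<And>I a b. I \<in> A \<Longrightarrow> a \<in> I \<Longrightarrow> b \<in> I \<Longrightarrow> y \<otimes> link a b = y"
  shows "y \<otimes> tie_partition A = y"
  unfolding tie_partition_def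
  using y by (intro absorbs_finprod[OF finite_partition[OF A] commuting_blocks[OF A]]
      absorbs_tie_block[OF partition_blockD[OF A]])

lemma tie_partition_commute:
  assumes A: "partition_on {1..n} A" and B: "partition_on {1..n} B"
  shows "tie_partition A \<otimes> tie_partition B = tie_partition B \<otimes> tie_partition A"
proof -
  have "tie_block I \<otimes> tie_partition B = tie_partition B \<otimes> tie_block I" if "I \<in> A" for I
    using that by (intro tie_block_commute_elt partition_blockD[OF A] tie_partition_closed B)
      (assumption | rule tie_partition_link_commute[OF B, symmetric])+
  then show ?thesis
    unfolding tie_partition_def[of A]
    by (intro finprod_commutes finite_partition[OF A] commuting_blocks[OF A] tie_partition_closed[OF B])
qed

text \<open>Let \<open>B\<close> arise from \<open>A\<close> by merging the blocks of \<open>a\<close> and \<open>b\<close>.  The left side absorbs the links within blocks of \<open>A\<close> and the link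
  of \<open>a\<close> and \<open>b\<close>, hence by transitivity all links within blocks of \<open>B\<close>, so it absorbs \<open>E\<^sub>B\<close>.  Conversely
  \<open>E\<^sub>B\<close> absorbs every factor of the left side.  As the two commute, they are equal.\<close>

lemma tie_partition_link:
  assumes A: "partition_on {1..n} A" and ab: "a \<in> {1..n}" "b \<in> {1..n}"
  shows "\<exists>B. partition_on {1..n} B \<and> tie_partition A \<otimes> link a b = tie_partition B"
proof -
  obtain I J where IJ: "I \<in> A" "a \<in> I" "J \<in> A" "b \<in> J"
    using A ab unfolding partition_on_def by blast
  define B where "B = insert (I \<union> J) (A - {I, J})"
  have B: "partition_on {1..n} B" unfolding B_def by (rule partition_on_merge[OF A IJ(1,3)])
  define y where "y = tie_partition A \<otimes> link a b"
  note cl = tie_partition_closed[OF A] tie_partition_closed[OF B] link_closed[OF ab]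
  have y: "y \<in> carrier G" using cl by (simp add: y_def)
  have yA: "y \<otimes> link c d = y" if "K \<in> A" "c \<in> K" "d \<in> K" for K c d
  proof -
    have cd: "c \<in> {1..n}" "d \<in> {1..n}" using partition_blockD[OF A that(1)] that by auto
    have "y \<otimes> link c d = (tie_partition A \<otimes> link c d) \<otimes> link a b"
      unfolding y_def using cl link_closed[OF cd] by (simp add: m_assoc link_commute[OF ab cd])
    then show ?thesis unfolding tie_partition_absorbs[OF A that] y_def .
  qed
  have yab: "y \<otimes> link a b = y"
    unfolding y_def using cl link_idem[OF ab] by (simp add: m_assoc)
  have ya: "y \<otimes> link c a = y" if "c \<in> I \<union> J" for c
  proof (cases "c \<in> I")
    case True
    then show ?thesis using yA IJ by blast
  next
    case False
    have "c \<in> {1..n}" using that partition_blockD[OF A] IJ by blast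
    then show ?thesis
      using absorb_trans[OF y, of c b a] yA[of J c b] yab False that IJ ab link_sym[of a b] by auto
  qed
  have yB: "y \<otimes> tie_partition B = y"
  proof (rule absorbs_tie_partition[OF B y])
    fix K c d assume K: "K \<in> B" "c \<in> K" "d \<in> K"
    show "y \<otimes> link c d = y"
    proof (cases "K \<in> A")
      case True
      then show ?thesis using yA K by blast
    next
      case False
      then have cd: "c \<in> I \<union> J" "d \<in> I \<union> J" using K by (auto simp: B_def)
      then have "c \<in> {1..n}" "d \<in> {1..n}" using partition_blockD[OF A] IJ by blast+
      then show ?thesis
        using absorb_trans[OF y, of c a d] ya[OF cd(1)] ya[OF cd(2)] ab link_sym[of d a] by simp
    qed
  qed
  have "tie_partition B \<otimes> link a b = tie_partition B"
    by (rule tie_partition_absorbs[OF B, of "I \<union> J"]) (use IJ in \<open>auto simp: B_def\<close>)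
  moreover have "tie_partition B \<otimes> tie_partition A = tie_partition B"
  proof (rule absorbs_tie_partition[OF A cl(2)])
    fix K c d assume K: "K \<in> A" "c \<in> K" "d \<in> K"
    show "tie_partition B \<otimes> link c d = tie_partition B"
    proof (cases "K = I \<or> K = J")
      case True
      then show ?thesis
        by (intro tie_partition_absorbs[OF B, of "I \<union> J"]) (use K in \<open>auto simp: B_def\<close>)
    next
      case False
      then show ?thesis
        by (intro tie_partition_absorbs[OF B, of K]) (use K in \<open>auto simp: B_def\<close>)
    qed
  qed
  ultimately have "tie_partition B \<otimes> y = tie_partition B"
    unfolding y_def using cl by (simp flip: m_assoc)
  moreover have "y \<otimes> tie_partition B = tie_partition B \<otimes> y"
    unfolding y_def using cl
    by (simp add: m_assoc flip: tie_partition_link_commute[OF B ab])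
       (simp add: tie_partition_commute[OF A B] flip: m_assoc)
  ultimately show ?thesis using yB B y_def by metis
qed

section \<open>The elements \<open>T\<^sub>w\<close>\<close>

abbreviation braid_word :: "nat list \<Rightarrow> 'a" where
  "braid_word is \<equiv> list_prod G (map t is)"

lemma braid_word_closed: "set is \<subseteq> {1..<n} \<Longrightarrow> braid_word is \<in> carrier G"
  by (rule list_prod_closed) auto

lemma braid_word_link:
  assumes "set is \<subseteq> {1..<n}" "a \<in> {1..n}" "b \<in> {1..n}"
  shows "braid_word is \<otimes> link a b = link (word_perm n is a) (word_perm n is b) \<otimes> braid_word is"
  using assms(1)
proof (induction "is")
  case Nil
  then show ?case using link_closed assms by (simp add: word_perm_Nil)
next
  case (Cons i js)
  let ?a = "word_perm n js a" and ?b = "word_perm n js b"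
  have i: "i \<in> {1..<n}" and js: "set js \<subseteq> {1..<n}" using Cons.prems by auto
  have ab': "?a \<in> {1..n}" "?b \<in> {1..n}"
    using permutes_in_image[OF word_perm_permutes[OF js]] assms by auto
  have ab'': "adj i ?a \<in> {1..n}" "adj i ?b \<in> {1..n}" using adj_in[OF i] ab' by auto
  note [simp] = t_closed[OF i] braid_word_closed[OF js] link_closed[OF assms(2,3)]
    link_closed[OF ab'] link_closed[OF ab'']
  have "braid_word (i # js) \<otimes> link a b = t i \<otimes> link ?a ?b \<otimes> braid_word js"
    using Cons.IH[OF js] by (simp add: m_assoc)
  also have "\<dots> = link (adj i ?a) (adj i ?b) \<otimes> braid_word (i # js)"
    unfolding t_link[OF i ab'] by (simp add: m_assoc)
  finally show ?case by (simp add: word_perm_Cons)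
qed

end

context braids_ties
begin

lemma braid_word_mult:
  "set xs \<subseteq> {1..<n} \<Longrightarrow> set ys \<subseteq> carrier G \<Longrightarrow>
    list_prod G (map t xs @ ys) = braid_word xs \<otimes> list_prod G ys"
  by (rule list_prod_append) auto

lemma reduced_word_subset: "reduced_word n w xs \<Longrightarrow> set xs \<subseteq> {1..<n}"
  by (simp add: reduced_word_iff)

text \<open>The case of Matsumoto's theorem where two reduced words of \<open>w\<close> end in neighbouring letters: then \<open>w\<close>
  is decreasing on three consecutive positions, so it has reduced words ending in either side of the
  braid relation after a common prefix \<open>c\<close>.\<close>

lemma braid_word_reduced_adjacent:
  assumes w: "w permutes {1..n}" and i: "i \<in> {1..<n}" "Suc i \<in> {1..<n}"
    and red: "reduced_word n (w \<circ> adj i) xs" "reduced_word n (w \<circ> adj (Suc i)) ys"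
    and desc: "w (Suc i) < w i" "w (Suc (Suc i)) < w (Suc i)"
    and IH: "\<And>v us vs. \<lbrakk>v permutes {1..n}; length us = m; reduced_word n v us; reduced_word n v vs\<rbrakk> \<Longrightarrow>
      braid_word us = braid_word vs"
    and len: "length xs = m" "length ys = m"
  shows "braid_word (xs @ [i]) = braid_word (ys @ [Suc i])"
proof -
  let ?j = "Suc i"
  have wi: "w \<circ> adj i permutes {1..n}" and wj: "w \<circ> adj ?j permutes {1..n}"
    and wij: "w \<circ> adj i \<circ> adj ?j permutes {1..n}" and wji: "w \<circ> adj ?j \<circ> adj i permutes {1..n}"
    by (intro permutes_comp_adj w i)+
  have wiji: "w \<circ> adj i \<circ> adj ?j \<circ> adj i permutes {1..n}"
    by (rule permutes_comp_adj[OF wij i(1)])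
  obtain c where c: "reduced_word n (w \<circ> adj i \<circ> adj ?j \<circ> adj i) c"
    using reduced_word_ex[OF wiji] by blast
  have eq: "w \<circ> adj ?j \<circ> adj i \<circ> adj ?j = w \<circ> adj i \<circ> adj ?j \<circ> adj i"
    using adj_braid[of i] by (metis comp_assoc)
  have "reduced_word n (w \<circ> adj i \<circ> adj ?j) (c @ [i])"
    unfolding reduced_word_snoc[OF wij i(1)] using c desc by simp
  then have ci: "reduced_word n (w \<circ> adj i) ((c @ [i]) @ [?j])"
    unfolding reduced_word_snoc[OF wi i(2)] using desc by simp
  have "reduced_word n (w \<circ> adj ?j \<circ> adj i) (c @ [?j])"
    unfolding reduced_word_snoc[OF wji i(2)] eq using c desc by simp
  then have cj: "reduced_word n (w \<circ> adj ?j) ((c @ [?j]) @ [i])"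
    unfolding reduced_word_snoc[OF wj i(1)] using desc by simp
  have sub: "set xs \<subseteq> {1..<n}" "set ys \<subseteq> {1..<n}" "set c \<subseteq> {1..<n}"
    using reduced_word_subset red c by auto
  note [simp] = t_closed[OF i(1)] t_closed[OF i(2)] braid_word_closed[OF sub(3)]
  have "braid_word (xs @ [i]) = braid_word c \<otimes> (t i \<otimes> (t ?j \<otimes> t i))"
    using IH[OF wi len(1) red(1) ci] sub i by (simp add: braid_word_mult m_assoc)
  also have "\<dots> = braid_word c \<otimes> (t ?j \<otimes> (t i \<otimes> t ?j))"
    using t_braid[OF i] by simp
  also have "\<dots> = braid_word (ys @ [?j])"
    using IH[OF wj len(2) red(2) cj] sub i by (simp add: braid_word_mult m_assoc)
  finally show ?thesis .
qed

text \<open>Matsumoto's theorem, by induction on the length, comparing the last letters \<open>i\<close> and \<open>j\<close> of the two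
  words.  Both are descents of \<open>w\<close>; so \<open>w\<close> has reduced words that end in \<open>i\<close> and \<open>j\<close> and differ by one
  braid relation, and the induction hypothesis connects them to the given words.\<close>

lemma braid_word_reduced_unique:
  assumes "w permutes {1..n}" "reduced_word n w xs" "reduced_word n w ys"
  shows "braid_word xs = braid_word ys"
  using assms
proof (induction "length xs" arbitrary: w xs ys)
  case 0
  then show ?case by (simp add: reduced_word_iff)
next
  case (Suc m)
  have len: "length xs = Suc m" "length ys = Suc m"
    using Suc.hyps(2) Suc.prems by (simp_all add: reduced_word_iff)
  obtain xs' i where xs: "xs = xs' @ [i]" using len(1) by (cases xs rule: rev_cases) auto
  obtain ys' j where ys: "ys = ys' @ [j]" using len(2) by (cases ys rule: rev_cases) auto
  have ij: "i \<in> {1..<n}" "j \<in> {1..<n}"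
    using reduced_word_subset[OF Suc.prems(2)] reduced_word_subset[OF Suc.prems(3)] unfolding xs ys by auto
  have red: "w (Suc i) < w i" "reduced_word n (w \<circ> adj i) xs'"
    "w (Suc j) < w j" "reduced_word n (w \<circ> adj j) ys'"
    using Suc.prems unfolding xs ys reduced_word_snoc[OF Suc.prems(1) ij(1)]
      reduced_word_snoc[OF Suc.prems(1) ij(2)] by auto
  have len': "length xs' = m" "length ys' = m" using len xs ys by auto
  have wi: "w \<circ> adj i permutes {1..n}" and wj: "w \<circ> adj j permutes {1..n}"
    by (intro permutes_comp_adj Suc.prems(1) ij)+
  have IH: "braid_word us = braid_word vs"
    if "v permutes {1..n}" "length us = m" "reduced_word n v us" "reduced_word n v vs" for v us vs
    using Suc.hyps(1)[of us v vs] that by simp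
  have sub: "set xs' \<subseteq> {1..<n}" "set ys' \<subseteq> {1..<n}" using reduced_word_subset red by auto
  consider "i = j" | "j = Suc i" | "i = Suc j" | "1 < \<bar>int i - int j\<bar>" by linarith
  then show ?case
  proof cases
    case 1
    then show ?thesis
      using IH[OF wi len'(1) red(2)] red(4) ij sub unfolding xs ys by (simp add: braid_word_mult)
  next
    case 2
    show ?thesis
      unfolding xs ys 2
      by (rule braid_word_reduced_adjacent[OF Suc.prems(1) ij(1) ij(2)[unfolded 2] red(2) red(4)[unfolded 2]
            red(1) red(3)[unfolded 2] IH len'])
  next
    case 3
    show ?thesis
      unfolding xs ys 3
      by (rule braid_word_reduced_adjacent[OF Suc.prems(1) ij(2) ij(1)[unfolded 3] red(4) red(2)[unfolded 3]
            red(3) red(1)[unfolded 3] IH len'(2,1), symmetric])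
  next
    case 4
    have wij: "w \<circ> adj i \<circ> adj j permutes {1..n}" by (rule permutes_comp_adj[OF wi ij(2)])
    obtain c where c: "reduced_word n (w \<circ> adj i \<circ> adj j) c"
      using reduced_word_ex[OF wij] by blast
    have eq: "w \<circ> adj j \<circ> adj i = w \<circ> adj i \<circ> adj j"
      using adj_far_comm[OF 4] by (metis comp_assoc)
    have fixed: "adj i j = j" "adj i (Suc j) = Suc j" "adj j i = i" "adj j (Suc i) = Suc i"
      using 4 by (auto simp: Transposition.transpose_def)
    have ci: "reduced_word n (w \<circ> adj i) (c @ [j])"
      unfolding reduced_word_snoc[OF wi ij(2)] using c red fixed by simp
    have cj: "reduced_word n (w \<circ> adj j) (c @ [i])"
      unfolding reduced_word_snoc[OF wj ij(1)] eq using c red fixed by simp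
    have csub: "set c \<subseteq> {1..<n}" using reduced_word_subset c by auto
    note [simp] = t_closed[OF ij(1)] t_closed[OF ij(2)] braid_word_closed[OF csub]
    have "braid_word xs = braid_word c \<otimes> (t j \<otimes> t i)"
      unfolding xs using IH[OF wi len'(1) red(2) ci] sub csub ij by (simp add: braid_word_mult m_assoc)
    also have "\<dots> = braid_word c \<otimes> (t i \<otimes> t j)" using t_far[OF ij 4] by simp
    also have "\<dots> = braid_word ys"
      unfolding ys using IH[OF wj len'(2) red(4) cj] sub csub ij by (simp add: braid_word_mult m_assoc)
    finally show ?thesis .
  qed
qed

definition braid_perm :: "(nat \<Rightarrow> nat) \<Rightarrow> 'a" where
  "braid_perm w = braid_word (SOME is. reduced_word n w is)"

lemma braid_perm_eq:
  assumes "w permutes {1..n}" "reduced_word n w is" shows "braid_perm w = braid_word is"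
  unfolding braid_perm_def
  by (rule braid_word_reduced_unique[OF assms(1) someI[of "reduced_word n w", OF assms(2)] assms(2)])

lemma braid_perm_closed: "w permutes {1..n} \<Longrightarrow> braid_perm w \<in> carrier G"
  using reduced_word_ex[of w n] braid_perm_eq[of w] braid_word_closed reduced_word_subset by metis

lemma braid_perm_id: "braid_perm id = \<one>"
  using braid_perm_eq[OF permutes_id reduced_word_Nil] by simp

lemma braid_perm_ascent:
  assumes w: "w permutes {1..n}" and i: "i \<in> {1..<n}" and asc: "w i < w (Suc i)"
  shows "braid_perm w \<otimes> t i = braid_perm (w \<circ> adj i)"
proof -
  obtain "is" where "is": "reduced_word n w is" using reduced_word_ex[OF w] by blast
  have wi: "w \<circ> adj i permutes {1..n}" using w i by (rule permutes_comp_adj)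
  have "reduced_word n (w \<circ> adj i) (is @ [i])"
    unfolding reduced_word_snoc[OF wi i] adj_adj using "is" asc by simp
  then show ?thesis
    using braid_perm_eq[OF wi] braid_perm_eq[OF w "is"] braid_word_mult[OF reduced_word_subset[OF "is"], of "[t i]"] i by simp
qed

lemma braid_perm_link:
  assumes w: "w permutes {1..n}" and ab: "a \<in> {1..n}" "b \<in> {1..n}"
  shows "braid_perm w \<otimes> link a b = link (w a) (w b) \<otimes> braid_perm w"
proof -
  obtain "is" where "is": "reduced_word n w is" using reduced_word_ex[OF w] by blast
  then have "set is \<subseteq> {1..<n}" "word_perm n is = w" by (auto simp: reduced_word_iff)
  then show ?thesis using braid_word_link[of "is" a b] ab braid_perm_eq[OF w "is"] by simp
qed

end

section \<open>The elements \<open>E\<^sub>A T\<^sub>w\<close> span\<close>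

text \<open>In contrast to \<open>algebra\<close>, the multiplication of \<open>M\<close> need not be commutative.\<close>

locale unital_algebra = Module.module R M + ring M for R and M (structure) +
  assumes smult_mult_left: "\<lbrakk>a \<in> carrier R; x \<in> carrier M; y \<in> carrier M\<rbrakk> \<Longrightarrow>
      (a \<odot> x) \<otimes> y = a \<odot> (x \<otimes> y)"
    and smult_mult_right: "\<lbrakk>a \<in> carrier R; x \<in> carrier M; y \<in> carrier M\<rbrakk> \<Longrightarrow>
      x \<otimes> (a \<odot> y) = a \<odot> (x \<otimes> y)"

text \<open>The scalar \<open>v\<close> stands for \<open>u - 1\<close>.\<close>

locale braids_ties_algebra =
  unital_algebra R M + braids_ties M n t e for R and M (structure) and n t e +
  fixes v
  assumes v_closed: "v \<in> carrier R"
    and quadratic: "i \<in> {1..<n} \<Longrightarrow>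
      t i \<otimes> t i = \<one> \<oplus> v \<odot> (e i \<otimes> (\<one> \<oplus> t i))"
begin

definition standard_set :: "'c set" where
  "standard_set = {tie_partition A \<otimes> braid_perm w | A w. partition_on {1..n} A \<and> w permutes {1..n}}"

lemma standard_set_closed: "standard_set \<subseteq> carrier M"
  by (auto simp: standard_set_def tie_partition_closed braid_perm_closed)

abbreviation standard_span :: "'c set" where
  "standard_span \<equiv> LinearCombinations.module.span R M standard_set"

lemma submodule_standard_span: "LinearCombinations.submodule R standard_span M"
  by (rule span_is_submodule[OF standard_set_closed])

lemma standard_mem:
  assumes "partition_on {1..n} A" "w permutes {1..n}"
  shows "tie_partition A \<otimes> braid_perm w \<in> standard_span"
  using in_own_span[OF standard_set_closed] assms by (auto simp: standard_set_def)

lemma standard_mult_e: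
  assumes A: "partition_on {1..n} A" and w: "w permutes {1..n}" and i: "i \<in> {1..<n}"
  shows "\<exists>B. partition_on {1..n} B \<and>
    tie_partition A \<otimes> braid_perm w \<otimes> e i = tie_partition B \<otimes> braid_perm w"
proof -
  have iS: "i \<in> {1..n}" "Suc i \<in> {1..n}" using i by auto
  have wi: "w i \<in> {1..n}" "w (Suc i) \<in> {1..n}" using permutes_in_image[OF w] iS by auto
  obtain B where B: "partition_on {1..n} B" "tie_partition A \<otimes> link (w i) (w (Suc i)) = tie_partition B"
    using tie_partition_link[OF A wi] by blast
  note cl = tie_partition_closed[OF A] braid_perm_closed[OF w] link_closed[OF wi] link_closed[OF iS]
  have "tie_partition A \<otimes> braid_perm w \<otimes> e i =
      tie_partition A \<otimes> (braid_perm w \<otimes> link i (Suc i))"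
    unfolding link_adj[OF i] using cl e_closed[OF i] by (simp add: m_assoc)
  also have "\<dots> = tie_partition A \<otimes> link (w i) (w (Suc i)) \<otimes> braid_perm w"
    unfolding braid_perm_link[OF w iS] using cl by (simp add: m_assoc)
  finally show ?thesis using B by auto
qed

text \<open>At a descent of \<open>w\<close>, one has \<open>T\<^sub>w = T\<^sub>x T\<^sub>i\<close> with the shorter \<open>x = w s\<^sub>i\<close>, and the quadratic relation
  expands \<open>T\<^sub>x T\<^sub>i\<^sup>2\<close>.\<close>

lemma standard_mult_t:
  assumes A: "partition_on {1..n} A" and w: "w permutes {1..n}" and i: "i \<in> {1..<n}"
  shows "tie_partition A \<otimes> braid_perm w \<otimes> t i \<in> standard_span"
proof -
  define x where "x = w \<circ> adj i"
  have x: "x permutes {1..n}" unfolding x_def by (rule permutes_comp_adj[OF w i])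
  note cl = tie_partition_closed[OF A] braid_perm_closed[OF w] braid_perm_closed[OF x]
    t_closed[OF i] e_closed[OF i] v_closed
  interpret sp: LinearCombinations.submodule R standard_span M by (rule submodule_standard_span)
  consider "w i < w (Suc i)" | "w (Suc i) < w i"
    using permutes_adj_neq[OF w, of i] by linarith
  then show ?thesis
  proof cases
    case 1
    then show ?thesis
      using standard_mem[OF A x] braid_perm_ascent[OF w i] cl by (simp add: m_assoc x_def[symmetric])
  next
    case 2
    have asc: "x i < x (Suc i)" using 2 by (simp add: x_def)
    have Tw: "braid_perm w = braid_perm x \<otimes> t i"
    proof -
      have "x \<circ> adj i = w" unfolding x_def by (rule adj_adj)
      then show ?thesis using braid_perm_ascent[OF x i asc] by metis
    qed
    let ?y = "tie_partition A \<otimes> braid_perm x"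
    obtain B where B: "partition_on {1..n} B" "?y \<otimes> e i = tie_partition B \<otimes> braid_perm x"
      using standard_mult_e[OF A x i] by blast
    note cB = tie_partition_closed[OF B(1)]
    have y: "?y \<in> carrier M" using cl by simp
    have "tie_partition A \<otimes> braid_perm w \<otimes> t i = ?y \<otimes> (t i \<otimes> t i)"
      unfolding Tw using cl by (simp add: m_assoc)
    also have "\<dots> = ?y \<oplus> v \<odot> (?y \<otimes> e i \<oplus> ?y \<otimes> e i \<otimes> t i)"
    proof -
      have "?y \<otimes> (\<one> \<oplus> v \<odot> (e i \<otimes> (\<one> \<oplus> t i))) =
          ?y \<oplus> v \<odot> (?y \<otimes> (e i \<otimes> (\<one> \<oplus> t i)))"
        using y cl by (simp add: r_distr smult_mult_right)
      also have "?y \<otimes> (e i \<otimes> (\<one> \<oplus> t i)) = ?y \<otimes> e i \<otimes> (\<one> \<oplus> t i)"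
        by (rule m_assoc[symmetric]) (use y cl in simp_all)
      also have "\<dots> = ?y \<otimes> e i \<oplus> ?y \<otimes> e i \<otimes> t i"
        using y cl by (simp add: r_distr)
      finally show ?thesis unfolding quadratic[OF i] .
    qed
    also have "?y \<otimes> e i \<otimes> t i = tie_partition B \<otimes> braid_perm w"
      unfolding B(2) Tw using cl cB by (simp add: m_assoc)
    also have "?y \<otimes> e i = tie_partition B \<otimes> braid_perm x" by (rule B(2))
    finally show ?thesis
      using standard_mem[OF A x] standard_mem[OF B(1) x] standard_mem[OF B(1) w] v_closed by simp
  qed
qed

lemma standard_span_mult_closed:
  assumes g: "g \<in> t ` {1..<n} \<union> e ` {1..<n}" and x: "x \<in> standard_span"
  shows "x \<otimes> g \<in> standard_span"
proof -
  have gc: "g \<in> carrier M" using g by auto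
  interpret sp: LinearCombinations.submodule R standard_span M by (rule submodule_standard_span)
  have sub: "LinearCombinations.submodule R {x \<in> carrier M. x \<otimes> g \<in> standard_span} M"
    by unfold_locales (use gc in \<open>auto simp: l_distr smult_mult_left\<close>)
  have "standard_set \<subseteq> {x \<in> carrier M. x \<otimes> g \<in> standard_span}"
  proof
    fix s assume s: "s \<in> standard_set"
    then obtain A w where Aw: "partition_on {1..n} A" "w permutes {1..n}"
      "s = tie_partition A \<otimes> braid_perm w" by (auto simp: standard_set_def)
    have "s \<otimes> g \<in> standard_span"
      using g
    proof
      assume "g \<in> t ` {1..<n}"
      then show ?thesis using standard_mult_t[OF Aw(1,2)] Aw(3) by auto
    next
      assume "g \<in> e ` {1..<n}"
      then obtain i where i: "i \<in> {1..<n}" "g = e i" by auto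
      then show ?thesis
        using standard_mult_e[OF Aw(1,2) i(1)] standard_mem[OF _ Aw(2)] Aw(3) by auto
    qed
    then show "s \<in> {x \<in> carrier M. x \<otimes> g \<in> standard_span}"
      using s standard_set_closed by auto
  qed
  then have "standard_span \<subseteq> {x \<in> carrier M. x \<otimes> g \<in> standard_span}"
    by (rule span_is_subset[OF _ sub])
  then show ?thesis using x by auto
qed

lemma one_in_standard_span: "\<one> \<in> standard_span"
proof -
  let ?A = "(\<lambda>x. {x}) ` {1..n}"
  have A: "partition_on {1..n} ?A" by (rule partition_on_singletons)
  have "\<one> \<otimes> tie_partition ?A = \<one>"
    by (rule absorbs_tie_partition[OF A]) auto
  then show ?thesis
    using standard_mem[OF A permutes_id] braid_perm_id tie_partition_closed[OF A] by simp
qed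

lemma generator_words_in_standard_span:
  assumes "set gs \<subseteq> t ` {1..<n} \<union> e ` {1..<n}"
  shows "list_prod M gs \<in> standard_span"
  using assms
proof (induction gs rule: rev_induct)
  case Nil
  then show ?case using one_in_standard_span by simp
next
  case (snoc g gs)
  have "set gs \<subseteq> carrier M" "g \<in> carrier M" using snoc.prems by auto
  then have "list_prod M (gs @ [g]) = list_prod M gs \<otimes> g"
    by (simp add: list_prod_append)
  then show ?case using standard_span_mult_closed snoc by simp
qed

end

section \<open>Unital algebras\<close>

text \<open>The inverse is \<open>x + (u\<^sup>-\<^sup>1 - 1) z\<close> with \<open>z = e (1 + x)\<close>; it works because \<open>z\<close> is an eigenvector:
  \<open>x z = z x = u z\<close>.\<close>

lemma unit_of_quadratic:
  fixes M :: "('r::comm_ring_1, 'm, 'x) module_scheme" (structure)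
  assumes M: "unital_algebra class_ring M" and x: "x \<in> carrier M" and e: "e \<in> carrier M"
    and idem: "e \<otimes> e = e" and comm: "e \<otimes> x = x \<otimes> e"
    and quad: "x \<otimes> x = \<one> \<oplus> (u - 1) \<odot> (e \<otimes> (\<one> \<oplus> x))" and u: "u * u' = 1"
  shows "x \<in> Units M"
proof -
  interpret unital_algebra class_ring M by fact
  note sm = smult_closed[simplified] smult_l_distr[simplified] smult_r_distr[simplified]
    smult_assoc1[simplified] smult_one[simplified] smult_mult_left[simplified] smult_mult_right[simplified]
  define z where "z = e \<otimes> (\<one> \<oplus> x)"
  have z: "z \<in> carrier M" using x e by (simp add: z_def)
  have exx: "e \<otimes> (x \<otimes> x) = e \<oplus> (u - 1) \<odot> z"
  proof -
    have "e \<otimes> z = z" unfolding z_def using x e idem by (simp flip: m_assoc)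
    then show ?thesis unfolding quad z_def[symmetric] using e z by (simp add: r_distr sm)
  qed
  have "z \<otimes> x = e \<otimes> x \<oplus> e \<otimes> (x \<otimes> x)"
    unfolding z_def using x e by (simp add: r_distr l_distr m_assoc)
  also have "\<dots> = z \<oplus> (u - 1) \<odot> z"
    unfolding exx using x e z sm(1)[of z "u - 1"] by (simp add: z_def r_distr M.a_ac)
  also have "\<dots> = u \<odot> z"
    using sm(2)[of z 1 "u - 1"] sm(5) z by simp
  finally have zx: "z \<otimes> x = u \<odot> z" .
  have xz: "x \<otimes> z = z \<otimes> x"
    unfolding z_def using x e comm by (simp add: r_distr l_distr m_assoc)
  define y where "y = x \<oplus> (u' - 1) \<odot> z"
  have y: "y \<in> carrier M" using x z sm(1) by (simp add: y_def)
  have inv: "\<one> \<oplus> (u - 1) \<odot> z \<oplus> (u' - 1) \<odot> (u \<odot> z) = \<one>"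
  proof -
    have "(u - 1) \<odot> z \<oplus> (u' - 1) \<odot> (u \<odot> z) = ((u - 1) + (u' - 1) * u) \<odot> z"
      using z sm by simp
    also have "(u - 1) + (u' - 1) * u = 0" using u by (simp add: algebra_simps)
    finally show ?thesis using z sm(1) lmult_0[OF z] by (simp add: M.a_assoc)
  qed
  have "x \<otimes> y = \<one>"
    unfolding y_def using x z sm(1) inv by (simp add: r_distr sm xz zx quad z_def[symmetric])
  moreover have "y \<otimes> x = \<one>"
    unfolding y_def using x z sm(1) inv by (simp add: l_distr sm zx quad z_def[symmetric])
  ultimately show ?thesis using x y unfolding Units_def by auto
qed

lemma square_commutes_of_quadratic:
  fixes M :: "('r::comm_ring_1, 'm, 'x) module_scheme" (structure)
  assumes M: "unital_algebra class_ring M" and c: "x \<in> carrier M" "e \<in> carrier M" "d \<in> carrier M"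
    and quad: "x \<otimes> x = \<one> \<oplus> v \<odot> (e \<otimes> (\<one> \<oplus> x))"
    and ed: "e \<otimes> d = d \<otimes> e" and exd: "e \<otimes> (x \<otimes> d) = d \<otimes> (e \<otimes> x)"
  shows "x \<otimes> (x \<otimes> d) = d \<otimes> (x \<otimes> x)"
proof -
  interpret unital_algebra class_ring M by fact
  note sm = smult_closed[simplified] smult_mult_left[simplified] smult_mult_right[simplified]
  have "e \<otimes> (\<one> \<oplus> x) \<otimes> d = d \<otimes> (e \<otimes> (\<one> \<oplus> x))"
    using c ed exd by (simp add: r_distr l_distr m_assoc)
  then have "x \<otimes> x \<otimes> d = d \<otimes> (x \<otimes> x)"
    unfolding quad using c by (simp add: r_distr l_distr sm)
  then show ?thesis using c by (simp add: m_assoc)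
qed

section \<open>Free algebras\<close>

abbreviation (input) "keys \<equiv> Poly_Mapping.keys"
abbreviation (input) "lookup \<equiv> Poly_Mapping.lookup"
abbreviation (input) "single \<equiv> Poly_Mapping.single"

lemma poly_mapping_sum_singles: "p = (\<Sum>g\<in>keys p. single g (lookup p g))"
  by (rule poly_mapping_eqI) (simp add: lookup_sum lookup_single when_def in_keys_iff)

lemma keys_single_plus_subset: "g \<in> C \<Longrightarrow> keys p \<subseteq> C \<Longrightarrow> keys (single g a + p) \<subseteq> C"
  using keys_add[of "single g a" p] by (auto split: if_splits)

text \<open>Additive maps on finitely supported functions are determined by their values on single points; the
  restriction to a set \<open>C\<close> of admissible points is for monoid laws that hold on a carrier only.\<close>

lemma poly_mapping_keys_induct [consumes 1, case_names zero add]: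
  fixes p :: "'g \<Rightarrow>\<^sub>0 'r::comm_monoid_add"
  assumes "keys p \<subseteq> C"
    and zero: "P 0"
    and add: "\<And>g a p. \<lbrakk>g \<in> C; keys p \<subseteq> C; P p\<rbrakk> \<Longrightarrow> P (single g a + p)"
  shows "P p"
proof -
  have "keys (\<Sum>g\<in>A. single g (f g)) \<subseteq> C \<and> P (\<Sum>g\<in>A. single g (f g))"
    if "finite A" "A \<subseteq> C" for A f
    using that
  proof (induction A rule: finite_induct)
    case (insert x F)
    let ?s = "\<Sum>g\<in>F. single g (f g)"
    have s: "keys ?s \<subseteq> C" "P ?s" "x \<in> C" using insert by auto
    show ?case
      unfolding sum.insert[OF insert.hyps]
      using add[OF s(3,1,2), of "f x"] keys_single_plus_subset[OF s(3,1), of "f x"] by simp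
  qed (simp add: zero)
  then show ?thesis
    using poly_mapping_sum_singles[of p] assms(1) finite_keys[of p] by metis
qed

lemma additive_eqI:
  fixes F F' :: "('g \<Rightarrow>\<^sub>0 'r::comm_monoid_add) \<Rightarrow> 'm::monoid_add"
  assumes "keys p \<subseteq> C"
    and "F 0 = 0" "\<And>p q. F (p + q) = F p + F q" "F' 0 = 0" "\<And>p q. F' (p + q) = F' p + F' q"
    and "\<And>g a. g \<in> C \<Longrightarrow> F (single g a) = F' (single g a)"
  shows "F p = F' p"
  using assms(1)
  by (induction p rule: poly_mapping_keys_induct) (simp_all add: assms)

text \<open>The product of a monoid ring, with a bare operation in place of the monoid.\<close>

definition conv :: "('g \<Rightarrow> 'g \<Rightarrow> 'g) \<Rightarrow> ('g \<Rightarrow>\<^sub>0 'r::comm_ring_1) \<Rightarrow> ('g \<Rightarrow>\<^sub>0 'r) \<Rightarrow> ('g \<Rightarrow>\<^sub>0 'r)" where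
  "conv f p q = (\<Sum>g\<in>keys p. \<Sum>h\<in>keys q.
     single (f g h) (lookup p g * lookup q h))"

lemma conv_zero [simp]: "conv f 0 q = 0" "conv f p 0 = 0"
  by (simp_all add: conv_def)

lemma conv_add_right: "conv f p (q + q') = conv f p q + conv f p q'"
  unfolding conv_def sum.distrib[symmetric]
  by (rule sum.cong[OF refl], rule setsum_keys_plus_distrib) (simp_all add: distrib_left single_add)

lemma conv_add_left: "conv f (p + p') q = conv f p q + conv f p' q"
  unfolding conv_def
  by (rule setsum_keys_plus_distrib) (simp_all add: distrib_right single_add sum.distrib)

lemma conv_single_single: "conv f (single g a) (single h b) = single (f g h) (a * b)"
  unfolding conv_def by simp

lemma keys_conv:
  fixes p q :: "'g \<Rightarrow>\<^sub>0 'r::comm_ring_1"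
  assumes "\<And>g h. g \<in> C \<Longrightarrow> h \<in> C \<Longrightarrow> f g h \<in> C" "keys p \<subseteq> C" "keys q \<subseteq> C"
  shows "keys (conv f p q) \<subseteq> C"
proof -
  have "keys (conv f p q) \<subseteq> (\<Union>g\<in>keys p. keys (\<Sum>h\<in>keys q.
     single (f g h) (lookup p g * lookup q h)))"
    unfolding conv_def by (rule keys_sum)
  also have "\<dots> \<subseteq> (\<Union>g\<in>keys p. \<Union>h\<in>keys q.
      keys (single (f g h) (lookup p g * lookup q h)))"
    by (intro UN_mono order_refl keys_sum)
  also have "\<dots> \<subseteq> C" using assms by (auto split: if_splits)
  finally show ?thesis .
qed

lemma conv_assoc:
  fixes p q r :: "'g \<Rightarrow>\<^sub>0 'r::comm_ring_1"
  assumes f: "\<And>g h k. \<lbrakk>g \<in> C; h \<in> C; k \<in> C\<rbrakk> \<Longrightarrow> f (f g h) k = f g (f h k)"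
    and p: "keys p \<subseteq> C" "keys q \<subseteq> C" "keys r \<subseteq> C"
  shows "conv f (conv f p q) r = conv f p (conv f q r)"
proof (rule additive_eqI[OF p(1), where F = "\<lambda>p. conv f (conv f p q) r" and F' = "\<lambda>p. conv f p (conv f q r)"])
  fix g :: 'g and a :: 'r assume g: "g \<in> C"
  let ?p = "single g a"
  show "conv f (conv f ?p q) r = conv f ?p (conv f q r)"
  proof (rule additive_eqI[OF p(2), where F = "\<lambda>q. conv f (conv f ?p q) r" and F' = "\<lambda>q. conv f ?p (conv f q r)"])
    fix h :: 'g and b :: 'r assume h: "h \<in> C"
    let ?q = "single h b"
    show "conv f (conv f ?p ?q) r = conv f ?p (conv f ?q r)"
      by (rule additive_eqI[OF p(3), where F = "\<lambda>r. conv f (conv f ?p ?q) r" and F' = "\<lambda>r. conv f ?p (conv f ?q r)"])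
        (simp_all add: conv_add_right conv_single_single f g h mult.assoc)
  qed (simp_all add: conv_add_left conv_add_right)
qed (simp_all add: conv_add_left)

lemma conv_one:
  fixes p :: "'g \<Rightarrow>\<^sub>0 'r::comm_ring_1"
  assumes "\<And>g. g \<in> C \<Longrightarrow> f e g = g" "\<And>g. g \<in> C \<Longrightarrow> f g e = g" "keys p \<subseteq> C"
  shows "conv f (single e 1) p = p" "conv f p (single e 1) = p"
   by (rule additive_eqI[OF assms(3), where F = "conv f (single e 1)" and F' = "\<lambda>p. p"];
      simp add: conv_add_right conv_single_single assms)
     (rule additive_eqI[OF assms(3), where F = "\<lambda>p. conv f p (single e 1)" and F' = "\<lambda>p. p"];
      simp add: conv_add_left conv_single_single assms)

lemma abelian_group_finitely_supported:
  fixes F :: "('g \<Rightarrow>\<^sub>0 'r::ab_group_add, 'x) ring_scheme"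
  assumes "carrier F = {p. keys p \<subseteq> C}" "add F = (+)" "zero F = 0"
  shows "abelian_group F"
proof (rule abelian_groupI)
  fix p q assume "p \<in> carrier F" "q \<in> carrier F"
  then show "p \<oplus>\<^bsub>F\<^esub> q \<in> carrier F" using keys_add[of p q] by (auto simp: assms)
next
  fix p assume "p \<in> carrier F"
  then show "\<exists>q\<in>carrier F. q \<oplus>\<^bsub>F\<^esub> p = \<zero>\<^bsub>F\<^esub>" by (intro bexI[of _ "- p"]) (simp_all add: assms)
qed (auto simp: assms ac_simps)

lemmas free_algebra_defs = free_algebra_def free_monoid_def monoid_ring_def ring.extend_def module.fields_def

lemma free_algebra_simps [simp]:
  "carrier (free_algebra X) = {p. keys p \<subseteq> lists X}"
  "p \<otimes>\<^bsub>free_algebra X\<^esub> q = conv (@) p q"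
  "\<one>\<^bsub>free_algebra X\<^esub> = single [] 1"
  "\<zero>\<^bsub>free_algebra X\<^esub> = 0"
  "p \<oplus>\<^bsub>free_algebra X\<^esub> q = p + q"
  "c \<odot>\<^bsub>free_algebra X\<^esub> p = Poly_Mapping.map ((*) c) p"
  by (simp_all add: free_algebra_defs ring.defs module.defs conv_def fun_eq_iff)

lemma abelian_group_free_algebra: "abelian_group (free_algebra X)"
  by (rule abelian_group_finitely_supported) (auto simp: fun_eq_iff)

lemma ring_free_algebra:
  "ring (free_algebra X :: ('b::comm_ring_1, 'a list \<Rightarrow>\<^sub>0 'b) module)"
proof (rule ringI)
  show "abelian_group (free_algebra X :: ('b, 'a list \<Rightarrow>\<^sub>0 'b) module)" by (rule abelian_group_free_algebra)
  show "Group.monoid (free_algebra X :: ('b, 'a list \<Rightarrow>\<^sub>0 'b) module)"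
  proof (rule monoidI, unfold free_algebra_simps mem_Collect_eq)
    show "conv (@) (single [] 1) p = p" "conv (@) p (single [] 1) = p"
      if "keys p \<subseteq> lists X" for p :: "'a list \<Rightarrow>\<^sub>0 'b"
      by (rule conv_one[OF _ _ that]; simp)+
    show "keys (conv (@) p q) \<subseteq> lists X"
      if "keys p \<subseteq> lists X" "keys q \<subseteq> lists X"
      for p q :: "'a list \<Rightarrow>\<^sub>0 'b"
      by (rule keys_conv[OF _ that]) simp
    show "conv (@) (conv (@) p q) r = conv (@) p (conv (@) q r)"
      if "keys p \<subseteq> lists X" "keys q \<subseteq> lists X" "keys r \<subseteq> lists X"
      for p q r :: "'a list \<Rightarrow>\<^sub>0 'b"
      by (rule conv_assoc[OF _ that]) simp
  qed simp
qed (simp_all add: conv_add_left conv_add_right)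

lemma lookup_map_times: "lookup (Poly_Mapping.map ((*) (c::'r::comm_ring_1)) p) g = c * lookup p g"
  by (simp add: Poly_Mapping.map.rep_eq when_def)

lemma map_times_add: "Poly_Mapping.map ((*) (c::'r::comm_ring_1)) (p + q) = Poly_Mapping.map ((*) c) p + Poly_Mapping.map ((*) c) q"
  by (rule poly_mapping_eqI) (simp add: lookup_map_times lookup_add distrib_left)

lemma map_times_single: "Poly_Mapping.map ((*) (c::'r::comm_ring_1)) (single g a) = single g (c * a)"
  by (rule poly_mapping_eqI) (auto simp: Poly_Mapping.map.rep_eq lookup_single when_def)

lemma map_times_zero [simp]: "Poly_Mapping.map ((*) (c::'r::comm_ring_1)) 0 = 0"
  by (rule poly_mapping_eqI) (simp add: Poly_Mapping.map.rep_eq)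

lemma cring_class_ring: "cring (class_ring :: 'r::comm_ring_1 ring)"
  by (rule class_cring.cring_axioms)

lemma conv_map_times_left:
  "conv f (Poly_Mapping.map ((*) (c::'r::comm_ring_1)) p) q = Poly_Mapping.map ((*) c) (conv f p q)"
proof (rule additive_eqI[where p = p and C = UNIV and F = "\<lambda>p. conv f (Poly_Mapping.map ((*) c) p) q"
      and F' = "\<lambda>p. Poly_Mapping.map ((*) c) (conv f p q)"])
  fix g and a :: 'r
  show "conv f (Poly_Mapping.map ((*) c) (single g a)) q =
      Poly_Mapping.map ((*) c) (conv f (single g a) q)"
    by (rule additive_eqI[where p = q and C = UNIV and
          F = "\<lambda>q. conv f (Poly_Mapping.map ((*) c) (single g a)) q" and
          F' = "\<lambda>q. Poly_Mapping.map ((*) c) (conv f (single g a) q)"])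
      (simp_all add: map_times_add map_times_single conv_add_right conv_single_single mult.assoc)
qed (simp_all add: map_times_add conv_add_left)

lemma conv_map_times_right:
  "conv f p (Poly_Mapping.map ((*) (c::'r::comm_ring_1)) q) = Poly_Mapping.map ((*) c) (conv f p q)"
proof (rule additive_eqI[where p = p and C = UNIV and F = "\<lambda>p. conv f p (Poly_Mapping.map ((*) c) q)"
      and F' = "\<lambda>p. Poly_Mapping.map ((*) c) (conv f p q)"])
  fix g and a :: 'r
  show "conv f (single g a) (Poly_Mapping.map ((*) c) q) =
      Poly_Mapping.map ((*) c) (conv f (single g a) q)"
    by (rule additive_eqI[where p = q and C = UNIV and
          F = "\<lambda>q. conv f (single g a) (Poly_Mapping.map ((*) c) q)" and
          F' = "\<lambda>q. Poly_Mapping.map ((*) c) (conv f (single g a) q)"])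
      (simp_all add: map_times_add map_times_single conv_add_right conv_single_single mult.left_commute)
qed (simp_all add: map_times_add conv_add_left)

lemma keys_map_times: "keys (Poly_Mapping.map ((*) (c::'r::comm_ring_1)) p) \<subseteq> keys p"
  by (auto simp: in_keys_iff lookup_map_times)

lemma unital_algebra_free_algebra: "unital_algebra class_ring (free_algebra X :: ('r::comm_ring_1, 'a list \<Rightarrow>\<^sub>0 'r) module)"
  by (intro unital_algebra.intro unital_algebra_axioms.intro moduleI cring_class_ring
      abelian_group_free_algebra ring_free_algebra)
    (auto simp: conv_map_times_left conv_map_times_right map_times_add lookup_map_times lookup_add
      distrib_right mult.assoc intro!: poly_mapping_eqI dest!: keys_map_times[THEN subsetD])

section \<open>Quotients\<close>

lemma quotient_algebra_simps:
  "carrier (quotient_algebra F I) = carrier (F Quot I)"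
  "monoid.mult (quotient_algebra F I) = monoid.mult (F Quot I)"
  "one (quotient_algebra F I) = one (F Quot I)"
  "zero (quotient_algebra F I) = zero (F Quot I)"
  "add (quotient_algebra F I) = add (F Quot I)"
  "smult (quotient_algebra F I) = (\<lambda>a X. \<Union>x\<in>X. I +>\<^bsub>F\<^esub> (a \<odot>\<^bsub>F\<^esub> x))"
  by (simp_all add: quotient_algebra_def ring.defs module.defs)

context abelian_subgroup
begin

lemma coset_eq_iff: "x \<in> carrier G \<Longrightarrow> y \<in> carrier G \<Longrightarrow> H +> x = H +> y \<longleftrightarrow> x \<ominus> y \<in> H"
  by (metis a_minus_def a_repr_independence' a_repr_independenceD a_rcos_module)

end

text \<open>Conditions under which \<open>quotient_algebra\<close> is a module.  The laws of the action are required only modulo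
  the subgroup, so that this covers both the quotient of an algebra by an ideal and the tensor
  product, where the free group on pairs is not itself a module.\<close>

locale scalar_quotient = abelian_subgroup I F + S: cring S
  for I and F :: "('s, 'b, 'x) module_scheme" (structure) and S :: "('s, 'y) ring_scheme" +
  assumes smult_closed: "\<lbrakk>a \<in> carrier S; x \<in> carrier F\<rbrakk> \<Longrightarrow> a \<odot>\<^bsub>F\<^esub> x \<in> carrier F"
    and smult_add: "\<lbrakk>a \<in> carrier S; x \<in> carrier F; y \<in> carrier F\<rbrakk> \<Longrightarrow>
      a \<odot>\<^bsub>F\<^esub> (x \<oplus>\<^bsub>F\<^esub> y) = a \<odot>\<^bsub>F\<^esub> x \<oplus>\<^bsub>F\<^esub> a \<odot>\<^bsub>F\<^esub> y"
    and smult_I: "\<lbrakk>a \<in> carrier S; x \<in> I\<rbrakk> \<Longrightarrow> a \<odot>\<^bsub>F\<^esub> x \<in> I"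
    and smult_distr_mod: "\<lbrakk>a \<in> carrier S; b \<in> carrier S; x \<in> carrier F\<rbrakk> \<Longrightarrow>
      I +> ((a \<oplus>\<^bsub>S\<^esub> b) \<odot>\<^bsub>F\<^esub> x) = I +> (a \<odot>\<^bsub>F\<^esub> x \<oplus>\<^bsub>F\<^esub> b \<odot>\<^bsub>F\<^esub> x)"
    and smult_assoc_mod: "\<lbrakk>a \<in> carrier S; b \<in> carrier S; x \<in> carrier F\<rbrakk> \<Longrightarrow>
      I +> ((a \<otimes>\<^bsub>S\<^esub> b) \<odot>\<^bsub>F\<^esub> x) = I +> (a \<odot>\<^bsub>F\<^esub> (b \<odot>\<^bsub>F\<^esub> x))"
    and smult_one_mod: "x \<in> carrier F \<Longrightarrow> I +> (\<one>\<^bsub>S\<^esub> \<odot>\<^bsub>F\<^esub> x) = I +> x"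
begin

lemma carrier_quotient: "carrier (quotient_algebra F I) = (\<lambda>x. I +> x) ` carrier F"
  by (auto simp: quotient_algebra_simps FactRing_simps)

lemma coset_closed: "x \<in> carrier F \<Longrightarrow> I +> x \<in> carrier (quotient_algebra F I)"
  by (simp add: carrier_quotient)

lemma add_coset: "x \<in> carrier F \<Longrightarrow> y \<in> carrier F \<Longrightarrow>
    (I +> x) \<oplus>\<^bsub>quotient_algebra F I\<^esub> (I +> y) = I +> (x \<oplus> y)"
  by (simp add: quotient_algebra_simps FactRing_def a_rcos_sum)

lemma zero_coset: "\<zero>\<^bsub>quotient_algebra F I\<^esub> = I +> \<zero>"
  by (simp add: quotient_algebra_simps FactRing_def a_rcos_const)

lemma smult_coset:
  assumes "a \<in> carrier S" "x \<in> carrier F"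
  shows "a \<odot>\<^bsub>quotient_algebra F I\<^esub> (I +> x) = I +> (a \<odot>\<^bsub>F\<^esub> x)"
proof -
  have "I +> (a \<odot>\<^bsub>F\<^esub> y) = I +> (a \<odot>\<^bsub>F\<^esub> x)" if y: "y \<in> I +> x" for y
  proof -
    obtain h where h: "h \<in> I" "y = h \<oplus> x" using y by (auto simp: a_r_coset_def r_coset_def)
    have "a \<odot>\<^bsub>F\<^esub> y = a \<odot>\<^bsub>F\<^esub> h \<oplus> a \<odot>\<^bsub>F\<^esub> x"
      using h assms by (simp add: smult_add)
    moreover have "a \<odot>\<^bsub>F\<^esub> h \<in> I" using smult_I assms h by blast
    ultimately have "a \<odot>\<^bsub>F\<^esub> y \<in> I +> (a \<odot>\<^bsub>F\<^esub> x)" by (auto simp: a_r_coset_def r_coset_def)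
    then show ?thesis using a_repr_independence' smult_closed assms by metis
  qed
  then show ?thesis
    unfolding quotient_algebra_simps by (intro UN_constant_eq[OF a_rcos_self[OF assms(2)]] ballI)
qed

lemma abelian_group_quotient: "abelian_group (quotient_algebra F I)"
proof (rule abelian_groupI)
  fix x assume "x \<in> carrier (quotient_algebra F I)"
  then obtain p where p: "p \<in> carrier F" "x = I +> p" by (auto simp: carrier_quotient)
  show "\<exists>y\<in>carrier (quotient_algebra F I). y \<oplus>\<^bsub>quotient_algebra F I\<^esub> x = \<zero>\<^bsub>quotient_algebra F I\<^esub>"
    by (rule bexI[of _ "I +> (\<ominus> p)"]) (use p in \<open>simp_all add: add_coset zero_coset coset_closed l_neg del: a_coset_add_zero\<close>)
qed (auto simp: carrier_quotient add_coset zero_coset a_assoc simp del: a_coset_add_zero, simp_all add: a_comm)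

lemma module_quotient: "Module.module S (quotient_algebra F I)"
  by (rule moduleI[OF S.is_cring abelian_group_quotient])
    (auto simp: carrier_quotient smult_coset add_coset smult_closed smult_add smult_distr_mod
      smult_assoc_mod smult_one_mod)

end

lemma scalar_quotient_algebra:
  assumes "unital_algebra R F" "ideal I F"
  shows "scalar_quotient I F R"
proof -
  interpret unital_algebra R F by fact
  interpret ideal I F by fact
  interpret abelian_subgroup I F by (rule abelian_subgroupI3[OF is_additive_subgroup is_abelian_group])
  show ?thesis
  proof
    fix a x assume a: "a \<in> carrier R" and x: "x \<in> I"
    have "a \<odot>\<^bsub>F\<^esub> x = (a \<odot>\<^bsub>F\<^esub> \<one>\<^bsub>F\<^esub>) \<otimes>\<^bsub>F\<^esub> x"
      using a x by (simp add: smult_mult_left)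
    then show "a \<odot>\<^bsub>F\<^esub> x \<in> I" using a x I_l_closed by simp
  qed (simp_all add: smult_l_distr smult_r_distr smult_assoc1)
qed

lemma quotient_mult_coset:
  assumes "ideal I F" "x \<in> carrier F" "y \<in> carrier F"
  shows "(I +>\<^bsub>F\<^esub> x) \<otimes>\<^bsub>quotient_algebra F I\<^esub> (I +>\<^bsub>F\<^esub> y) = I +>\<^bsub>F\<^esub> (x \<otimes>\<^bsub>F\<^esub> y)"
proof -
  interpret ideal I F by fact
  show ?thesis using assms by (simp add: quotient_algebra_simps FactRing_def rcoset_mult_add)
qed

lemma quotient_one_coset: "\<one>\<^bsub>quotient_algebra F I\<^esub> = I +>\<^bsub>F\<^esub> \<one>\<^bsub>F\<^esub>"
  by (simp add: quotient_algebra_simps FactRing_def)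

lemma unital_algebra_quotient:
  assumes F: "unital_algebra R F" and I: "ideal I F"
  shows "unital_algebra R (quotient_algebra F I)"
proof -
  interpret F: unital_algebra R F by fact
  interpret I: ideal I F by fact
  interpret scalar_quotient I F R by (rule scalar_quotient_algebra[OF F I])
  have mult: "(I +>\<^bsub>F\<^esub> x) \<otimes>\<^bsub>quotient_algebra F I\<^esub> (I +>\<^bsub>F\<^esub> y) = I +>\<^bsub>F\<^esub> (x \<otimes>\<^bsub>F\<^esub> y)"
    if "x \<in> carrier F" "y \<in> carrier F" for x y
    by (rule quotient_mult_coset[OF I that])
  have one: "\<one>\<^bsub>quotient_algebra F I\<^esub> = I +>\<^bsub>F\<^esub> \<one>\<^bsub>F\<^esub>"
    by (rule quotient_one_coset)
  have "Group.monoid (quotient_algebra F I)"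
    by (rule monoidI) (auto simp: carrier_quotient mult one F.m_assoc)
  then have "ring (quotient_algebra F I)"
    by (intro ringI abelian_group_quotient) (auto simp: carrier_quotient mult add_coset F.l_distr F.r_distr)
  then show ?thesis
    by (intro unital_algebra.intro module_quotient unital_algebra_axioms.intro)
      (auto simp: carrier_quotient mult smult_coset F.smult_mult_left F.smult_mult_right)
qed

section \<open>Base change of a free module\<close>

definition linear_functional :: "('r::comm_ring_1, 'm, 'x) module_scheme \<Rightarrow> ('m \<Rightarrow> 'r) \<Rightarrow> bool" where
  "linear_functional M \<Psi> \<longleftrightarrow>
     (\<forall>x\<in>carrier M. \<forall>y\<in>carrier M. \<Psi> (x \<oplus>\<^bsub>M\<^esub> y) = \<Psi> x + \<Psi> y) \<and>
     (\<forall>a. \<forall>x\<in>carrier M. \<Psi> (a \<odot>\<^bsub>M\<^esub> x) = a * \<Psi> x)"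

lemma lincomb_functional:
  fixes M :: "('r::comm_ring_1, 'm, 'x) module_scheme"
  assumes M: "Module.module class_ring M" and \<Psi>: "linear_functional M \<Psi>"
    and A: "finite A" "A \<subseteq> carrier M"
  shows "\<Psi> (LinearCombinations.module.lincomb M a A) = (\<Sum>v\<in>A. a v * \<Psi> v)"
proof -
  interpret Module.module "class_ring :: 'r ring" M by fact
  show ?thesis using A
  proof (induction A rule: finite_induct)
    case empty
    have "\<Psi> (0 \<odot>\<^bsub>M\<^esub> \<zero>\<^bsub>M\<^esub>) = 0 * \<Psi> \<zero>\<^bsub>M\<^esub>"
      using \<Psi> M.zero_closed unfolding linear_functional_def by blast
    then show ?case using lmult_0[OF M.zero_closed] by (simp add: lincomb_def)
  next
    case (insert v A)
    have "lincomb a (insert v A) = a v \<odot>\<^bsub>M\<^esub> v \<oplus>\<^bsub>M\<^esub> lincomb a A"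
      using lincomb_insert[of A a v] insert by simp
    then show ?case
      using insert \<Psi> lincomb_closed[of A a] smult_closed[of "a v" v] by (simp add: linear_functional_def)
  qed
qed

text \<open>Coordinates with respect to a finite basis.  Independence makes them unique, hence additive and
  homogeneous.\<close>

locale finite_free_module = Module.module class_ring M
  for M :: "('r::comm_ring_1, 'm, 'x) module_scheme" (structure) +
  fixes B
  assumes basis: "module_basis class_ring M B" and finite_B: "finite B"
begin

lemma B_carrier: "B \<subseteq> carrier M"
  using basis by (simp add: module_basis_def)

definition coord :: "'m \<Rightarrow> 'm \<Rightarrow> 'r" where
  "coord m = (SOME a. lincomb a B = m)"

lemma lincomb_coord: "m \<in> carrier M \<Longrightarrow> lincomb (coord m) B = m"
proof -
  assume "m \<in> carrier M"
  then have "m \<in> LinearCombinations.module.span class_ring M B"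
    using basis by (simp add: module_basis_def)
  then have "\<exists>a. lincomb a B = m"
    using finite_in_span[OF finite_B B_carrier] by blast
  then show ?thesis unfolding coord_def by (rule someI_ex)
qed

lemma lincomb_eq_imp_coeffs_eq:
  assumes "lincomb a B = lincomb a' B" "b \<in> B" shows "a b = a' b"
proof (rule ccontr)
  assume ne: "a b \<noteq> a' b"
  have "lincomb (\<lambda>v. a v + - a' v) B = lincomb a B \<oplus> lincomb (\<lambda>v. (-1) * a' v) B"
    using lincomb_sum[OF finite_B B_carrier, of a "\<lambda>v. (-1) * a' v"] by simp
  also have "lincomb (\<lambda>v. (-1) * a' v) B = (-1) \<odot> lincomb a' B"
    using lincomb_smult[OF B_carrier, of a' "-1"] by simp
  also have "lincomb a B \<oplus> (-1) \<odot> lincomb a' B = (1 + (-1)) \<odot> lincomb a' B"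
    unfolding assms(1) using smult_l_distr[of 1 "-1" "lincomb a' B"] smult_one[of "lincomb a' B"] lincomb_closed[OF B_carrier, of a'] by simp
  also have "\<dots> = \<zero>" using lmult_0[of "lincomb a' B"] lincomb_closed[OF B_carrier, of a'] by simp
  finally have "lin_dep B"
    unfolding lin_dep_def using finite_B assms(2) ne
    by (intro exI[of _ B] exI[of _ "\<lambda>v. a v + - a' v"] exI[of _ b]) auto
  then show False using basis by (simp add: module_basis_def)
qed

lemma coord_add:
  assumes "m \<in> carrier M" "m' \<in> carrier M" "b \<in> B"
  shows "coord (m \<oplus> m') b = coord m b + coord m' b"
proof (rule lincomb_eq_imp_coeffs_eq[OF _ assms(3)])
  have "lincomb (\<lambda>b. coord m b + coord m' b) B = lincomb (coord m) B \<oplus> lincomb (coord m') B"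
    using lincomb_sum[OF finite_B B_carrier, of "coord m" "coord m'"] by simp
  then show "lincomb (coord (m \<oplus> m')) B = lincomb (\<lambda>b. coord m b + coord m' b) B"
    using assms by (simp add: lincomb_coord)
qed

lemma coord_smult:
  assumes "m \<in> carrier M" "b \<in> B"
  shows "coord (r \<odot> m) b = r * coord m b"
proof (rule lincomb_eq_imp_coeffs_eq[OF _ assms(2)])
  have "lincomb (\<lambda>b. r * coord m b) B = r \<odot> lincomb (coord m) B"
    using lincomb_smult[OF B_carrier, of "coord m" r] by simp
  then show "lincomb (coord (r \<odot> m)) B = lincomb (\<lambda>b. r * coord m b) B"
    using assms smult_closed[of r m] by (simp add: lincomb_coord)
qed

lemma coord_basis:
  assumes "b \<in> B" "c \<in> B" shows "coord b c = (if c = b then 1 else 0)"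
proof (rule lincomb_eq_imp_coeffs_eq[OF _ assms(2)])
  have b: "b \<in> carrier M" using assms B_carrier by auto
  have "lincomb (\<lambda>c. if c = b then 1 else 0) B = (1 \<odot> b) \<oplus> lincomb (\<lambda>c. if c = b then 1 else 0) (B - {b})"
    using lincomb_del2[OF finite_B B_carrier _ assms(1), of "\<lambda>c. if c = b then 1 else 0"] by simp
  also have "lincomb (\<lambda>c. if c = b then 1 else 0) (B - {b}) = \<zero>"
    unfolding lincomb_def
    by (rule finsum_all0) (use B_carrier finite_B lmult_0 in \<open>auto simp: subset_iff\<close>)
  finally show "lincomb (coord b) B = lincomb (\<lambda>c. if c = b then 1 else 0) B"
    using b smult_one[OF b] by (simp add: lincomb_coord)
qed

end

locale base_change = Module.module class_ring M
  for M :: "('r::comm_ring_1, 'm, 'x) module_scheme" (structure) +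
  fixes h :: "'r \<Rightarrow> 's::comm_ring_1"
  assumes h_add: "h (a + b) = h a + h b" and h_mult: "h (a * b) = h a * h b" and h_one: "h 1 = 1"
begin

abbreviation "F \<equiv> tensor_free M (class_ring :: 's ring)"
abbreviation "I \<equiv> tensor_subgroup (class_ring :: 'r ring) M (class_ring :: 's ring) h"
abbreviation "relators \<equiv> tensor_relators (class_ring :: 'r ring) M (class_ring :: 's ring) h"
abbreviation "Q \<equiv> extension_of_scalars (class_ring :: 'r ring) M (class_ring :: 's ring) h"

lemma F_simps [simp]:
  "carrier F = {p. keys p \<subseteq> carrier M \<times> UNIV}"
  "\<zero>\<^bsub>F\<^esub> = 0"
  "p \<oplus>\<^bsub>F\<^esub> q = p + q"
  by (simp_all add: tensor_free_def monoid_ring_def ring.defs module.defs DirProd_def)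

abbreviation scale :: "'s \<Rightarrow> ('m \<times> 's \<Rightarrow>\<^sub>0 int) \<Rightarrow> ('m \<times> 's \<Rightarrow>\<^sub>0 int)" (infixr \<open>\<cdot>\<close> 75) where
  "c \<cdot> p \<equiv> c \<odot>\<^bsub>F\<^esub> p"

lemma F_smult: "c \<cdot> p = frag_extend (\<lambda>(m, s). frag_of (m, c * s)) p"
proof -
  have "frag_cmul k (frag_of x) = single x k" for k and x :: "'m \<times> 's"
    by (rule poly_mapping_eqI) (simp add: lookup_single when_def)
  then show ?thesis
    by (simp add: tensor_free_def monoid_ring_def ring.defs module.defs frag_extend_def case_prod_unfold)
qed

lemma abelian_group_F: "abelian_group F"
  by (rule abelian_group_finitely_supported) (auto simp: fun_eq_iff)

lemma F_inv: "p \<in> carrier F \<Longrightarrow> \<ominus>\<^bsub>F\<^esub> p = - p"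
proof -
  interpret abelian_group F by (rule abelian_group_F)
  assume "p \<in> carrier F"
  then show ?thesis by (intro minus_equality) simp_all
qed

lemma F_minus: "p \<in> carrier F \<Longrightarrow> q \<in> carrier F \<Longrightarrow> p \<ominus>\<^bsub>F\<^esub> q = p - q"
  by (simp add: a_minus_def F_inv del: F_simps(1))

lemma subgroup_F:
  assumes "N \<subseteq> carrier F" "0 \<in> N" "\<And>p q. p \<in> N \<Longrightarrow> q \<in> N \<Longrightarrow> p + q \<in> N" "\<And>p. p \<in> N \<Longrightarrow> - p \<in> N"
  shows "subgroup N (add_monoid F)"
proof -
  interpret abelian_group F by (rule abelian_group_F)
  have "inv\<^bsub>add_monoid F\<^esub> p \<in> N" if "p \<in> N" for p
  proof -
    have "p \<in> carrier F" using that assms(1) by blast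
    then show ?thesis using F_inv[of p] assms(4)[OF that] unfolding a_inv_def by metis
  qed
  then show ?thesis
    by (intro subgroup.intro) (use assms in auto)
qed

lemma relators_carrier: "relators \<subseteq> carrier F"
proof
  fix p assume "p \<in> relators"
  then show "p \<in> carrier F"
  proof cases
    case (add_left m m' s)
    then show ?thesis
      by (auto dest!: subsetD[OF keys_diff] subsetD[OF keys_add] split: if_splits)
  next
    case (add_right m s s')
    then show ?thesis
      by (auto dest!: subsetD[OF keys_diff] subsetD[OF keys_add] split: if_splits)
  next
    case (balanced r m s)
    then show ?thesis
      using smult_closed[of r m]
      by (auto dest!: subsetD[OF keys_diff] subsetD[OF keys_add] split: if_splits)
  qed
qed

lemma subgroup_I: "subgroup I (add_monoid F)"
proof -
  interpret abelian_group F by (rule abelian_group_F)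
  show ?thesis
    unfolding tensor_subgroup_def
    by (rule add.generate_is_subgroup) (use relators_carrier in simp)
qed

lemma I_least:
  assumes "subgroup N (add_monoid F)" "relators \<subseteq> N"
  shows "I \<subseteq> N"
proof -
  interpret abelian_group F by (rule abelian_group_F)
  show ?thesis
    unfolding tensor_subgroup_def by (rule add.generate_subgroup_incl[OF assms(2,1)])
qed

lemma relators_I: "relators \<subseteq> I"
  unfolding tensor_subgroup_def by (auto intro: generate.incl)

sublocale I: abelian_subgroup I F
proof -
  interpret abelian_group F by (rule abelian_group_F)
  show "abelian_subgroup I F"
    by (rule abelian_subgroupI3) (use subgroup_I in \<open>auto intro: additive_subgroupI abelian_group_F\<close>)
qed

lemma I_add: "p \<in> I \<Longrightarrow> q \<in> I \<Longrightarrow> p + q \<in> I"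
  using subgroup.m_closed[OF subgroup_I, of p q] by simp

lemma I_carrier: "p \<in> I \<Longrightarrow> p \<in> carrier F"
  using I.a_subset by blast

lemma I_uminus: "p \<in> I \<Longrightarrow> - p \<in> I"
  using subgroup.m_inv_closed[OF subgroup_I, of p] F_inv[OF I_carrier, of p] unfolding a_inv_def by metis

lemma I_diff: "p \<in> I \<Longrightarrow> q \<in> I \<Longrightarrow> p - q \<in> I"
  using I_add[of p "- q"] I_uminus by simp

lemma I_zero: "0 \<in> I"
  using subgroup.one_closed[OF subgroup_I] by simp

lemma F_smult_closed: "p \<in> carrier F \<Longrightarrow> c \<cdot> p \<in> carrier F"
proof -
  assume p: "p \<in> carrier F"
  have "keys (frag_extend (\<lambda>(m, s). frag_of (m, c * s)) p) \<subseteq>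
      (\<Union>x\<in>keys p. keys ((\<lambda>(m, s). frag_of (m, c * s)) x))"
    by (rule keys_frag_extend)
  also have "\<dots> \<subseteq> carrier M \<times> UNIV" using p by auto
  finally show ?thesis by (simp add: F_smult)
qed

lemma F_smult_zero: "c \<cdot> 0 = 0"
  by (simp add: F_smult)

lemma F_smult_add: "c \<cdot> (p + q) = c \<cdot> p + c \<cdot> q"
  by (simp add: F_smult frag_extend_add)

lemma F_smult_minus: "c \<cdot> (- p) = - (c \<cdot> p)"
  by (simp add: F_smult frag_extend_minus del: minus_frag_cmul)

lemma F_smult_diff: "c \<cdot> (p - q) = c \<cdot> p - c \<cdot> q"
  by (simp add: F_smult frag_extend_diff)

lemma F_smult_single: "c \<cdot> (frag_of (m, s)) = frag_of (m, c * s)"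
  by (simp add: F_smult)

lemma F_smult_I: "p \<in> I \<Longrightarrow> c \<cdot> p \<in> I"
proof -
  have "I \<subseteq> {p \<in> carrier F. c \<cdot> p \<in> I}"
  proof (rule I_least)
    show "subgroup {p \<in> carrier F. c \<cdot> p \<in> I} (add_monoid F)"
    proof (rule subgroup_F)
      show "0 \<in> {p \<in> carrier F. c \<cdot> p \<in> I}" by (simp add: F_smult I_zero)
      show "p + q \<in> {p \<in> carrier F. c \<cdot> p \<in> I}"
        if "p \<in> {p \<in> carrier F. c \<cdot> p \<in> I}" "q \<in> {p \<in> carrier F. c \<cdot> p \<in> I}" for p q
        using that keys_add[of p q] by (auto simp: F_smult_add I_add)
      show "- p \<in> {p \<in> carrier F. c \<cdot> p \<in> I}" if "p \<in> {p \<in> carrier F. c \<cdot> p \<in> I}" for p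
        using that by (simp add: F_smult_minus I_uminus)
    qed auto
    show "relators \<subseteq> {p \<in> carrier F. c \<cdot> p \<in> I}"
    proof
      fix p assume p: "p \<in> relators"
      from p have "c \<cdot> p \<in> relators"
      proof cases
        case (add_left m m' s)
        then show ?thesis
          using tensor_relators.add_left[of m M m' "c * s" "class_ring :: 's ring"]
          by (simp add: F_smult_diff F_smult_add F_smult_single)
      next
        case (add_right m s s')
        then show ?thesis
          using tensor_relators.add_right[of m M "c * s" "class_ring :: 's ring" "c * s'"]
          by (simp add: F_smult_diff F_smult_add F_smult_single distrib_left)
      next
        case (balanced r m s)
        then show ?thesis
          using tensor_relators.balanced[of r "class_ring :: 'r ring" m M "c * s" "class_ring :: 's ring" h]
          by (simp add: F_smult_diff F_smult_add F_smult_single mult.left_commute)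
      qed
      then show "p \<in> {p \<in> carrier F. c \<cdot> p \<in> I}"
        using relators_I relators_carrier p by auto
    qed
  qed
  then show "p \<in> I \<Longrightarrow> c \<cdot> p \<in> I" by blast
qed

text \<open>The pairs generate the free abelian group, so an additive map sends everything into \<open>I\<close> as soon as
  it does so on pairs.\<close>

lemma additive_in_I:
  fixes D :: "('m \<times> 's \<Rightarrow>\<^sub>0 int) \<Rightarrow> ('m \<times> 's \<Rightarrow>\<^sub>0 int)"
  assumes "p \<in> carrier F" "D 0 = 0" "\<And>p q. D (p - q) = D p - D q"
    and "\<And>m s. m \<in> carrier M \<Longrightarrow> D (frag_of (m, s)) \<in> I"
  shows "D p \<in> I"
proof -
  have "keys p \<subseteq> carrier M \<times> UNIV" using assms(1) by simp
  then show ?thesis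
    by (induction p rule: frag_induction) (auto simp: assms I_zero I_diff)
qed

lemma coset_eqI: "p \<in> carrier F \<Longrightarrow> q \<in> carrier F \<Longrightarrow> p - q \<in> I \<Longrightarrow> I +>\<^bsub>F\<^esub> p = I +>\<^bsub>F\<^esub> q"
  using I.coset_eq_iff[of p q] by (simp add: F_minus del: F_simps(1))

lemma smult_distr_I: "p \<in> carrier F \<Longrightarrow> (a + b) \<cdot> p - (a \<cdot> p + b \<cdot> p) \<in> I"
proof (rule additive_in_I[where D = "\<lambda>p. (a + b) \<cdot> p - (a \<cdot> p + b \<cdot> p)"])
  fix m and s :: 's assume "m \<in> carrier M"
  then have "frag_of (m, a * s + b * s) - (frag_of (m, a * s) + frag_of (m, b * s)) \<in> I"
    using tensor_relators.add_right[of m M "a * s" "class_ring :: 's ring" "b * s"] relators_I by auto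
  then show "(a + b) \<cdot> frag_of (m, s) - (a \<cdot> frag_of (m, s) + b \<cdot> frag_of (m, s)) \<in> I"
    by (simp add: F_smult_single distrib_right)
qed (simp_all add: F_smult_diff F_smult_zero)

lemma F_smult_assoc: "(a * b) \<cdot> p = a \<cdot> (b \<cdot> p)"
  by (induction p rule: frag_induction[OF subset_UNIV]) (auto simp: F_smult_diff F_smult_single mult.assoc F_smult_zero)

lemma F_smult_one: "1 \<cdot> p = p"
  by (induction p rule: frag_induction[OF subset_UNIV]) (auto simp: F_smult_diff F_smult_single F_smult_zero)

sublocale sq: scalar_quotient I F "class_ring :: 's ring"
proof (intro scalar_quotient.intro scalar_quotient_axioms.intro)
  show "abelian_subgroup I F" by (rule I.abelian_subgroup_axioms)
  show "cring (class_ring :: 's ring)" by (rule cring_class_ring)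
  fix a b :: 's and p q assume p: "p \<in> carrier F"
  show "a \<cdot> p \<in> carrier F" by (rule F_smult_closed[OF p])
  show "a \<cdot> (p \<oplus>\<^bsub>F\<^esub> q) = a \<cdot> p \<oplus>\<^bsub>F\<^esub> a \<cdot> q" by (simp add: F_smult_add)
  have "a \<cdot> p \<oplus>\<^bsub>F\<^esub> b \<cdot> p \<in> carrier F"
    by (rule I.add.m_closed[simplified monoid_record_simps]; rule F_smult_closed[OF p])
  then show "I +>\<^bsub>F\<^esub> ((a \<oplus>\<^bsub>class_ring\<^esub> b) \<cdot> p) = I +>\<^bsub>F\<^esub> (a \<cdot> p \<oplus>\<^bsub>F\<^esub> b \<cdot> p)"
    using coset_eqI[OF F_smult_closed[OF p, of "a + b"]] smult_distr_I[OF p, of a b] by simp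
  show "I +>\<^bsub>F\<^esub> ((a \<otimes>\<^bsub>class_ring\<^esub> b) \<cdot> p) = I +>\<^bsub>F\<^esub> (a \<cdot> (b \<cdot> p))"
    by (simp add: F_smult_assoc)
  show "I +>\<^bsub>F\<^esub> (\<one>\<^bsub>class_ring\<^esub> \<cdot> p) = I +>\<^bsub>F\<^esub> p"
    by (simp add: F_smult_one)
next
  fix a :: 's and p assume "p \<in> I"
  then show "a \<cdot> p \<in> I" by (rule F_smult_I)
qed

lemma module_Q: "Module.module (class_ring :: 's ring) Q"
  unfolding extension_of_scalars_def by (rule sq.module_quotient)

end

locale free_base_change = base_change M h + finite_free_module M B
  for M :: "('r::comm_ring_1, 'm, 'x) module_scheme" (structure)
    and h :: "'r \<Rightarrow> 's::comm_ring_1" and B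
begin

abbreviation pure :: "'m \<Rightarrow> 's \<Rightarrow> ('m \<times> 's \<Rightarrow>\<^sub>0 int) set" where
  "pure m s \<equiv> pure_tensor (class_ring :: 'r ring) M (class_ring :: 's ring) h m s"

abbreviation can :: "'m \<Rightarrow> ('m \<times> 's \<Rightarrow>\<^sub>0 int) set" where
  "can \<equiv> canonical_map (class_ring :: 'r ring) M (class_ring :: 's ring) h"

lemma can_pure: "can m = pure m 1"
  by (simp add: canonical_map_def)

lemma Q_quotient: "Q = quotient_algebra F I"
  by (rule extension_of_scalars_def)

lemma single_F: "m \<in> carrier M \<Longrightarrow> frag_of (m, s) \<in> carrier F"
  by simp

lemma pure_closed: "m \<in> carrier M \<Longrightarrow> pure m s \<in> carrier Q"
  unfolding pure_tensor_def Q_quotient by (rule sq.coset_closed[OF single_F])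

lemma pure_add:
  assumes "m \<in> carrier M" "m' \<in> carrier M"
  shows "pure (m \<oplus> m') s = pure m s \<oplus>\<^bsub>Q\<^esub> pure m' s"
proof -
  have "frag_of (m \<oplus> m', s) - (frag_of (m, s) + frag_of (m', s)) \<in> I"
    using tensor_relators.add_left[of m M m' s "class_ring :: 's ring"] assms relators_I by auto
  moreover have "frag_of (m, s) \<oplus>\<^bsub>F\<^esub> frag_of (m', s) \<in> carrier F"
    by (rule I.add.m_closed[simplified monoid_record_simps]; rule single_F; fact)
  ultimately have "I +>\<^bsub>F\<^esub> frag_of (m \<oplus> m', s) = I +>\<^bsub>F\<^esub> (frag_of (m, s) \<oplus>\<^bsub>F\<^esub> frag_of (m', s))"
    using single_F[of "m \<oplus> m'" s] assms by (intro coset_eqI) simp_all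
  then show ?thesis
    unfolding pure_tensor_def Q_quotient sq.add_coset[OF single_F[OF assms(1)] single_F[OF assms(2)]] .
qed

lemma pure_smult:
  assumes "m \<in> carrier M" shows "pure (r \<odot> m) s = pure m (h r * s)"
proof -
  have "frag_of (r \<odot> m, s) - frag_of (m, h r * s) \<in> I"
    using tensor_relators.balanced[of r "class_ring :: 'r ring" m M s "class_ring :: 's ring" h] assms relators_I by auto
  moreover have "r \<odot> m \<in> carrier M" using assms smult_closed[of r m] by simp
  ultimately show ?thesis
    unfolding pure_tensor_def using assms by (intro coset_eqI single_F)
qed

lemma smult_pure:
  assumes "m \<in> carrier M" shows "c \<odot>\<^bsub>Q\<^esub> pure m s = pure m (c * s)"
  unfolding pure_tensor_def Q_quotient
  using sq.smult_coset[of c "frag_of (m, s)"] single_F[OF assms] by (simp add: F_smult_single del: F_simps)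

abbreviation can_span :: "('m \<times> 's \<Rightarrow>\<^sub>0 int) set set" where
  "can_span \<equiv> LinearCombinations.module.span (class_ring :: 's ring) Q (can ` B)"

lemma can_closed: "can ` B \<subseteq> carrier Q"
  using B_carrier pure_closed by (auto simp: can_pure)

lemma submodule_can_span: "LinearCombinations.submodule (class_ring :: 's ring) can_span Q"
  by (rule LinearCombinations.module.span_is_submodule[OF module_Q can_closed])

text \<open>The pairs \<open>(b, 1)\<close> generate: \<open>(\<Sum>\<^sub>b a\<^sub>b b) \<otimes> s = \<Sum>\<^sub>b (h a\<^sub>b s) (b \<otimes> 1)\<close>.\<close>

lemma pure_lincomb_in_span:
  assumes "finite A" "A \<subseteq> B"
  shows "pure (lincomb a A) s \<in> can_span"
  using assms
proof (induction A rule: finite_induct)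
  interpret Q: Module.module "class_ring :: 's ring" Q by (rule module_Q)
  interpret sp: LinearCombinations.submodule "class_ring :: 's ring" can_span Q by (rule submodule_can_span)
  {
    case empty
    have z: "\<zero> \<in> carrier M" by simp
    have "pure \<zero> s = 0 \<odot>\<^bsub>Q\<^esub> pure \<zero> s"
      using pure_smult[OF z, of 0 s] smult_pure[OF z, of 0 s] lmult_0[OF z] h_add[of 0 0] by simp
    also have "\<dots> = \<zero>\<^bsub>Q\<^esub>" using Q.lmult_0[OF pure_closed[OF z]] by simp
    finally show ?case using sp.zero_closed by (simp add: lincomb_def)
  next
    case (insert b A)
    have b: "b \<in> carrier M" and A: "A \<subseteq> carrier M" using insert.prems B_carrier by auto
    have ab: "a b \<odot> b \<in> carrier M" using smult_closed[of "a b" b] b by simp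
    have "lincomb a (insert b A) = a b \<odot> b \<oplus> lincomb a A"
      using lincomb_insert[of A a b] insert b A by simp
    then have "pure (lincomb a (insert b A)) s = pure (a b \<odot> b) s \<oplus>\<^bsub>Q\<^esub> pure (lincomb a A) s"
      using pure_add[OF ab] lincomb_closed[OF A, of a] by simp
    also have "pure (a b \<odot> b) s = (h (a b) * s) \<odot>\<^bsub>Q\<^esub> can b"
      using pure_smult[OF b] smult_pure[OF b] by (simp add: can_pure)
    finally have eq: "pure (lincomb a (insert b A)) s = (h (a b) * s) \<odot>\<^bsub>Q\<^esub> can b \<oplus>\<^bsub>Q\<^esub> pure (lincomb a A) s" .
    have "can b \<in> can_span"
      using Q.in_own_span[OF can_closed] insert.prems by auto
    then show ?case
      unfolding eq using insert by (intro sp.m_closed sp.smult_closed) auto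
  }
qed

lemma can_span_all: "can_span = carrier Q"
proof
  interpret Q: Module.module "class_ring :: 's ring" Q by (rule module_Q)
  interpret sp: LinearCombinations.submodule "class_ring :: 's ring" can_span Q by (rule submodule_can_span)
  show "can_span \<subseteq> carrier Q" by (rule sp.subset)
  have coset: "p \<in> carrier F \<and> I +>\<^bsub>F\<^esub> p \<in> can_span" if "keys p \<subseteq> carrier M \<times> UNIV" for p
    using that
  proof (induction p rule: frag_induction)
    case zero
    then show ?case using sp.zero_closed sq.zero_coset by (simp add: Q_quotient)
  next
    case (one x)
    then obtain m s where x: "x = (m, s)" "m \<in> carrier M" by auto
    have "pure (lincomb (coord m) B) s \<in> can_span"
      by (rule pure_lincomb_in_span[OF finite_B order_refl])
    then show ?case
      unfolding x lincomb_coord[OF x(2)] pure_tensor_def using single_F[OF x(2)] by blast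
  next
    case (diff p q)
    \<comment> \<open>The span is closed under scalars, so the difference is formed with the scalar \<open>-1\<close>.\<close>
    let ?p = "I +>\<^bsub>F\<^esub> p" and ?q = "I +>\<^bsub>F\<^esub> q"
    have pq: "p - q \<in> carrier F" using diff keys_diff[of p q] by auto
    have "?p \<in> can_span" "?q \<in> can_span" using diff by auto
    then have "?p \<oplus>\<^bsub>Q\<^esub> (-1) \<odot>\<^bsub>Q\<^esub> ?q \<in> can_span"
      by (intro sp.m_closed sp.smult_closed) auto
    moreover have "I +>\<^bsub>F\<^esub> (p - q) = ?p \<oplus>\<^bsub>Q\<^esub> (-1) \<odot>\<^bsub>Q\<^esub> ?q"
    proof -
      have cl: "I +>\<^bsub>F\<^esub> (p - q) \<in> carrier Q" "?p \<in> carrier Q" "?q \<in> carrier Q" "(-1) \<odot>\<^bsub>Q\<^esub> ?q \<in> carrier Q"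
        using sq.coset_closed diff pq Q.smult_closed[of "-1" ?q] by (auto simp: Q_quotient)
      have "?p = (I +>\<^bsub>F\<^esub> (p - q)) \<oplus>\<^bsub>Q\<^esub> ?q"
        using sq.add_coset[OF pq, of q] diff by (simp add: Q_quotient)
      moreover have "?q \<oplus>\<^bsub>Q\<^esub> (-1) \<odot>\<^bsub>Q\<^esub> ?q = \<zero>\<^bsub>Q\<^esub>"
        using Q.smult_l_distr[of 1 "-1" ?q] Q.smult_one[OF cl(3)] Q.lmult_0[OF cl(3)] cl by simp
      ultimately show ?thesis using cl by (simp add: Q.M.a_assoc)
    qed
    ultimately show ?case using pq by simp
  qed
  show "carrier Q \<subseteq> can_span"
    using coset by (auto simp: Q_quotient sq.carrier_quotient)
qed

text \<open>The functional \<open>m \<otimes> s \<mapsto> h (coord m b) s\<close> on the free group of pairs.\<close>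

definition tensor_coord :: "'m \<Rightarrow> ('m \<times> 's \<Rightarrow>\<^sub>0 int) \<Rightarrow> 's" where
  "tensor_coord b p = (\<Sum>x\<in>keys p. of_int (lookup p x) * (h (coord (fst x) b) * snd x))"

lemma tensor_coord_add: "tensor_coord b (p + q) = tensor_coord b p + tensor_coord b q"
  unfolding tensor_coord_def by (rule setsum_keys_plus_distrib) (simp_all add: distrib_right)

lemma tensor_coord_zero: "tensor_coord b 0 = 0"
  by (simp add: tensor_coord_def)

lemma tensor_coord_uminus: "tensor_coord b (- p) = - tensor_coord b p"
  using tensor_coord_add[of b p "- p"] by (simp add: tensor_coord_zero eq_neg_iff_add_eq_0 add.commute)

lemma tensor_coord_diff: "tensor_coord b (p - q) = tensor_coord b p - tensor_coord b q"
  using tensor_coord_add[of b p "- q"] by (simp add: tensor_coord_uminus)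

lemma tensor_coord_single: "tensor_coord b (frag_of (m, s)) = h (coord m b) * s"
  by (simp add: tensor_coord_def)

lemma tensor_coord_I:
  assumes b: "b \<in> B" and "p \<in> I" shows "tensor_coord b p = 0"
proof -
  have "I \<subseteq> {p \<in> carrier F. tensor_coord b p = 0}"
  proof (rule I_least)
    show "subgroup {p \<in> carrier F. tensor_coord b p = 0} (add_monoid F)"
    proof (rule subgroup_F)
      show "p + q \<in> {p \<in> carrier F. tensor_coord b p = 0}"
        if "p \<in> {p \<in> carrier F. tensor_coord b p = 0}" "q \<in> {p \<in> carrier F. tensor_coord b p = 0}" for p q
        using that keys_add[of p q] by (auto simp: tensor_coord_add)
    qed (auto simp: tensor_coord_zero tensor_coord_uminus)
    show "relators \<subseteq> {p \<in> carrier F. tensor_coord b p = 0}"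
    proof
      fix p assume p: "p \<in> relators"
      from p have "tensor_coord b p = 0"
        by cases (use b in \<open>simp_all add: tensor_coord_diff tensor_coord_add tensor_coord_single coord_add coord_smult h_add h_mult
            distrib_left distrib_right mult.assoc mult.left_commute\<close>)
      then show "p \<in> {p \<in> carrier F. tensor_coord b p = 0}" using p relators_carrier by auto
    qed
  qed
  then show ?thesis using assms(2) by auto
qed

lemma tensor_coord_smult:
  assumes "p \<in> carrier F" shows "tensor_coord b (c \<cdot> p) = c * tensor_coord b p"
proof -
  show ?thesis
    by (induction p rule: frag_induction[OF subset_UNIV])
      (auto simp: F_smult_diff F_smult_single F_smult_zero tensor_coord_diff tensor_coord_single tensor_coord_zero algebra_simps)
qed

definition ext_coord :: "'m \<Rightarrow> ('m \<times> 's \<Rightarrow>\<^sub>0 int) set \<Rightarrow> 's" where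
  "ext_coord b X = tensor_coord b (SOME p. p \<in> X)"

lemma ext_coord_coset:
  assumes b: "b \<in> B" and p: "p \<in> carrier F" shows "ext_coord b (I +>\<^bsub>F\<^esub> p) = tensor_coord b p"
proof -
  define q where "q = (SOME q. q \<in> I +>\<^bsub>F\<^esub> p)"
  have "q \<in> I +>\<^bsub>F\<^esub> p" unfolding q_def by (rule someI[of _ p]) (rule I.a_rcos_self[OF p])
  then obtain i where "i \<in> I" "q = i + p" by (auto simp: a_r_coset_def r_coset_def)
  then have "tensor_coord b q = tensor_coord b p" using tensor_coord_I[OF b] by (simp add: tensor_coord_add)
  then show ?thesis by (simp add: ext_coord_def q_def)
qed

lemma linear_functional_ext_coord:
  assumes b: "b \<in> B" shows "linear_functional Q (ext_coord b)"
  unfolding linear_functional_def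
proof (intro conjI ballI allI)
  fix X assume "X \<in> carrier Q"
  then obtain p where p: "p \<in> carrier F" "X = I +>\<^bsub>F\<^esub> p" by (auto simp: Q_quotient sq.carrier_quotient)
  show "ext_coord b (c \<odot>\<^bsub>Q\<^esub> X) = c * ext_coord b X" for c
    unfolding p(2) Q_quotient using sq.smult_coset[of c p] p(1) F_smult_closed[OF p(1), of c]
    by (simp add: ext_coord_coset[OF b] tensor_coord_smult del: F_simps)
  fix Y assume "Y \<in> carrier Q"
  then obtain q where q: "q \<in> carrier F" "Y = I +>\<^bsub>F\<^esub> q" by (auto simp: Q_quotient sq.carrier_quotient)
  have "p \<oplus>\<^bsub>F\<^esub> q \<in> carrier F" by (rule I.add.m_closed[simplified monoid_record_simps]; fact)
  then show "ext_coord b (X \<oplus>\<^bsub>Q\<^esub> Y) = ext_coord b X + ext_coord b Y"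
    unfolding p(2) q(2) Q_quotient sq.add_coset[OF p(1) q(1)]
    using p q by (simp add: ext_coord_coset[OF b] tensor_coord_add del: F_simps(1))
qed

lemma ext_coord_can: "b \<in> B \<Longrightarrow> c \<in> B \<Longrightarrow> ext_coord b (can c) = (if b = c then 1 else 0)"
  using h_add[of 0 0] B_carrier
  by (auto simp: can_pure pure_tensor_def ext_coord_coset single_F tensor_coord_single coord_basis h_one simp del: F_simps)

lemma inj_on_can: "inj_on can B"
proof (rule inj_onI)
  fix b c assume "b \<in> B" "c \<in> B" "can b = can c"
  then show "b = c" using ext_coord_can[of b b] ext_coord_can[of b c] by (auto split: if_splits)
qed

text \<open>The functionals \<open>ext_coord b\<close> form a dual family of the images of the basis elements.\<close>

theorem module_basis_extension: "module_basis (class_ring :: 's ring) Q (can ` B)"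
proof -
  interpret Q: Module.module "class_ring :: 's ring" Q by (rule module_Q)
  have "\<not> Q.lin_dep (can ` B)"
  proof (rule Q.finite_lin_indpt2[OF finite_imageI[OF finite_B] can_closed])
    fix a assume z: "Q.lincomb a (can ` B) = \<zero>\<^bsub>Q\<^esub>"
    show "\<forall>v\<in>can ` B. a v = \<zero>\<^bsub>class_ring\<^esub>"
    proof safe
      fix b assume b: "b \<in> B"
      note lf = linear_functional_ext_coord[OF b]
      have "ext_coord b (Q.lincomb a (can ` B)) = (\<Sum>v\<in>can ` B. a v * ext_coord b v)"
        by (rule lincomb_functional[OF module_Q lf]) (use finite_B can_closed in auto)
      also have "\<dots> = (\<Sum>c\<in>B. a (can c) * (if b = c then 1 else 0))"
        unfolding sum.reindex[OF inj_on_can] by (rule sum.cong) (use b in \<open>simp_all add: ext_coord_can\<close>)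
      also have "\<dots> = a (can b)" using b finite_B by (simp add: if_distrib cong: if_cong)
      finally have "a (can b) = ext_coord b \<zero>\<^bsub>Q\<^esub>" using z by simp
      also have "\<dots> = 0"
        using lincomb_functional[OF module_Q lf, of "{}"] by (simp add: Q.lincomb_def)
      finally show "a (can b) = \<zero>\<^bsub>class_ring\<^esub>" by simp
    qed
  qed
  then show ?thesis
    unfolding module_basis_def using module_Q can_closed can_span_all by blast
qed

end

section \<open>Laurent polynomials\<close>

lemma additive_zero:
  fixes \<phi> :: "'a::comm_monoid_add \<Rightarrow> 'b::cancel_comm_monoid_add"
  assumes "\<And>a b. \<phi> (a + b) = \<phi> a + \<phi> b" shows "\<phi> 0 = 0"
  using assms[of 0 0] by (metis add.right_neutral add_left_cancel)

lemma laurent_eval_add: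
  assumes "\<And>a b. \<phi> (a + b) = \<phi> a + \<phi> b"
  shows "laurent_eval \<phi> x (f + g) = laurent_eval \<phi> x f + laurent_eval \<phi> x g"
  unfolding laurent_eval_def
  by (rule setsum_keys_plus_distrib) (simp_all add: assms additive_zero[of \<phi>] distrib_right)

lemma laurent_eval_single:
  assumes "\<phi> 0 = 0" shows "laurent_eval \<phi> x (single k a) = \<phi> a * x powi k"
  unfolding laurent_eval_def using assms by simp

lemma laurent_eval_mult:
  assumes \<phi>: "\<And>a b. \<phi> (a + b) = \<phi> a + \<phi> b" "\<And>a b. \<phi> (a * b) = \<phi> a * \<phi> b" and x: "x \<noteq> 0"
  shows "laurent_eval \<phi> x (f * g) = laurent_eval \<phi> x f * laurent_eval \<phi> x g"
proof -
  have \<phi>0: "\<phi> 0 = 0" using \<phi>(1) by (rule additive_zero)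
  have e0: "laurent_eval \<phi> x 0 = 0" by (simp add: laurent_eval_def)
  note simps = laurent_eval_add[of \<phi>, OF \<phi>(1)] laurent_eval_single[of \<phi>, OF \<phi>0] e0
  show ?thesis
  proof (rule additive_eqI[where p = f and C = UNIV and F = "\<lambda>f. laurent_eval \<phi> x (f * g)" and
        F' = "\<lambda>f. laurent_eval \<phi> x f * laurent_eval \<phi> x g"])
    fix k a
    show "laurent_eval \<phi> x (single k a * g) =
        laurent_eval \<phi> x (single k a) * laurent_eval \<phi> x g"
      by (rule additive_eqI[where p = g and C = UNIV and
          F = "\<lambda>g. laurent_eval \<phi> x (single k a * g)" and
          F' = "\<lambda>g. laurent_eval \<phi> x (single k a) * laurent_eval \<phi> x g"])
        (simp_all add: simps distrib_left mult_single \<phi> power_int_add[of x] x)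
  qed (simp_all add: simps distrib_right)
qed

lemma laurent_eval_one:
  assumes "\<phi> 0 = 0" "\<phi> 1 = 1" shows "laurent_eval \<phi> x 1 = 1"
  using laurent_eval_single[of \<phi> x 0 1] assms by simp

lemma laurent_to_ratfun_hom:
  "laurent_to_ratfun (f + g) = laurent_to_ratfun f + laurent_to_ratfun g"
  "laurent_to_ratfun (f * g) = laurent_to_ratfun f * laurent_to_ratfun g"
  "laurent_to_ratfun 1 = 1"
proof -
  have add: "to_fract [:a + b:] = to_fract [:a:] + to_fract [:b:]" for a b :: complex
    using to_fract_add[of "[:a:]" "[:b:]"] by simp
  have mult: "to_fract [:a * b:] = to_fract [:a:] * to_fract [:b:]" for a b :: complex
    using to_fract_mult[of "[:a:]" "[:b:]"] by (simp add: mult.commute)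
  show "laurent_to_ratfun (f + g) = laurent_to_ratfun f + laurent_to_ratfun g"
    unfolding laurent_to_ratfun_def by (rule laurent_eval_add[OF add])
  show "laurent_to_ratfun (f * g) = laurent_to_ratfun f * laurent_to_ratfun g"
    unfolding laurent_to_ratfun_def by (rule laurent_eval_mult[OF add mult]) simp
  show "laurent_to_ratfun 1 = 1"
    unfolding laurent_to_ratfun_def by (rule laurent_eval_one) (simp_all flip: one_pCons)
qed

lemma laurent_at_1_hom:
  "laurent_at_1 (f + g) = laurent_at_1 f + laurent_at_1 g"
  "laurent_at_1 (f * g) = laurent_at_1 f * laurent_at_1 g"
  "laurent_at_1 1 = 1"
  unfolding laurent_at_1_def
  by (simp_all add: laurent_eval_add laurent_eval_mult laurent_eval_one)

section \<open>Representations\<close>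

text \<open>The action attached to a colouring \<open>c\<close>, on functions of arrangements \<open>w\<close>, where \<open>w i\<close> is the strand
  in position \<open>i\<close>.  Arrangements that repeat a strand are allowed; the eigenvalue \<open>u\<close> for two equal
  strands makes the relations hold for all \<open>w\<close> without a case distinction in the statements.\<close>

fun rep_gen :: "'r::comm_ring_1 \<Rightarrow> (nat \<Rightarrow> nat) \<Rightarrow> bt_gen \<Rightarrow> ((nat \<Rightarrow> nat) \<Rightarrow> 'r) \<Rightarrow> (nat \<Rightarrow> nat) \<Rightarrow> 'r" where
  "rep_gen u c (E i) f w = (if c (w i) = c (w (Suc i)) then f w else 0)"
| "rep_gen u c (T i) f w =
    (if c (w i) \<noteq> c (w (Suc i)) \<or> w i < w (Suc i) then f (w \<circ> adj i)
     else if w i = w (Suc i) then u * f w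
     else u * f (w \<circ> adj i) + (u - 1) * f w)"

text \<open>The operator by which the tie between positions \<open>a\<close> and \<open>b\<close> acts.\<close>

definition diag :: "(nat \<Rightarrow> nat) \<Rightarrow> nat \<Rightarrow> nat \<Rightarrow> ((nat \<Rightarrow> nat) \<Rightarrow> 'r::comm_ring_1) \<Rightarrow> (nat \<Rightarrow> nat) \<Rightarrow> 'r" where
  "diag c a b f w = (if c (w a) = c (w b) then f w else 0)"

lemma rep_gen_E: "rep_gen u c (E i) = diag c i (Suc i)"
  by (simp add: fun_eq_iff diag_def)

lemma adj_simps [simp]:
  "adj i i = Suc i" "adj i (Suc i) = i" "adj (Suc i) i = i" "adj i (Suc (Suc i)) = Suc (Suc i)"
  by (simp_all add: Transposition.transpose_def)

text \<open>The counterpart of \<open>t_link\<close>.  The second term of \<open>T\<close> occurs only if the strands in positions \<open>k\<close> and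
  \<open>k + 1\<close> have equal colours, and then the colours of all positions are invariant under \<open>s\<^sub>k\<close>.\<close>

lemma rep_T_diag:
  "rep_gen u c (T k) (diag c a b f) = diag c (adj k a) (adj k b) (rep_gen u c (T k) f)"
proof
  fix w
  have "c ((w \<circ> adj k) x) = c (w x)" if "c (w k) = c (w (Suc k))" for x
    using that by (auto simp: Transposition.transpose_def)
  then show "rep_gen u c (T k) (diag c a b f) w = diag c (adj k a) (adj k b) (rep_gen u c (T k) f) w"
    by (auto simp: diag_def)
qed

lemma rep_quadratic:
  "rep_gen u c (T i) (rep_gen u c (T i) f) w =
    f w + (u - 1) * (rep_gen u c (E i) (\<lambda>w. f w + rep_gen u c (T i) f w) w)"
  by (auto simp: adj_adj algebra_simps)

lemma rep_T_far:
  assumes "1 < \<bar>int i - int j\<bar>"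
  shows "rep_gen u c (T i) (rep_gen u c (T j) f) w = rep_gen u c (T j) (rep_gen u c (T i) f) w"
proof -
  have eq: "w \<circ> adj i \<circ> adj j = w \<circ> adj j \<circ> adj i"
    using adj_far_comm[OF assms] by (metis comp_assoc)
  have fixed: "adj i j = j" "adj i (Suc j) = Suc j" "adj j i = i" "adj j (Suc i) = Suc i"
    using assms by (auto simp: Transposition.transpose_def)
  show ?thesis by (auto simp: fixed eq algebra_simps)
qed

lemma rep_T_braid:
  "rep_gen u c (T i) (rep_gen u c (T (Suc i)) (rep_gen u c (T i) f)) w =
    rep_gen u c (T (Suc i)) (rep_gen u c (T i) (rep_gen u c (T (Suc i)) f)) w"
proof -
  have eq: "w \<circ> adj i \<circ> adj (Suc i) \<circ> adj i = w \<circ> adj (Suc i) \<circ> adj i \<circ> adj (Suc i)"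
    using adj_braid[of i] by (metis comp_assoc)
  define p q r where "p = w i" and "q = w (Suc i)" and "r = w (Suc (Suc i))"
  note val = p_def[symmetric] q_def[symmetric] r_def[symmetric]
  consider "p < q" | "p = q" | "q < p" by linarith
  then show ?thesis
    by cases (auto simp: eq adj_adj val algebra_simps)
qed

definition rep_word :: "'r::comm_ring_1 \<Rightarrow> (nat \<Rightarrow> nat) \<Rightarrow> bt_gen list \<Rightarrow> ((nat \<Rightarrow> nat) \<Rightarrow> 'r) \<Rightarrow> (nat \<Rightarrow> nat) \<Rightarrow> 'r" where
  "rep_word u c gs f = foldr (rep_gen u c) gs f"

lemma rep_gen_add: "rep_gen u c g (\<lambda>w. f w + f' w) = (\<lambda>w. rep_gen u c g f w + rep_gen u c g f' w)"
  by (cases g) (auto simp: fun_eq_iff algebra_simps)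

lemma rep_gen_scale: "rep_gen u c g (\<lambda>w. a * f w) = (\<lambda>w. a * rep_gen u c g f w)"
  by (cases g) (auto simp: fun_eq_iff algebra_simps)

lemma rep_word_add: "rep_word u c gs (\<lambda>w. f w + f' w) = (\<lambda>w. rep_word u c gs f w + rep_word u c gs f' w)"
  unfolding rep_word_def by (induction gs) (auto simp: rep_gen_add)

lemma rep_word_scale: "rep_word u c gs (\<lambda>w. a * f w) = (\<lambda>w. a * rep_word u c gs f w)"
  unfolding rep_word_def by (induction gs) (auto simp: rep_gen_scale)

lemma rep_word_append: "rep_word u c (gs @ hs) f = rep_word u c gs (rep_word u c hs f)"
  by (simp add: rep_word_def)

definition rep :: "'r::comm_ring_1 \<Rightarrow> (nat \<Rightarrow> nat) \<Rightarrow> (bt_gen list \<Rightarrow>\<^sub>0 'r) \<Rightarrow> ((nat \<Rightarrow> nat) \<Rightarrow> 'r) \<Rightarrow> (nat \<Rightarrow> nat) \<Rightarrow> 'r" where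
  "rep u c p f w = (\<Sum>gs\<in>keys p. lookup p gs * rep_word u c gs f w)"

lemma rep_add: "rep u c (p + q) f w = rep u c p f w + rep u c q f w"
  unfolding rep_def by (rule setsum_keys_plus_distrib) (simp_all add: distrib_right)

lemma rep_zero: "rep u c 0 f w = 0"
  by (simp add: rep_def)

lemma rep_uminus: "rep u c (- p) f w = - rep u c p f w"
  using rep_add[of u c p "- p" f w] by (simp add: rep_zero eq_neg_iff_add_eq_0 add.commute)

lemma rep_single: "rep u c (single gs a) f w = a * rep_word u c gs f w"
  by (simp add: rep_def)

lemma rep_arg_add: "rep u c p (\<lambda>w. f w + f' w) w = rep u c p f w + rep u c p f' w"
  by (simp add: rep_def rep_word_add distrib_left sum.distrib)

lemma rep_arg_zero: "rep u c p (\<lambda>w. 0) w = 0"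
  using rep_arg_add[of u c p "\<lambda>w. 0" "\<lambda>w. 0" w] by simp

lemma rep_scale: "rep u c (Poly_Mapping.map ((*) a) p) f w = a * rep u c p f w"
  by (rule additive_eqI[where p = p and C = UNIV and F = "\<lambda>p. rep u c (Poly_Mapping.map ((*) a) p) f w" and
        F' = "\<lambda>p. a * rep u c p f w"])
    (simp_all add: map_times_add map_times_single rep_add rep_zero rep_single distrib_left mult.assoc)

lemma rep_conv: "rep u c (conv (@) p q) f w = rep u c p (rep u c q f) w"
proof (rule additive_eqI[where p = p and C = UNIV and F = "\<lambda>p. rep u c (conv (@) p q) f w" and
      F' = "\<lambda>p. rep u c p (rep u c q f) w"])
  fix gs a
  show "rep u c (conv (@) (single gs a) q) f w = rep u c (single gs a) (rep u c q f) w"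
  proof (rule additive_eqI[where p = q and C = UNIV and
      F = "\<lambda>q. rep u c (conv (@) (single gs a) q) f w" and
      F' = "\<lambda>q. rep u c (single gs a) (rep u c q f) w"])
    fix hs b
    have "rep u c (single hs b) f = (\<lambda>w. b * rep_word u c hs f w)"
      by (simp add: fun_eq_iff rep_single)
    then show "rep u c (conv (@) (single gs a) (single hs b)) f w =
        rep u c (single gs a) (rep u c (single hs b) f) w"
      by (simp add: conv_single_single rep_single rep_word_append rep_word_scale mult.assoc)
  next
    have "rep u c 0 f = (\<lambda>w. 0)" by (simp add: fun_eq_iff rep_zero)
    then show "rep u c (single gs a) (rep u c 0 f) w = 0"
      by (simp add: rep_arg_zero)
    fix p q
    have "rep u c (p + q) f = (\<lambda>w. rep u c p f w + rep u c q f w)" by (simp add: fun_eq_iff rep_add)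
    then show "rep u c (single gs a) (rep u c (p + q) f) w =
        rep u c (single gs a) (rep u c p f) w + rep u c (single gs a) (rep u c q f) w"
      by (simp add: rep_arg_add)
  qed (simp_all add: conv_add_right rep_zero rep_add)
qed (simp_all add: conv_add_left rep_add rep_zero)

lemma rep_bt_word: "rep u c (single gs 1) f w = rep_word u c gs f w"
  by (simp add: rep_single)

lemma nat_dist_one_cases: "\<bar>int i - int j\<bar> = 1 \<Longrightarrow> (j = Suc i \<Longrightarrow> P) \<Longrightarrow> (i = Suc j \<Longrightarrow> P) \<Longrightarrow> P"
  by linarith

lemma diag_commute: "diag c a b (diag c a' b' f) = diag c a' b' (diag c a b f)"
  by (auto simp: diag_def fun_eq_iff)

lemma diag_sym: "diag c a b = diag c b a"
  by (auto simp: diag_def fun_eq_iff)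

lemma diag_idem: "diag c a b (diag c a b f) = diag c a b f"
  by (auto simp: diag_def fun_eq_iff)

lemma rep_word_Cons: "rep_word u c (g # gs) f = rep_gen u c g (rep_word u c gs f)"
  by (simp add: rep_word_def)

lemma rep_word_Nil: "rep_word u c [] f = f"
  by (simp add: rep_word_def)

text \<open>The relations that involve some \<open>E\<^sub>i\<close>, apart from the quadratic one, follow from \<open>rep_T_diag\<close>, because
  diagonal operators compose by intersecting their conditions.\<close>

lemma rep_relations:
  assumes "(p, q) \<in> bt_relations n"
  shows "rep laurent_u c p f w = rep laurent_u c q f w"
proof -
  note simps = rep_bt_word rep_word_Cons rep_word_Nil rep_gen_E rep_T_diag
  from assms show ?thesis
  proof cases
    case (E1 i j)
    then show ?thesis using rep_T_far[of i j] by (simp add: simps del: rep_gen.simps)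
  next
    case (E2 i j)
    then show ?thesis by (simp add: simps diag_commute del: rep_gen.simps)
  next
    case (E3 i j)
    then have "adj j i = i" "adj j (Suc i) = Suc i"
      by (auto simp: Transposition.transpose_def)
    then show ?thesis using E3 by (simp add: simps del: rep_gen.simps)
  next
    case (E4 i)
    then show ?thesis by (simp add: simps diag_idem del: rep_gen.simps)
  next
    case (E5 i)
    then show ?thesis by (simp add: simps diag_sym[of c "Suc i" i] del: rep_gen.simps)
  next
    case (E6 i j)
    show ?thesis
      using E6(5)
    proof (rule nat_dist_one_cases)
      assume "j = Suc i"
      then show ?thesis using E6 rep_T_braid[of laurent_u c i f w] by (simp add: simps del: rep_gen.simps)
    next
      assume "i = Suc j"
      then show ?thesis using E6 rep_T_braid[of laurent_u c j f w] by (simp add: simps del: rep_gen.simps)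
    qed
  next
    case (E7 i j)
    show ?thesis
      using E7(5)
      by (rule nat_dist_one_cases)
        (use E7 in \<open>simp_all add: simps diag_sym[of c "Suc (Suc _)" "Suc _"] diag_sym[of c "Suc i" i] diag_sym[of c "Suc j" j] del: rep_gen.simps\<close>)
  next
    case (E8_left i j)
    show ?thesis
      using E8_left(5)
      by (rule nat_dist_one_cases)
        (use E8_left in \<open>auto simp: simps diag_def del: rep_gen.simps\<close>)
  next
    case (E8_right i j)
    show ?thesis
      using E8_right(5)
      by (rule nat_dist_one_cases)
        (use E8_right in \<open>auto simp: simps diag_def del: rep_gen.simps\<close>)
  next
    case (E9 i)
    have add: "rep laurent_u c (bt_word [] + bt_word [T i]) f = (\<lambda>w. f w + rep_gen laurent_u c (T i) f w)"
      by (simp add: fun_eq_iff rep_add simps del: rep_gen.simps)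
    show ?thesis
      unfolding E9 free_algebra_simps rep_add rep_scale rep_conv add
      using rep_quadratic[of laurent_u c i f w] by (simp add: simps del: rep_gen.simps)
  qed
qed

section \<open>The algebra of braids and ties\<close>

definition laurent_u_inv :: laurent where "laurent_u_inv = single (- 1) 1"

lemma laurent_u_mult_inv: "laurent_u * laurent_u_inv = 1"
  by (simp add: laurent_u_def laurent_u_inv_def mult_single)

context fixes n :: nat
begin

abbreviation (input) "FA \<equiv> bt_free n"
abbreviation (input) "BA \<equiv> bt_algebra n"

interpretation FA: unital_algebra class_ring FA by (rule unital_algebra_free_algebra)

lemma bt_word_closed: "set ws \<subseteq> bt_gens n \<Longrightarrow> bt_word ws \<in> carrier FA"
  by auto

lemma gens: "i \<in> {1..<n} \<Longrightarrow> T i \<in> bt_gens n" "i \<in> {1..<n} \<Longrightarrow> E i \<in> bt_gens n"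
  by (auto simp: bt_gens_def)

lemma bt_relations_closed:
  assumes "(p, q) \<in> bt_relations n" shows "p \<in> carrier FA" "q \<in> carrier FA"
proof -
  have "p \<in> carrier FA \<and> q \<in> carrier FA"
    using assms
  proof cases
    case (E9 i)
    have c: "bt_word [T i, T i] \<in> carrier FA" "bt_word [E i] \<in> carrier FA" "bt_word [T i] \<in> carrier FA"
      using E9 gens by (auto intro!: bt_word_closed simp del: free_algebra_simps)
    then show ?thesis unfolding E9
      by (intro conjI FA.M.a_closed FA.M.add.m_closed FA.smult_closed FA.m_closed FA.one_closed) (auto simp del: free_algebra_simps)
  qed (use gens in \<open>auto intro!: bt_word_closed simp del: free_algebra_simps\<close>)
  then show "p \<in> carrier FA" "q \<in> carrier FA" by auto
qed

lemma ideal_bt: "ideal (bt_ideal n) FA"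
  unfolding bt_ideal_def
  by (rule FA.genideal_ideal) (use bt_relations_closed in \<open>auto simp del: free_algebra_simps\<close>)

interpretation sq: scalar_quotient "bt_ideal n" FA class_ring
  by (rule scalar_quotient_algebra[OF FA.unital_algebra_axioms ideal_bt])

interpretation BA: unital_algebra class_ring BA
  unfolding bt_algebra_def by (rule unital_algebra_quotient[OF FA.unital_algebra_axioms ideal_bt])

abbreviation cl :: "(bt_gen list \<Rightarrow>\<^sub>0 laurent) \<Rightarrow> (bt_gen list \<Rightarrow>\<^sub>0 laurent) set" where
  "cl p \<equiv> bt_ideal n +>\<^bsub>FA\<^esub> p"

lemma cl_relation: "(p, q) \<in> bt_relations n \<Longrightarrow> cl p = cl q"
proof -
  assume pq: "(p, q) \<in> bt_relations n"
  have "{p \<ominus>\<^bsub>FA\<^esub> q | p q. (p, q) \<in> bt_relations n} \<subseteq> bt_ideal n"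
    unfolding bt_ideal_def
    by (rule FA.genideal_self) (use bt_relations_closed in \<open>auto simp del: free_algebra_simps\<close>)
  then have "p \<ominus>\<^bsub>FA\<^esub> q \<in> bt_ideal n" using pq by blast
  then show ?thesis using sq.coset_eq_iff bt_relations_closed[OF pq] by blast
qed

lemma cl_closed: "p \<in> carrier FA \<Longrightarrow> cl p \<in> carrier BA"
  unfolding bt_algebra_def by (rule sq.coset_closed)

lemma carrier_BA: "carrier BA = cl ` carrier FA"
  unfolding bt_algebra_def by (rule sq.carrier_quotient)

lemma cl_add: "p \<in> carrier FA \<Longrightarrow> q \<in> carrier FA \<Longrightarrow> cl p \<oplus>\<^bsub>BA\<^esub> cl q = cl (p \<oplus>\<^bsub>FA\<^esub> q)"
  unfolding bt_algebra_def by (rule sq.add_coset)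

lemma cl_mult: "p \<in> carrier FA \<Longrightarrow> q \<in> carrier FA \<Longrightarrow> cl p \<otimes>\<^bsub>BA\<^esub> cl q = cl (p \<otimes>\<^bsub>FA\<^esub> q)"
  unfolding bt_algebra_def by (rule quotient_mult_coset[OF ideal_bt])

lemma cl_one: "\<one>\<^bsub>BA\<^esub> = cl \<one>\<^bsub>FA\<^esub>"
  unfolding bt_algebra_def by (rule quotient_one_coset)

lemma cl_smult: "p \<in> carrier FA \<Longrightarrow> a \<odot>\<^bsub>BA\<^esub> cl p = cl (a \<odot>\<^bsub>FA\<^esub> p)"
  unfolding bt_algebra_def by (rule sq.smult_coset) auto

definition bt_gen_class :: "bt_gen \<Rightarrow> (bt_gen list \<Rightarrow>\<^sub>0 laurent) set" where
  "bt_gen_class g = cl (bt_word [g])"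

lemma bt_gen_class_simps: "bt_gen_class (T i) = bt_T n i" "bt_gen_class (E i) = bt_E n i"
  by (simp_all add: bt_gen_class_def bt_T_def bt_E_def)

lemma cl_word: "set gs \<subseteq> bt_gens n \<Longrightarrow> cl (bt_word gs) = list_prod BA (map bt_gen_class gs)"
proof (induction gs)
  case Nil
  show ?case using cl_one by (simp add: list_prod_def)
next
  case (Cons g gs)
  have c: "bt_word [g] \<in> carrier FA" "bt_word gs \<in> carrier FA"
    using Cons.prems by (auto intro!: bt_word_closed simp del: free_algebra_simps)
  have "bt_word (g # gs) = bt_word [g] \<otimes>\<^bsub>FA\<^esub> bt_word gs"
    by (simp add: conv_single_single)
  then show ?case
    using cl_mult[OF c] Cons by (simp add: bt_gen_class_def del: free_algebra_simps)
qed

lemma bt_T_closed: "i \<in> {1..<n} \<Longrightarrow> bt_T n i \<in> carrier BA"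
  unfolding bt_T_def by (intro cl_closed bt_word_closed) (use gens in auto)

lemma bt_E_closed: "i \<in> {1..<n} \<Longrightarrow> bt_E n i \<in> carrier BA"
  unfolding bt_E_def by (intro cl_closed bt_word_closed) (use gens in auto)

lemma word_relation:
  assumes "(bt_word gs, bt_word hs) \<in> bt_relations n" "set gs \<subseteq> bt_gens n" "set hs \<subseteq> bt_gens n"
  shows "list_prod BA (map bt_gen_class gs) = list_prod BA (map bt_gen_class hs)"
  using cl_relation[OF assms(1)] cl_word assms by simp

lemma bt_quadratic:
  assumes i: "i \<in> {1..<n}"
  shows "bt_T n i \<otimes>\<^bsub>BA\<^esub> bt_T n i =
    \<one>\<^bsub>BA\<^esub> \<oplus>\<^bsub>BA\<^esub> (laurent_u - 1) \<odot>\<^bsub>BA\<^esub> (bt_E n i \<otimes>\<^bsub>BA\<^esub> (\<one>\<^bsub>BA\<^esub> \<oplus>\<^bsub>BA\<^esub> bt_T n i))"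
proof -
  have c: "bt_word [T i] \<in> carrier FA" "bt_word [E i] \<in> carrier FA"
    using i gens by (auto intro!: bt_word_closed simp del: free_algebra_simps)
  have c1: "\<one>\<^bsub>FA\<^esub> \<oplus>\<^bsub>FA\<^esub> bt_word [T i] \<in> carrier FA"
    by (rule FA.M.a_closed[OF FA.one_closed c(1)])
  have c2: "bt_word [E i] \<otimes>\<^bsub>FA\<^esub> (\<one>\<^bsub>FA\<^esub> \<oplus>\<^bsub>FA\<^esub> bt_word [T i]) \<in> carrier FA"
    by (rule FA.m_closed[OF c(2) c1])
  have c3: "(laurent_u - 1) \<odot>\<^bsub>FA\<^esub> (bt_word [E i] \<otimes>\<^bsub>FA\<^esub> (\<one>\<^bsub>FA\<^esub> \<oplus>\<^bsub>FA\<^esub> bt_word [T i])) \<in> carrier FA"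
    by (rule FA.smult_closed[OF _ c2]) simp
  have TT: "bt_word [T i] \<otimes>\<^bsub>FA\<^esub> bt_word [T i] = bt_word [T i, T i]"
    by (simp add: conv_single_single)
  show ?thesis
    unfolding bt_T_def bt_E_def cl_one cl_add[OF FA.one_closed c(1)] cl_mult[OF c(2) c1] cl_smult[OF c2]
      cl_add[OF FA.one_closed c3] cl_mult[OF c(1) c(1)] TT
    by (rule cl_relation[OF bt_relations.E9[OF i]])
qed

text \<open>The relation that the square of \<open>T\<^sub>i\<close> commutes with \<open>E\<^sub>j\<close> for neighbouring \<open>i\<close> and \<open>j\<close> comes down to
  \<open>E\<^sub>i T\<^sub>i E\<^sub>j = T\<^sub>i E\<^sub>j E\<^sub>i = E\<^sub>j E\<^sub>i T\<^sub>i\<close>.\<close>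

lemma braids_ties_algebra_bt:
  "braids_ties_algebra class_ring BA n (bt_T n) (bt_E n) (laurent_u - 1)"
proof -
  note [simp] = bt_T_closed bt_E_closed
  have rel: "list_prod BA (map bt_gen_class gs) = list_prod BA (map bt_gen_class hs)"
    if "(bt_word gs, bt_word hs) \<in> bt_relations n" "set gs \<subseteq> bt_gens n" "set hs \<subseteq> bt_gens n" for gs hs
    by (rule word_relation[OF that])
  note simps = bt_gen_class_simps gens
  have E2: "bt_E n i \<otimes>\<^bsub>BA\<^esub> bt_E n j = bt_E n j \<otimes>\<^bsub>BA\<^esub> bt_E n i"
    if "i \<in> {1..<n}" "j \<in> {1..<n}" for i j
    using rel[OF bt_relations.E2[OF that]] that by (simp add: simps)
  have E4: "bt_E n i \<otimes>\<^bsub>BA\<^esub> bt_E n i = bt_E n i" if "i \<in> {1..<n}" for i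
    using rel[OF bt_relations.E4[OF that]] that by (simp add: simps)
  have E5: "bt_E n i \<otimes>\<^bsub>BA\<^esub> bt_T n i = bt_T n i \<otimes>\<^bsub>BA\<^esub> bt_E n i" if "i \<in> {1..<n}" for i
    using rel[OF bt_relations.E5[OF that]] that by (simp add: simps)
  have E8l: "bt_E n i \<otimes>\<^bsub>BA\<^esub> (bt_E n j \<otimes>\<^bsub>BA\<^esub> bt_T n j) = bt_E n i \<otimes>\<^bsub>BA\<^esub> (bt_T n j \<otimes>\<^bsub>BA\<^esub> bt_E n i)"
    if "i \<in> {1..<n}" "j \<in> {1..<n}" "\<bar>int i - int j\<bar> = 1" for i j
    using rel[OF bt_relations.E8_left[OF that]] that by (simp add: simps)
  have E8r: "bt_E n i \<otimes>\<^bsub>BA\<^esub> (bt_T n j \<otimes>\<^bsub>BA\<^esub> bt_E n i) = bt_T n j \<otimes>\<^bsub>BA\<^esub> (bt_E n i \<otimes>\<^bsub>BA\<^esub> bt_E n j)"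
    if "i \<in> {1..<n}" "j \<in> {1..<n}" "\<bar>int i - int j\<bar> = 1" for i j
    using rel[OF bt_relations.E8_right[OF that]] that by (simp add: simps)
  have unit: "bt_T n i \<in> Units BA" if i: "i \<in> {1..<n}" for i
    by (rule unit_of_quadratic[OF BA.unital_algebra_axioms bt_T_closed[OF i] bt_E_closed[OF i]
          E4[OF i] E5[OF i] bt_quadratic[OF i] laurent_u_mult_inv])
  have TTE: "bt_T n i \<otimes>\<^bsub>BA\<^esub> (bt_T n i \<otimes>\<^bsub>BA\<^esub> bt_E n j) = bt_E n j \<otimes>\<^bsub>BA\<^esub> (bt_T n i \<otimes>\<^bsub>BA\<^esub> bt_T n i)"
    if ij: "i \<in> {1..<n}" "j \<in> {1..<n}" "\<bar>int i - int j\<bar> = 1" for i j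
  proof (rule square_commutes_of_quadratic[OF BA.unital_algebra_axioms bt_T_closed[OF ij(1)]
        bt_E_closed[OF ij(1)] bt_E_closed[OF ij(2)] bt_quadratic[OF ij(1)] E2[OF ij(1,2)]])
    have ji: "\<bar>int j - int i\<bar> = 1" using ij by simp
    have "bt_E n i \<otimes>\<^bsub>BA\<^esub> (bt_T n i \<otimes>\<^bsub>BA\<^esub> bt_E n j) = bt_T n i \<otimes>\<^bsub>BA\<^esub> (bt_E n i \<otimes>\<^bsub>BA\<^esub> bt_E n j)"
      using ij E5[OF ij(1)] by (simp flip: BA.m_assoc)
    also have "\<dots> = bt_E n j \<otimes>\<^bsub>BA\<^esub> (bt_E n i \<otimes>\<^bsub>BA\<^esub> bt_T n i)"
      unfolding E2[OF ij(1,2)] using E8l[OF ij(2,1) ji] E8r[OF ij(2,1) ji] by simp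
    finally show "bt_E n i \<otimes>\<^bsub>BA\<^esub> (bt_T n i \<otimes>\<^bsub>BA\<^esub> bt_E n j) = bt_E n j \<otimes>\<^bsub>BA\<^esub> (bt_E n i \<otimes>\<^bsub>BA\<^esub> bt_T n i)" .
  qed
  show ?thesis
  proof (intro braids_ties_algebra.intro BA.unital_algebra_axioms braids_ties.intro BA.monoid_axioms
      braids_ties_axioms.intro braids_ties_algebra_axioms.intro bt_quadratic)
    show "laurent_u - 1 \<in> carrier class_ring" by simp
    fix i j assume ij: "i \<in> {1..<n}" "j \<in> {1..<n}"
    {
      assume "\<bar>int i - int j\<bar> > 1"
      note far = rel[OF bt_relations.E1[OF ij this]] rel[OF bt_relations.E3[OF ij this]]
      show "bt_T n i \<otimes>\<^bsub>BA\<^esub> bt_T n j = bt_T n j \<otimes>\<^bsub>BA\<^esub> bt_T n i"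
        "bt_E n i \<otimes>\<^bsub>BA\<^esub> bt_T n j = bt_T n j \<otimes>\<^bsub>BA\<^esub> bt_E n i"
        using far ij by (simp_all add: simps)
    next
      assume near: "\<bar>int i - int j\<bar> = 1"
      show "bt_T n i \<otimes>\<^bsub>BA\<^esub> (bt_T n j \<otimes>\<^bsub>BA\<^esub> bt_T n i) = bt_T n j \<otimes>\<^bsub>BA\<^esub> (bt_T n i \<otimes>\<^bsub>BA\<^esub> bt_T n j)"
        "bt_E n j \<otimes>\<^bsub>BA\<^esub> (bt_T n i \<otimes>\<^bsub>BA\<^esub> bt_T n j) = bt_T n i \<otimes>\<^bsub>BA\<^esub> (bt_T n j \<otimes>\<^bsub>BA\<^esub> bt_E n i)"
        using rel[OF bt_relations.E6[OF ij near]] rel[OF bt_relations.E7[OF ij near]] ij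
        by (simp_all add: simps)
      show "bt_E n i \<otimes>\<^bsub>BA\<^esub> (bt_E n j \<otimes>\<^bsub>BA\<^esub> bt_T n j) = bt_T n j \<otimes>\<^bsub>BA\<^esub> (bt_E n i \<otimes>\<^bsub>BA\<^esub> bt_E n j)"
        using E8l[OF ij near] E8r[OF ij near] by simp
    }
  qed (fact unit bt_E_closed E2 E4 E5 TTE)+
qed

interpretation BA: braids_ties_algebra class_ring BA n "bt_T n" "bt_E n" "laurent_u - 1"
  by (rule braids_ties_algebra_bt)

lemma bt_E_pair_tie: "bt_E_pair n i j = BA.tie i j"
  by (simp add: bt_E_pair_def BA.tie_def)

lemma bt_E_partition_tie: "bt_E_partition n A = BA.tie_partition A"
proof -
  have "bt_E_block n = BA.tie_block"
    by (simp add: fun_eq_iff bt_E_block_def BA.tie_block_def bt_E_pair_tie)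
  then show ?thesis by (simp add: bt_E_partition_def BA.tie_partition_def)
qed

lemma bt_T_perm_braid: "bt_T_perm n w = BA.braid_perm w"
  by (simp add: bt_T_perm_def BA.braid_perm_def)

lemma bt_G_standard: "bt_G n = BA.standard_set"
  by (simp add: bt_G_def BA.standard_set_def bt_E_partition_tie bt_T_perm_braid sym_group_carrier)

lemma bt_span: "LinearCombinations.module.span class_ring BA (bt_G n) = carrier BA"
proof
  interpret sp: LinearCombinations.submodule class_ring BA.standard_span BA by (rule BA.submodule_standard_span)
  show "LinearCombinations.module.span class_ring BA (bt_G n) \<subseteq> carrier BA"
    unfolding bt_G_standard by (rule sp.subset)
  have "p \<in> carrier FA \<and> cl p \<in> BA.standard_span" if "keys p \<subseteq> lists (bt_gens n)" for p
    using that
  proof (induction p rule: poly_mapping_keys_induct)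
    case zero
    have "cl 0 = \<zero>\<^bsub>BA\<^esub>" unfolding bt_algebra_def sq.zero_coset by simp
    then show ?case using sp.zero_closed by simp
  next
    case (add gs a p)
    have gs: "set gs \<subseteq> bt_gens n" using add by auto
    have w: "bt_word gs \<in> carrier FA" by (rule bt_word_closed[OF gs])
    have "list_prod BA (map bt_gen_class gs) \<in> BA.standard_span"
      by (rule BA.generator_words_in_standard_span)
        (use gs in \<open>auto simp: bt_gens_def bt_gen_class_simps\<close>)
    then have "a \<odot>\<^bsub>BA\<^esub> cl (bt_word gs) \<in> BA.standard_span"
      unfolding cl_word[OF gs] by (intro sp.smult_closed) auto
    moreover have aw: "a \<odot>\<^bsub>FA\<^esub> bt_word gs = single gs a"
      by (simp add: map_times_single)
    moreover have sc: "single gs a \<in> carrier FA" using gs by auto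
    ultimately have "cl (single gs a) \<in> BA.standard_span" using cl_smult[OF w, of a] by simp
    moreover have "cl (single gs a + p) = cl (single gs a) \<oplus>\<^bsub>BA\<^esub> cl p"
      using cl_add[OF sc, of p] add by simp
    ultimately show ?case using add keys_single_plus_subset[of gs "lists (bt_gens n)" p a] by auto
  qed
  then show "carrier BA \<subseteq> LinearCombinations.module.span class_ring BA (bt_G n)"
    unfolding bt_G_standard carrier_BA by auto
qed

section \<open>Linear independence\<close>

lemma FA_uminus: "p \<in> carrier FA \<Longrightarrow> \<ominus>\<^bsub>FA\<^esub> p = - p"
  by (rule FA.minus_equality) auto

lemma rep_ideal:
  assumes "p \<in> bt_ideal n" shows "rep laurent_u c p f w = 0"
proof -
  define K where "K = {p \<in> carrier FA. \<forall>f w. rep laurent_u c p f w = 0}"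
  have minus: "- p \<in> carrier FA" if "p \<in> carrier FA" for p using that by simp
  have "ideal K FA"
  proof (rule idealI[OF FA.ring_axioms])
    show "subgroup K (add_monoid FA)"
    proof (rule FA.add.subgroupI)
      show "K \<subseteq> carrier FA" by (auto simp: K_def)
      have "0 \<in> K" by (simp add: K_def rep_zero)
      then show "K \<noteq> {}" by blast
      fix p assume p: "p \<in> K"
      then show "\<ominus>\<^bsub>FA\<^esub> p \<in> K"
        using FA_uminus[of p] minus[of p] by (simp add: K_def rep_uminus del: free_algebra_simps)
      fix q assume q: "q \<in> K"
      then show "p \<oplus>\<^bsub>FA\<^esub> q \<in> K"
        using p FA.a_closed[of p q] by (simp add: K_def rep_add)
    qed
    fix p x assume p: "p \<in> K" and x: "x \<in> carrier FA"
    have "rep laurent_u c p f = (\<lambda>w. 0)" for f using p by (auto simp: K_def)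
    then show "x \<otimes>\<^bsub>FA\<^esub> p \<in> K"
      using p x FA.m_closed[of x p] by (simp add: K_def rep_conv rep_arg_zero)
    show "p \<otimes>\<^bsub>FA\<^esub> x \<in> K"
      using p x FA.m_closed[of p x] by (simp add: K_def rep_conv)
  qed
  moreover have "{p \<ominus>\<^bsub>FA\<^esub> q | p q. (p, q) \<in> bt_relations n} \<subseteq> K"
  proof clarify
    fix p q assume pq: "(p, q) \<in> bt_relations n"
    note c = bt_relations_closed[OF pq]
    have "p \<ominus>\<^bsub>FA\<^esub> q = p + - q"
      unfolding a_minus_def FA_uminus[OF c(2)] by simp
    moreover have "rep laurent_u c (p + - q) f w = 0" for f w
      unfolding rep_add rep_uminus rep_relations[OF pq] by simp
    ultimately show "p \<ominus>\<^bsub>FA\<^esub> q \<in> K"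
      using FA.minus_closed[OF c] unfolding K_def by simp
  qed
  ultimately have "bt_ideal n \<subseteq> K"
    unfolding bt_ideal_def by (rule FA.genideal_minimal)
  then show ?thesis using assms by (auto simp: K_def)
qed

text \<open>The value does not depend on the representative chosen, by \<open>rep_ideal\<close>.\<close>

definition bt_rep :: "(nat \<Rightarrow> nat) \<Rightarrow> (bt_gen list \<Rightarrow>\<^sub>0 laurent) set \<Rightarrow> ((nat \<Rightarrow> nat) \<Rightarrow> laurent) \<Rightarrow> (nat \<Rightarrow> nat) \<Rightarrow> laurent" where
  "bt_rep c X = rep laurent_u c (SOME p. p \<in> X)"

lemma bt_rep_cl:
  assumes p: "p \<in> carrier FA" shows "bt_rep c (cl p) = rep laurent_u c p"
proof (intro ext)
  fix f w
  define q where "q = (SOME q. q \<in> cl p)"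
  have "q \<in> cl p" unfolding q_def by (rule someI[of _ p]) (rule sq.a_rcos_self[OF p])
  then obtain i where "i \<in> bt_ideal n" "q = i + p" by (auto simp: a_r_coset_def r_coset_def)
  then show "bt_rep c (cl p) f w = rep laurent_u c p f w"
    using rep_ideal by (simp add: bt_rep_def flip: q_def) (simp add: rep_add)
qed

lemma bt_rep_mult:
  assumes "X \<in> carrier BA" "Y \<in> carrier BA"
  shows "bt_rep c (X \<otimes>\<^bsub>BA\<^esub> Y) f = bt_rep c X (bt_rep c Y f)"
proof -
  obtain p q where pq: "p \<in> carrier FA" "X = cl p" "q \<in> carrier FA" "Y = cl q"
    using assms by (auto simp: carrier_BA)
  have "bt_rep c (X \<otimes>\<^bsub>BA\<^esub> Y) = rep laurent_u c (p \<otimes>\<^bsub>FA\<^esub> q)"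
    unfolding pq(2,4) cl_mult[OF pq(1,3)] by (rule bt_rep_cl[OF FA.m_closed[OF pq(1,3)]])
  then show ?thesis
    unfolding pq(2,4) bt_rep_cl[OF pq(1)] bt_rep_cl[OF pq(3)] by (simp add: fun_eq_iff rep_conv)
qed

lemma bt_rep_one: "bt_rep c \<one>\<^bsub>BA\<^esub> f = f"
  unfolding cl_one bt_rep_cl[OF FA.one_closed] by (simp add: fun_eq_iff rep_single rep_word_Nil)

lemma linear_functional_bt_rep: "linear_functional BA (\<lambda>X. bt_rep c X f w)"
  unfolding linear_functional_def
proof (intro conjI ballI allI)
  fix X assume "X \<in> carrier BA"
  then obtain p where p: "p \<in> carrier FA" "X = cl p" by (auto simp: carrier_BA)
  show "bt_rep c (a \<odot>\<^bsub>BA\<^esub> X) f w = a * bt_rep c X f w" for a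
    unfolding p(2) cl_smult[OF p(1)] bt_rep_cl[OF p(1)]
    using FA.smult_closed[OF _ p(1), of a] by (subst bt_rep_cl) (simp_all add: rep_scale)
  fix Y assume "Y \<in> carrier BA"
  then obtain q where q: "q \<in> carrier FA" "Y = cl q" by (auto simp: carrier_BA)
  show "bt_rep c (X \<oplus>\<^bsub>BA\<^esub> Y) f w = bt_rep c X f w + bt_rep c Y f w"
    unfolding p(2) q(2) cl_add[OF p(1) q(1)] bt_rep_cl[OF p(1)] bt_rep_cl[OF q(1)]
      bt_rep_cl[OF FA.a_closed[OF p(1) q(1)]] by (simp add: rep_add)
qed

lemma bt_rep_T: "i \<in> {1..<n} \<Longrightarrow> bt_rep c (bt_T n i) = rep_gen laurent_u c (T i)"
  unfolding bt_T_def
  by (subst bt_rep_cl, rule bt_word_closed)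
    (auto simp: gens fun_eq_iff rep_single rep_word_Cons rep_word_Nil simp del: rep_gen.simps)

lemma bt_rep_E: "i \<in> {1..<n} \<Longrightarrow> bt_rep c (bt_E n i) = diag c i (Suc i)"
  unfolding bt_E_def rep_gen_E[of laurent_u c i, symmetric]
  by (subst bt_rep_cl, rule bt_word_closed)
    (auto simp: gens fun_eq_iff rep_single rep_word_Cons rep_word_Nil simp del: rep_gen.simps)

text \<open>By \<open>tie_down\<close> the claim for \<open>i + 1\<close> gives the claim for \<open>i\<close> on functions in the image of \<open>T\<^sub>i\<close>, and
  \<open>T\<^sub>i\<close> acts surjectively because it is a unit.\<close>

lemma bt_rep_tie:
  assumes "1 \<le> i" "i < j" "j \<le> n"
  shows "bt_rep c (BA.tie i j) f = diag c i j f"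
  using assms
proof (induction i arbitrary: f rule: BA.tie_induct)
  case (base i)
  then show ?case by (simp add: BA.tie_base bt_rep_E)
next
  case (step i)
  have i: "i \<in> {1..<n}" using step by auto
  have tie: "BA.tie (Suc i) j \<in> carrier BA" "BA.tie i j \<in> carrier BA"
    using step by (auto intro!: BA.tie_closed)
  have tw: "bt_rep c (BA.tie i j) (rep_gen laurent_u c (T i) g) = diag c i j (rep_gen laurent_u c (T i) g)" for g
  proof -
    have "bt_rep c (BA.tie i j) (rep_gen laurent_u c (T i) g) = bt_rep c (BA.tie i j \<otimes>\<^bsub>BA\<^esub> bt_T n i) g"
      using bt_rep_mult[OF tie(2) bt_T_closed[OF i]] bt_rep_T[OF i] by simp
    also have "\<dots> = bt_rep c (bt_T n i \<otimes>\<^bsub>BA\<^esub> BA.tie (Suc i) j) g"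
      using BA.tie_down[of i j] step by simp
    also have "\<dots> = rep_gen laurent_u c (T i) (diag c (Suc i) j g)"
      using bt_rep_mult[OF bt_T_closed[OF i] tie(1)] bt_rep_T[OF i] step.IH by simp
    also have "\<dots> = diag c i j (rep_gen laurent_u c (T i) g)"
    proof -
      have "adj i (Suc i) = i" "adj i j = j" using step by (auto simp: Transposition.transpose_def)
      then show ?thesis using rep_T_diag[of laurent_u c i "Suc i" j g] by simp
    qed
    finally show ?thesis .
  qed
  have u: "bt_T n i \<in> Units BA" by (rule BA.t_unit[OF i])
  let ?g = "bt_rep c (inv\<^bsub>BA\<^esub> bt_T n i) f"
  have "f = bt_rep c (bt_T n i \<otimes>\<^bsub>BA\<^esub> inv\<^bsub>BA\<^esub> bt_T n i) f" using u by (simp add: bt_rep_one)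
  also have "\<dots> = rep_gen laurent_u c (T i) ?g"
    using bt_rep_mult[OF bt_T_closed[OF i] BA.inv_t_closed[OF i]] bt_rep_T[OF i] by simp
  finally show ?case using tw[of ?g] by metis
qed

lemma bt_rep_finprod:
  assumes "finite A" "BA.commuting F A"
    and "\<And>x g. x \<in> A \<Longrightarrow> bt_rep c (F x) g = (\<lambda>w. if P x w then g w else 0)"
  shows "bt_rep c (finprod BA F A) g = (\<lambda>w. if \<forall>x\<in>A. P x w then g w else 0)"
  using assms
proof (induction A rule: finite_induct)
  case empty
  then show ?case by (simp add: bt_rep_one)
next
  case (insert x A)
  note comm = BA.commuting_insertD[OF insert.prems(1)]
  have c: "F x \<in> carrier BA" "finprod BA F A \<in> carrier BA"
    using BA.commutingD[OF insert.prems(1)] BA.finprod_commuting_closed[OF insert.hyps(1) comm] by auto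
  have IH: "bt_rep c (finprod BA F A) g = (\<lambda>w. if \<forall>x\<in>A. P x w then g w else 0)"
    by (rule insert.IH[OF comm insert.prems(2)]) simp
  show ?case
    unfolding BA.finprod_commuting_insert[OF insert.hyps(1) insert.prems(1) insert.hyps(2)]
      bt_rep_mult[OF c] IH insert.prems(2)[OF insertI1] by (simp add: fun_eq_iff)
qed

lemma bt_rep_tie_block:
  assumes I: "I \<subseteq> {1..n}"
  shows "bt_rep c (BA.tie_block I) g = (\<lambda>w. if \<forall>a\<in>I. \<forall>b\<in>I. c (w a) = c (w b) then g w else 0)"
proof -
  have eq: "bt_rep c (BA.tie_block I) g =
      (\<lambda>w. if \<forall>p\<in>{(i, j) \<in> I \<times> I. i < j}. c (w (fst p)) = c (w (snd p)) then g w else 0)"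
    unfolding BA.tie_block_def
  proof (rule bt_rep_finprod[OF BA.finite_pairs[OF I] BA.commuting_ties[OF I]])
    fix p g assume "p \<in> {(i, j) \<in> I \<times> I. i < j}"
    then obtain i j where p: "p = (i, j)" "i < j" "i \<in> {1..n}" "j \<in> {1..n}" using I by blast
    then show "bt_rep c (case p of (i, j) \<Rightarrow> BA.tie i j) g = (\<lambda>w. if c (w (fst p)) = c (w (snd p)) then g w else 0)"
      using bt_rep_tie[of i j c g] by (simp add: fun_eq_iff diag_def)
  qed
  have iff: "(\<forall>p\<in>{(i, j) \<in> I \<times> I. i < j}. c (w (fst p)) = c (w (snd p))) \<longleftrightarrow>
      (\<forall>a\<in>I. \<forall>b\<in>I. c (w a) = c (w b))" for w :: "nat \<Rightarrow> nat"
  proof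
    assume h: "\<forall>p\<in>{(i, j) \<in> I \<times> I. i < j}. c (w (fst p)) = c (w (snd p))"
    have "c (w a) = c (w b)" if "a \<in> I" "b \<in> I" "a < b" for a b using h that by auto
    then show "\<forall>a\<in>I. \<forall>b\<in>I. c (w a) = c (w b)" by (metis linorder_neqE_nat)
  qed auto
  show ?thesis unfolding eq iff ..
qed

lemma bt_rep_tie_partition:
  assumes A: "partition_on {1..n} A"
  shows "bt_rep c (BA.tie_partition A) g =
    (\<lambda>w. if \<forall>I\<in>A. \<forall>a\<in>I. \<forall>b\<in>I. c (w a) = c (w b) then g w else 0)"
  unfolding BA.tie_partition_def
  by (rule bt_rep_finprod[OF BA.finite_partition[OF A] BA.commuting_blocks[OF A]])
    (rule bt_rep_tie_block[OF BA.partition_blockD[OF A]])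

text \<open>Reading a reduced word from left to right, starting at the identity arrangement, every letter meets
  an ascent; there \<open>T\<^sub>i\<close> evaluates its argument at the swapped arrangement, whatever the colours.\<close>

lemma rep_word_reduced:
  assumes "w permutes {1..n}" "reduced_word n w is"
  shows "rep_word laurent_u c (map T is) f id = f w"
  using assms
proof (induction "is" arbitrary: w f rule: rev_induct)
  case Nil
  then show ?case by (simp add: reduced_word_iff word_perm_Nil rep_word_Nil)
next
  case (snoc i js)
  have i: "i \<in> {1..<n}" using snoc.prems by (simp add: reduced_word_iff)
  have red: "w (Suc i) < w i" "reduced_word n (w \<circ> adj i) js"
    using snoc.prems unfolding reduced_word_snoc[OF snoc.prems(1) i] by auto
  have w': "w \<circ> adj i permutes {1..n}" by (rule permutes_comp_adj[OF snoc.prems(1) i])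
  have "rep_word laurent_u c (map T (js @ [i])) f id = rep_word laurent_u c (map T js) (rep_gen laurent_u c (T i) f) id"
    by (simp add: rep_word_append rep_word_Cons rep_word_Nil del: rep_gen.simps)
  also have "\<dots> = rep_gen laurent_u c (T i) f (w \<circ> adj i)"
    by (rule snoc.IH[OF w' red(2)])
  also have "\<dots> = f w" using red(1) by (simp add: adj_adj)
  finally show ?case .
qed

lemma bt_rep_braid_perm:
  assumes w: "w permutes {1..n}" shows "bt_rep c (BA.braid_perm w) f id = f w"
proof -
  obtain "is" where "is": "reduced_word n w is" using reduced_word_ex[OF w] by blast
  have gs: "set (map T is) \<subseteq> bt_gens n"
    using "is" by (auto simp: reduced_word_iff bt_gens_def)
  have m: "map bt_gen_class (map T is) = map (bt_T n) is" by (simp add: bt_gen_class_simps)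
  have "BA.braid_perm w = cl (bt_word (map T is))"
    unfolding BA.braid_perm_eq[OF w "is"] cl_word[OF gs] m ..
  then show ?thesis
    using bt_rep_cl[OF bt_word_closed[OF gs]] rep_word_reduced[OF w "is"] by (simp add: rep_single)
qed

definition compatible :: "(nat \<Rightarrow> nat) \<Rightarrow> nat set set \<Rightarrow> bool" where
  "compatible c A \<longleftrightarrow> (\<forall>I\<in>A. \<forall>a\<in>I. \<forall>b\<in>I. c a = c b)"

abbreviation std :: "nat set set \<times> (nat \<Rightarrow> nat) \<Rightarrow> (bt_gen list \<Rightarrow>\<^sub>0 laurent) set" where
  "std x \<equiv> BA.tie_partition (fst x) \<otimes>\<^bsub>BA\<^esub> BA.braid_perm (snd x)"

abbreviation std_index :: "(nat set set \<times> (nat \<Rightarrow> nat)) set" where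
  "std_index \<equiv> {A. partition_on {1..n} A} \<times> {w. w permutes {1..n}}"

definition matrix_coeff :: "(nat \<Rightarrow> nat) \<Rightarrow> (nat \<Rightarrow> nat) \<Rightarrow> (bt_gen list \<Rightarrow>\<^sub>0 laurent) set \<Rightarrow> laurent" where
  "matrix_coeff c w X = bt_rep c X (\<lambda>v. if v = w then 1 else 0) id"

lemma matrix_coeff_std:
  assumes "x \<in> std_index"
  shows "matrix_coeff c w (std x) = (if compatible c (fst x) \<and> snd x = w then 1 else 0)"
proof -
  have A: "partition_on {1..n} (fst x)" and v: "snd x permutes {1..n}" using assms by auto
  show ?thesis
    unfolding matrix_coeff_def bt_rep_mult[OF BA.tie_partition_closed[OF A] BA.braid_perm_closed[OF v]]
      bt_rep_tie_partition[OF A]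
    by (simp only: id_apply bt_rep_braid_perm[OF v] compatible_def[symmetric]) simp
qed

definition same_block :: "nat set set \<Rightarrow> (nat \<times> nat) set" where
  "same_block A = {(a, b). \<exists>I\<in>A. a \<in> I \<and> b \<in> I}"

text \<open>A colouring whose colour classes are the blocks of \<open>A\<close>.\<close>

definition block_colour :: "nat set set \<Rightarrow> nat \<Rightarrow> nat" where
  "block_colour A a = Min {b \<in> {1..n}. (a, b) \<in> same_block A}"

lemma equiv_same_block: "partition_on {1..n} A \<Longrightarrow> equiv {1..n} (same_block A)"
  unfolding same_block_def by (rule equiv_partition_on)

lemma block_colour_eq_iff:
  assumes A: "partition_on {1..n} A" and ab: "a \<in> {1..n}" "b \<in> {1..n}"
  shows "block_colour A a = block_colour A b \<longleftrightarrow> (a, b) \<in> same_block A"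
proof
  note eq = equiv_same_block[OF A]
  assume "(a, b) \<in> same_block A"
  then have "same_block A `` {a} = same_block A `` {b}" by (rule equiv_class_eq[OF eq])
  then have "{d \<in> {1..n}. (a, d) \<in> same_block A} = {d \<in> {1..n}. (b, d) \<in> same_block A}" by blast
  then show "block_colour A a = block_colour A b" by (simp add: block_colour_def)
next
  note eq = equiv_same_block[OF A]
  have mem: "(d, block_colour A d) \<in> same_block A" if d: "d \<in> {1..n}" for d
  proof -
    have "d \<in> {e \<in> {1..n}. (d, e) \<in> same_block A}" using d eq by (auto simp: equiv_def refl_on_def)
    then have "Min {e \<in> {1..n}. (d, e) \<in> same_block A} \<in> {e \<in> {1..n}. (d, e) \<in> same_block A}"
      by (intro Min_in) auto
    then show ?thesis by (simp add: block_colour_def)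
  qed
  assume same: "block_colour A a = block_colour A b"
  have st: "sym (same_block A)" "trans (same_block A)" using eq by (auto simp: equiv_def)
  show "(a, b) \<in> same_block A"
    using transD[OF st(2) mem[OF ab(1)]] symD[OF st(1) mem[OF ab(2)]] unfolding same .
qed

lemma compatible_block_colour:
  assumes A: "partition_on {1..n} A" and B: "partition_on {1..n} B"
  shows "compatible (block_colour A) B \<longleftrightarrow> same_block B \<subseteq> same_block A"
proof -
  have "a \<in> {1..n}" if "I \<in> B" "a \<in> I" for I a using BA.partition_blockD[OF B] that by blast
  then have "compatible (block_colour A) B \<longleftrightarrow> (\<forall>I\<in>B. \<forall>a\<in>I. \<forall>b\<in>I. (a, b) \<in> same_block A)"
    unfolding compatible_def by (intro ball_cong refl block_colour_eq_iff[OF A])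
  also have "\<dots> \<longleftrightarrow> same_block B \<subseteq> same_block A"
    unfolding same_block_def[of B] by (simp add: subset_iff) blast
  finally show ?thesis .
qed

lemma same_block_inject:
  assumes "partition_on {1..n} A" "partition_on {1..n} B" "same_block A = same_block B"
  shows "A = B"
  using partition_on_eq_quotient[OF assms(1)] partition_on_eq_quotient[OF assms(2)] assms(3)
  unfolding same_block_def by simp

lemma finite_std_index: "finite std_index"
  using finitely_many_partition_on[of "{1..n}"] finite_permutations[of "{1..n}"] by simp

lemma bt_G_image: "bt_G n = std ` std_index"
  unfolding bt_G_standard BA.standard_set_def by force

lemma inj_on_std: "inj_on std std_index"
proof (rule inj_onI)
  fix x y assume x: "x \<in> std_index" and y: "y \<in> std_index" and eq: "std x = std y"
  have A: "partition_on {1..n} (fst x)" "partition_on {1..n} (fst y)" using x y by auto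
  have refl: "compatible (block_colour (fst x)) (fst x)" "compatible (block_colour (fst y)) (fst y)"
    using compatible_block_colour A by simp_all
  have "compatible (block_colour (fst x)) (fst y) \<and> snd y = snd x"
    using matrix_coeff_std[OF x, of "block_colour (fst x)" "snd x"]
      matrix_coeff_std[OF y, of "block_colour (fst x)" "snd x"] eq refl by (auto split: if_splits)
  moreover have "compatible (block_colour (fst y)) (fst x)"
    using matrix_coeff_std[OF y, of "block_colour (fst y)" "snd y"]
      matrix_coeff_std[OF x, of "block_colour (fst y)" "snd y"] eq refl by (auto split: if_splits)
  ultimately show "x = y"
    using same_block_inject[OF A] compatible_block_colour A by (auto simp: prod_eq_iff)
qed

text \<open>With the colouring by the blocks of a partition \<open>B\<close>, the sum contains the coefficients at partitions
  finer than \<open>B\<close> only; those strictly finer vanish by induction on the size of the equivalence relation.\<close>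

lemma std_coeffs_zero:
  assumes sum: "\<And>c w. (\<Sum>x\<in>std_index. a x * matrix_coeff c w (std x)) = 0"
    and x: "x \<in> std_index"
  shows "a x = 0"
  using x
proof (induction "card (same_block (fst x))" arbitrary: x rule: less_induct)
  case less
  have A: "partition_on {1..n} (fst x)" using less.prems by auto
  have fin: "finite (same_block (fst x))"
    by (rule finite_subset[of _ "{1..n} \<times> {1..n}"])
      (use BA.partition_blockD[OF A] in \<open>auto simp: same_block_def\<close>)
  let ?f = "\<lambda>y. a y * matrix_coeff (block_colour (fst x)) (snd x) (std y)"
  have "?f y = 0" if y: "y \<in> std_index - {x}" for y
  proof (cases "compatible (block_colour (fst x)) (fst y) \<and> snd y = snd x")
    case True
    have B: "partition_on {1..n} (fst y)" using y by auto
    have sub: "same_block (fst y) \<subseteq> same_block (fst x)"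
      using True compatible_block_colour[OF A B] by simp
    have "fst y \<noteq> fst x" using True y by (auto simp: prod_eq_iff)
    then have "same_block (fst y) \<noteq> same_block (fst x)" using same_block_inject[OF A B] by auto
    then have "card (same_block (fst y)) < card (same_block (fst x))"
      using sub fin by (intro psubset_card_mono) auto
    then show ?thesis using less.hyps[of y] y by simp
  next
    case False
    then show ?thesis using matrix_coeff_std[of y] y by auto
  qed
  then have "(\<Sum>y\<in>std_index. ?f y) = ?f x"
    using sum.remove[OF finite_std_index less.prems, of ?f] by (simp add: sum.neutral)
  then have "?f x = 0" using sum by metis
  moreover have "compatible (block_colour (fst x)) (fst x)"
    using compatible_block_colour[OF A A] by simp
  ultimately show ?case using matrix_coeff_std[OF less.prems] by simp
qed

lemma finite_bt_G: "finite (bt_G n)"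
  unfolding bt_G_image by (rule finite_imageI[OF finite_std_index])

lemma module_basis_bt: "module_basis class_ring BA (bt_G n)"
proof -
  have sub: "bt_G n \<subseteq> carrier BA" unfolding bt_G_standard by (rule BA.standard_set_closed)
  have mod: "Module.module class_ring BA" by (rule BA.module_axioms)
  have "\<not> BA.lin_dep (bt_G n)"
  proof (rule BA.finite_lin_indpt2[OF finite_bt_G sub])
    fix a assume z: "BA.lincomb a (bt_G n) = \<zero>\<^bsub>BA\<^esub>"
    have "(\<Sum>x\<in>std_index. a (std x) * matrix_coeff c w (std x)) = 0" for c w
    proof -
      have lf: "linear_functional BA (matrix_coeff c w)"
        unfolding matrix_coeff_def by (rule linear_functional_bt_rep)
      have "(\<Sum>x\<in>std_index. a (std x) * matrix_coeff c w (std x)) = (\<Sum>X\<in>bt_G n. a X * matrix_coeff c w X)"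
        unfolding bt_G_image sum.reindex[OF inj_on_std] by (simp add: comp_def)
      also have "\<dots> = matrix_coeff c w (BA.lincomb a (bt_G n))"
        by (rule lincomb_functional[OF mod lf finite_bt_G sub, symmetric])
      also have "\<dots> = 0"
        unfolding z using lincomb_functional[OF mod lf, of "{}"] by (simp add: BA.lincomb_def)
      finally show ?thesis .
    qed
    then have "a (std x) = 0" if "x \<in> std_index" for x
      using std_coeffs_zero[of "\<lambda>x. a (std x)" x] that by blast
    then show "\<forall>X\<in>bt_G n. a X = \<zero>\<^bsub>class_ring\<^esub>" unfolding bt_G_image by auto
  qed
  then show ?thesis
    unfolding module_basis_def using mod sub bt_span by blast
qed

lemma module_basis_bt_extension:
  fixes h :: "laurent \<Rightarrow> 's::comm_ring_1"
  assumes "\<And>a b. h (a + b) = h a + h b" "\<And>a b. h (a * b) = h a * h b" "h 1 = 1"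
  shows "module_basis (class_ring :: 's ring) (extension_of_scalars class_ring BA class_ring h)
    (canonical_map class_ring BA class_ring h ` bt_G n)"
proof -
  interpret free_base_change BA h "bt_G n"
    by (intro free_base_change.intro base_change.intro base_change_axioms.intro finite_free_module.intro
        finite_free_module_axioms.intro BA.module_axioms assms module_basis_bt finite_bt_G)
  show ?thesis by (rule module_basis_extension)
qed

end

theorem theorem3:
  fixes n :: nat
  shows "module_basis laurent_ring (bt_algebra n) (bt_G n) \<and>
    module_basis ratfun_field (bt_algebra_generic n)
      (canonical_map laurent_ring (bt_algebra n) ratfun_field laurent_to_ratfun ` bt_G n) \<and>
    module_basis complex_field (bt_algebra_at_1 n)
      (canonical_map laurent_ring (bt_algebra n) complex_field laurent_at_1 ` bt_G n)"
  unfolding bt_algebra_generic_def bt_algebra_at_1_def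
  by (intro conjI module_basis_bt module_basis_bt_extension laurent_to_ratfun_hom laurent_at_1_hom)

end
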